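(* Let $(\Omega,\mathcal F,\mathcal F_t,X_t,P^x)$, $x\in\mathcal X$, be $\mathcal X$-valued càdlàg Markov processes with invariant ergodic measure $\mu_*$ and $L^2(\mu_* )$-generator $(A,D(A))$ (as in the context), and let $\mu$ be an initial distribution. Let $\langle\cdot,\cdot\rangle_\#$ be an inner product on $L^2(\mu_* )$, with induced norm $\|\cdot\|_\#$, such that: 1. the norms $\|\cdot\|_\#$ and $\|\cdot\|$ are equivalent: there exist $0<c\le C<\infty$ such that $c\|g\|\le\|g\|_\#\le C\|g\|$ for all $g\in L^2(\mu_* )$; 2. $\langle g,1\rangle_\#=\langle g,1\rangle$ for all $g\in L^2(\mu_* )$; 3. a Poincaré inequality holds for $\langle\cdot,\cdot\rangle_\#$: there is $\alpha>0$ such that $\|g\|_\#^2\le\alpha\langle -Ag,g\rangle_\#$ for all $g\in D(A)$ with $\mu_*[g]=0$. Let $f:\mathcal X\to\mathbb R$ be bounded and measurable, let $\widehat f=f-\mu_*[f]$, let $M_{\pm\widehat f}$ denote the operator of multiplication by $\pm\widehat f$ on $L^2(\mu_* )$, and let $M_{\pm\widehat f}^\dagger$ be its adjoint with respect to $\langle\cdot,\cdot\rangle_\#$. Then, given a time $T>0$ and a confidence level $0<1-\delta<1$, $$P^\mu\left(\frac1T\int_0^T f(X_t)\,dt-\mu_*[f]\in(-r_-,r_+)\right)\ \ge\ 1-\delta,$$ where $$r_\pm=\sqrt{2v_\pm\,\frac1T\log\left(\frac{2N}{\delta}\right)}+b_\pm\,\frac1T\log\left(\frac{2N}{\delta}\right),\qquad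 N=c^{-1}\left\|\frac{d\mu}{d\mu_*}\right\|,$$ $$v_\pm=2\alpha\left\|\tfrac12\left(M_{\pm\widehat f}+M_{\pm\widehat f}^\dagger\right)1\right\|_\#^2,\qquad b_\pm=\alpha\max\left\{0,\ \sup_{\|g\|_\#=1}\langle M_{\pm\widehat f}\,g,g\rangle_\#\right\}.$$
   Context: $\mathcal X$ is a Polish space; the Markov processes are time-homogeneous, and under $P^x$ the initial distribution of $X_0$ is $\delta_x$; for an initial measure $\mu$, $P^\mu=\int P^x\,d\mu(x)$. $\mu_*$ is an invariant ergodic probability measure on $\mathcal X$; $\langle\cdot,\cdot\rangle$ and $\|\cdot\|$ are the scalar product and norm of the real Hilbert space $L^2(\mu_* )$; $\mu_*[f]=\int f\,d\mu_*$; $1$ denotes the constant function equal to one; and $(A,D(A))$ is the generator of the strongly continuous Markov semigroup $T_t[g](x)=E^x[g(X_t)]$ on $L^2(\mu_* )$, where $E^x$ is the expectation with respect to $P^x$. $\frac{d\mu}{d\mu_*}$ is the Radon–Nikodym derivative of $\mu$ with respect to $\mu_*$, and $\left\|\frac{d\mu}{d\mu_*}\right\|$ is its $L^2(\mu_* )$-norm.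
   Formalization: The function f is additionally assumed not to be μ_*-almost everywhere constant; for such f one has v_± = b_± = 0, so r_± = 0, the open interval (-r_-, r_+) is empty, and the claimed bound fails. *)

theory Defs
  imports "HOL-Probability.Probability"
begin

text \<open>
  Time is the half-line of nonnegative reals; \<open>X t\<close> is never constrained for \<open>t < 0\<close>. The measures
  \<open>F\<close> and \<open>\<FF> t\<close> are used as measurable spaces only, so \<open>\<Omega>\<close> is \<open>space F\<close>.
  Measurability of \<open>P\<close> into \<open>prob_algebra F\<close> makes \<open>x \<mapsto> P\<^sup>x E\<close> Borel for every \<open>E \<in> sets F\<close>, so that
  \<open>P\<^sup>\<mu> = \<integral> P\<^sup>x d\<mu>(x)\<close> is the Giry bind \<open>\<mu> \<bind> P\<close>.
\<close>

definition cadlag :: "(real \<Rightarrow> 'a::topological_space) \<Rightarrow> bool" where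
  "cadlag p \<longleftrightarrow>
     (\<forall>t\<ge>0. (p \<longlongrightarrow> p t) (at_right t)) \<and> (\<forall>t>0. \<exists>l. (p \<longlongrightarrow> l) (at_left t))"

definition cadlag_Markov_family ::
  "'w measure \<Rightarrow> (real \<Rightarrow> 'w measure) \<Rightarrow> (real \<Rightarrow> 'w \<Rightarrow> 'a::polish_space) \<Rightarrow> ('a \<Rightarrow> 'w measure) \<Rightarrow> bool"
where
  "cadlag_Markov_family F \<FF> X P \<longleftrightarrow>
     (\<forall>t\<ge>0. subalgebra F (\<FF> t)) \<and>
     (\<forall>s t. 0 \<le> s \<longrightarrow> s \<le> t \<longrightarrow> sets (\<FF> s) \<subseteq> sets (\<FF> t)) \<and>
     (\<forall>t\<ge>0. X t \<in> \<FF> t \<rightarrow>\<^sub>M borel) \<and>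
     (\<forall>\<omega>\<in>space F. cadlag (\<lambda>t. X t \<omega>)) \<and>
     P \<in> borel \<rightarrow>\<^sub>M prob_algebra F \<and>
     (\<forall>x. distr (P x) borel (X 0) = return borel x) \<and>
     (\<forall>x. \<forall>s\<ge>0. \<forall>t\<ge>0. \<forall>B\<in>sets borel.
        AE \<omega> in P x.
          real_cond_exp (P x) (\<FF> s) (\<lambda>\<omega>'. indicator B (X (s + t) \<omega>')) \<omega>
            = measure (P (X s \<omega>)) {\<omega>' \<in> space F. X t \<omega>' \<in> B})"

definition Markov_semigroup ::
  "(real \<Rightarrow> 'w \<Rightarrow> 'a) \<Rightarrow> ('a \<Rightarrow> 'w measure) \<Rightarrow> real \<Rightarrow> ('a \<Rightarrow> real) \<Rightarrow> 'a \<Rightarrow> real"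
where
  "Markov_semigroup X P t g x = (\<integral>\<omega>. g (X t \<omega>) \<partial>P x)"

definition invariant_measure ::
  "(real \<Rightarrow> 'w \<Rightarrow> 'a::polish_space) \<Rightarrow> ('a \<Rightarrow> 'w measure) \<Rightarrow> 'a measure \<Rightarrow> bool"
where
  "invariant_measure X P M \<longleftrightarrow> (\<forall>t\<ge>0. distr (M \<bind> P) borel (X t) = M)"

definition ergodic_measure ::
  "(real \<Rightarrow> 'w \<Rightarrow> 'a::polish_space) \<Rightarrow> ('a \<Rightarrow> 'w measure) \<Rightarrow> 'a measure \<Rightarrow> bool"
where
  "ergodic_measure X P M \<longleftrightarrow>
     (\<forall>B\<in>sets borel.
        (\<forall>t\<ge>0. AE x in M. Markov_semigroup X P t (indicator B) x = indicator B x) \<longrightarrow>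
        measure M B = 0 \<or> measure M B = 1)"

text \<open>
  Elements of \<open>L\<^sup>2(M)\<close> are represented by square-integrable functions, two of them denoting the same
  element iff they agree almost everywhere.
\<close>

definition L2 :: "'a measure \<Rightarrow> ('a \<Rightarrow> real) set" where
  "L2 M = {g \<in> borel_measurable M. integrable M (\<lambda>x. (g x)\<^sup>2)}"

definition L2_inner :: "'a measure \<Rightarrow> ('a \<Rightarrow> real) \<Rightarrow> ('a \<Rightarrow> real) \<Rightarrow> real" where
  "L2_inner M g h = (\<integral>x. g x * h x \<partial>M)"

definition ip_norm :: "(('a \<Rightarrow> real) \<Rightarrow> ('a \<Rightarrow> real) \<Rightarrow> real) \<Rightarrow> ('a \<Rightarrow> real) \<Rightarrow> real" where
  "ip_norm ip g = sqrt (ip g g)"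

abbreviation L2_norm :: "'a measure \<Rightarrow> ('a \<Rightarrow> real) \<Rightarrow> real" where
  "L2_norm M \<equiv> ip_norm (L2_inner M)"

text \<open>
  Definiteness is up to null functions; by Cauchy-Schwarz such an \<open>ip\<close> takes equal values on almost
  everywhere equal arguments, so it is an inner product on the space of equivalence classes.
\<close>

definition L2_inner_product ::
  "'a measure \<Rightarrow> (('a \<Rightarrow> real) \<Rightarrow> ('a \<Rightarrow> real) \<Rightarrow> real) \<Rightarrow> bool"
where
  "L2_inner_product M ip \<longleftrightarrow>
     (\<forall>g\<in>L2 M. \<forall>h\<in>L2 M. ip g h = ip h g) \<and>
     (\<forall>g\<in>L2 M. \<forall>h\<in>L2 M. \<forall>k\<in>L2 M. ip (\<lambda>x. g x + h x) k = ip g k + ip h k) \<and>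
     (\<forall>a. \<forall>g\<in>L2 M. \<forall>h\<in>L2 M. ip (\<lambda>x. a * g x) h = a * ip g h) \<and>
     (\<forall>g\<in>L2 M. 0 \<le> ip g g) \<and>
     (\<forall>g\<in>L2 M. ip g g = 0 \<longleftrightarrow> (AE x in M. g x = 0))"

definition strongly_continuous_L2 ::
  "'a measure \<Rightarrow> (real \<Rightarrow> ('a \<Rightarrow> real) \<Rightarrow> 'a \<Rightarrow> real) \<Rightarrow> bool"
where
  "strongly_continuous_L2 M S \<longleftrightarrow>
     (\<forall>g\<in>L2 M. ((\<lambda>t. L2_norm M (\<lambda>x. S t g x - g x)) \<longlongrightarrow> 0) (at_right 0))"

definition is_generator_value ::
  "'a measure \<Rightarrow> (real \<Rightarrow> ('a \<Rightarrow> real) \<Rightarrow> 'a \<Rightarrow> real) \<Rightarrow> ('a \<Rightarrow> real) \<Rightarrow> ('a \<Rightarrow> real) \<Rightarrow> bool"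
where
  "is_generator_value M S g h \<longleftrightarrow>
     h \<in> L2 M \<and> ((\<lambda>t. L2_norm M (\<lambda>x. (S t g x - g x) / t - h x)) \<longlongrightarrow> 0) (at_right 0)"

definition generator_domain ::
  "'a measure \<Rightarrow> (real \<Rightarrow> ('a \<Rightarrow> real) \<Rightarrow> 'a \<Rightarrow> real) \<Rightarrow> ('a \<Rightarrow> real) set"
where
  "generator_domain M S = {g \<in> L2 M. \<exists>h. is_generator_value M S g h}"

text \<open>The limit defining the generator is unique up to null functions.\<close>

definition generator ::
  "'a measure \<Rightarrow> (real \<Rightarrow> ('a \<Rightarrow> real) \<Rightarrow> 'a \<Rightarrow> real) \<Rightarrow> ('a \<Rightarrow> real) \<Rightarrow> 'a \<Rightarrow> real"
where
  "generator M S g = (SOME h. is_generator_value M S g h)"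

definition mult_op :: "('a \<Rightarrow> real) \<Rightarrow> ('a \<Rightarrow> real) \<Rightarrow> 'a \<Rightarrow> real" where
  "mult_op V g = (\<lambda>x. V x * g x)"

text \<open>
  The adjoint is determined up to null functions. It exists for every bounded operator \<open>B\<close> when the
  norm of \<open>ip\<close> is equivalent to the \<open>L\<^sup>2\<close> norm, by the Riesz representation theorem.
\<close>

definition L2_adjoint ::
  "'a measure \<Rightarrow> (('a \<Rightarrow> real) \<Rightarrow> ('a \<Rightarrow> real) \<Rightarrow> real) \<Rightarrow> (('a \<Rightarrow> real) \<Rightarrow> 'a \<Rightarrow> real)
     \<Rightarrow> ('a \<Rightarrow> real) \<Rightarrow> 'a \<Rightarrow> real"
where
  "L2_adjoint M ip B u = (SOME w. w \<in> L2 M \<and> (\<forall>g\<in>L2 M. ip (B g) u = ip g w))"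

definition variance_const ::
  "'a measure \<Rightarrow> (('a \<Rightarrow> real) \<Rightarrow> ('a \<Rightarrow> real) \<Rightarrow> real) \<Rightarrow> real \<Rightarrow> ('a \<Rightarrow> real) \<Rightarrow> real"
where
  "variance_const M ip \<alpha> V =
     2 * \<alpha> * (ip_norm ip (\<lambda>x. 1/2 * (mult_op V (\<lambda>_. 1) x
                                       + L2_adjoint M ip (mult_op V) (\<lambda>_. 1) x)))\<^sup>2"

definition scale_const ::
  "'a measure \<Rightarrow> (('a \<Rightarrow> real) \<Rightarrow> ('a \<Rightarrow> real) \<Rightarrow> real) \<Rightarrow> real \<Rightarrow> ('a \<Rightarrow> real) \<Rightarrow> real"
where
  "scale_const M ip \<alpha> V =
     \<alpha> * max 0 (SUP g\<in>{g \<in> L2 M. ip_norm ip g = 1}. ip (mult_op V g) g)"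

definition deviation_radius :: "real \<Rightarrow> real \<Rightarrow> real \<Rightarrow> real \<Rightarrow> real \<Rightarrow> real" where
  "deviation_radius T \<delta> N v b =
     sqrt (2 * v * (1 / T) * ln (2 * N / \<delta>)) + b * (1 / T) * ln (2 * N / \<delta>)"

end

theory Submission
  imports Defs
begin

text \<open>
  The proof is a Chernoff bound for an exponential moment that grows at most at the rate of a
  perturbed quadratic form.

  For a bounded potential \<open>W\<close> let \<open>u t x = E\<^sup>x exp (\<integral>\<^sub>0\<^sup>t W (X s) ds)\<close>. Formally \<open>u\<close> solves
  \<open>u' = A u + W u\<close> with \<open>u 0 = 1\<close>, hence the square of its norm for \<open>ip\<close> has the derivative
  \<open>2 ip (A u + W u) u\<close>, and a bound \<open>ip (A g + W g) g \<le> \<Lambda> ip g g\<close> gives \<open>ip_norm ip (u S) \<le> exp (\<Lambda> S)\<close>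
  (\<open>energy_growth\<close>). Since \<open>E\<^sup>\<mu> exp (\<integral>\<^sub>0\<^sup>S W (X s) ds)\<close> is the \<open>L\<^sup>2\<close> inner product of the density of \<open>\<mu>\<close>
  with \<open>u S\<close>, it is at most \<open>N exp (\<Lambda> S)\<close>.

  For \<open>W = \<kappa> V\<close> with \<open>V\<close> centred, the rate \<open>\<Lambda>\<close> is found in \<open>perturbed_form_bound\<close>. Split \<open>g\<close> into its mean \<open>a\<close>
  and a centred part \<open>g\<^sub>0\<close>. These are orthogonal for \<open>ip\<close>, because \<open>ip\<close> and the \<open>L\<^sup>2\<close> inner product agree
  against \<open>1\<close>. The Poincare inequality makes the generator contribute at most
  \<open>- (ip_norm ip g\<^sub>0)\<^sup>2 / \<alpha>\<close>; the potential contributes nothing at order \<open>a\<^sup>2\<close>, a mixed term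
  \<open>2 a ip g\<^sub>0 (1/2 (V + V\<^sup>\<dagger> 1))\<close> controlled by the variance constant \<open>v\<close>, where \<open>V\<^sup>\<dagger>\<close> is the adjoint of
  multiplication by \<open>V\<close>, and a quadratic term in \<open>g\<^sub>0\<close> controlled by the scale constant \<open>b\<close>. Completing the
  square gives \<open>\<Lambda> = \<kappa>\<^sup>2 v / (2 (1 - \<kappa> b))\<close>, the exponent of Bernstein's inequality, and the optimal \<open>\<kappa>\<close> gives the
  stated radius (\<open>upper_tail_bound\<close>). The theorem is the union of the two tails \<open>V\<close> and \<open>- V\<close>.

  Two points need work. The equation for \<open>u\<close> has to be justified, in particular that \<open>u t\<close> is in the domain
  of the generator. Both come from a single limit: with \<open>T\<close> the transition semigroup and \<open>Q\<close> the Feynman-Kac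
  semigroup of the potential \<open>W\<close>, \<open>(Q h g - T h g) / h\<close> tends to \<open>W g\<close> in \<open>L\<^sup>2\<close> for every bounded \<open>g\<close> (\<open>Q_minus_T_derivative\<close>).
  For \<open>g = 1\<close> this differentiates \<open>u (t + h) - u t = Q t (Q h 1 - T h 1)\<close>, and for \<open>g = u t\<close> it
  then differentiates \<open>T h (u t) - u t = (u (t + h) - u t) - (Q h (u t) - T h (u t))\<close>. The semigroup
  property of \<open>Q\<close> is a Markov property for functionals of a whole path segment, derived in
  \<open>Feynman_Kac_Markov_property\<close> from the Markov property for one future time.
  The other point is the existence of \<open>V\<^sup>\<dagger> 1\<close>, which needs the Riesz representation theorem for \<open>ip\<close>, hence
  completeness of \<open>L\<^sup>2\<close>.
\<close>

section \<open>Inner products on square-integrable functions\<close>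

lemma L2_measurable [measurable_dest]: "g \<in> L2 M \<Longrightarrow> g \<in> borel_measurable M"
  by (simp add: L2_def)

lemma integrable_mult_L2:
  assumes "g \<in> L2 M" "h \<in> L2 M"
  shows "integrable M (\<lambda>x. g x * h x)"
proof (rule Bochner_Integration.integrable_bound)
  show "integrable M (\<lambda>x. (g x)\<^sup>2 + (h x)\<^sup>2)"
    using assms by (auto simp: L2_def)
  show "(\<lambda>x. g x * h x) \<in> borel_measurable M"
    using assms by (auto simp: L2_def)
  show "AE x in M. norm (g x * h x) \<le> norm ((g x)\<^sup>2 + (h x)\<^sup>2)"
  proof (rule AE_I2)
    fix x
    have "0 \<le> (\<bar>g x\<bar> - \<bar>h x\<bar>)\<^sup>2" by simp
    then have "2 * (\<bar>g x\<bar> * \<bar>h x\<bar>) \<le> (g x)\<^sup>2 + (h x)\<^sup>2"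
      by (simp add: power2_diff)
    moreover have "0 \<le> \<bar>g x\<bar> * \<bar>h x\<bar>" by simp
    ultimately show "norm (g x * h x) \<le> norm ((g x)\<^sup>2 + (h x)\<^sup>2)"
      unfolding real_norm_def abs_mult by linarith
  qed
qed

lemma L2_scale [intro]: "g \<in> L2 M \<Longrightarrow> (\<lambda>x. a * g x) \<in> L2 M"
  by (auto simp: L2_def power_mult_distrib)

lemma L2_add [intro]:
  assumes "g \<in> L2 M" "h \<in> L2 M"
  shows "(\<lambda>x. g x + h x) \<in> L2 M"
proof -
  have "integrable M (\<lambda>x. (g x)\<^sup>2 + (h x)\<^sup>2 + 2 * (g x * h x))"
    using assms integrable_mult_L2[OF assms] by (auto simp: L2_def)
  then show ?thesis
    using assms by (auto simp: L2_def power2_sum mult.assoc)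
qed

lemma L2_diff [intro]: "g \<in> L2 M \<Longrightarrow> h \<in> L2 M \<Longrightarrow> (\<lambda>x. g x - h x) \<in> L2 M"
  using L2_add[of g M "\<lambda>x. (-1) * h x"] L2_scale[of h M "-1"] by simp

lemma L2_uminus [intro]: "g \<in> L2 M \<Longrightarrow> (\<lambda>x. - g x) \<in> L2 M"
  by (auto simp: L2_def)

lemma L2_divide [intro]: "g \<in> L2 M \<Longrightarrow> (\<lambda>x. g x / a) \<in> L2 M"
  using L2_scale[of g M "1 / a"] by simp

lemma L2_bounded_mult:
  assumes "g \<in> L2 M" "V \<in> borel_measurable M" "\<And>x. \<bar>V x\<bar> \<le> K"
  shows "(\<lambda>x. V x * g x) \<in> L2 M"
proof -
  have "integrable M (\<lambda>x. (V x * g x)\<^sup>2)"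
  proof (rule Bochner_Integration.integrable_bound)
    show "integrable M (\<lambda>x. K\<^sup>2 * (g x)\<^sup>2)" using assms by (auto simp: L2_def)
    show "(\<lambda>x. (V x * g x)\<^sup>2) \<in> borel_measurable M" using assms by (auto simp: L2_def)
    show "AE x in M. norm ((V x * g x)\<^sup>2) \<le> norm (K\<^sup>2 * (g x)\<^sup>2)"
      using assms(3) by (auto simp: power_mult_distrib intro!: mult_right_mono abs_le_square_iff[THEN iffD1] order_trans[OF _ abs_ge_self])
  qed
  then show ?thesis using assms by (auto simp: L2_def)
qed

lemma (in finite_measure) bounded_in_L2:
  assumes "g \<in> borel_measurable M" "\<And>x. \<bar>g x\<bar> \<le> K"
  shows "g \<in> L2 M"
  using L2_bounded_mult[of "\<lambda>_. 1" M g K] assms by (simp add: L2_def)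

lemma L2_inner_product_L2_inner: "L2_inner_product M (L2_inner M)"
  unfolding L2_inner_product_def L2_inner_def
proof (intro conjI ballI allI)
  fix g h k :: "'a \<Rightarrow> real" and a :: real
  assume g: "g \<in> L2 M" 
  show "0 \<le> (\<integral>x. g x * g x \<partial>M)" by simp
  have "(\<integral>x. g x * g x \<partial>M) = 0 \<longleftrightarrow> (AE x in M. g x * g x = 0)"
    by (rule integral_nonneg_eq_0_iff_AE) (use integrable_mult_L2[OF g g] in auto)
  then show "(\<integral>x. g x * g x \<partial>M) = 0 \<longleftrightarrow> (AE x in M. g x = 0)" by simp
  assume h: "h \<in> L2 M"
  show "(\<integral>x. g x * h x \<partial>M) = (\<integral>x. h x * g x \<partial>M)" by (simp add: mult.commute)
  show "(\<integral>x. a * g x * h x \<partial>M) = a * (\<integral>x. g x * h x \<partial>M)" by (simp add: mult.assoc)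
  assume k: "k \<in> L2 M"
  show "(\<integral>x. (g x + h x) * k x \<partial>M) = (\<integral>x. g x * k x \<partial>M) + (\<integral>x. h x * k x \<partial>M)"
    using integrable_mult_L2[OF g k] integrable_mult_L2[OF h k] by (simp add: distrib_right)
qed

text \<open>
  The \<open>L\<^sup>2\<close> inner product and the modified one are both instances, so that the facts below serve for both.
\<close>

locale L2_form =
  fixes M :: "'a measure" and ip :: "('a \<Rightarrow> real) \<Rightarrow> ('a \<Rightarrow> real) \<Rightarrow> real"
  assumes L2_inner_product: "L2_inner_product M ip"
begin

lemma ip_commute: "g \<in> L2 M \<Longrightarrow> h \<in> L2 M \<Longrightarrow> ip g h = ip h g"
  and ip_add_left: "g \<in> L2 M \<Longrightarrow> h \<in> L2 M \<Longrightarrow> k \<in> L2 M \<Longrightarrow> ip (\<lambda>x. g x + h x) k = ip g k + ip h k"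
  and ip_scale_left: "g \<in> L2 M \<Longrightarrow> h \<in> L2 M \<Longrightarrow> ip (\<lambda>x. a * g x) h = a * ip g h"
  and ip_nonneg: "g \<in> L2 M \<Longrightarrow> 0 \<le> ip g g"
  and ip_eq_0_iff: "g \<in> L2 M \<Longrightarrow> ip g g = 0 \<longleftrightarrow> (AE x in M. g x = 0)"
  using L2_inner_product unfolding L2_inner_product_def by blast+

lemma ip_add_right: "g \<in> L2 M \<Longrightarrow> h \<in> L2 M \<Longrightarrow> k \<in> L2 M \<Longrightarrow> ip k (\<lambda>x. g x + h x) = ip k g + ip k h"
  using ip_add_left[of g h k] ip_commute[of k] L2_add[of g M h] by simp

lemma ip_scale_right: "g \<in> L2 M \<Longrightarrow> h \<in> L2 M \<Longrightarrow> ip h (\<lambda>x. a * g x) = a * ip h g"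
  using ip_scale_left[of g h a] ip_commute[of h] L2_scale[of g M a] by simp

lemma ip_uminus_left: "g \<in> L2 M \<Longrightarrow> h \<in> L2 M \<Longrightarrow> ip (\<lambda>x. - g x) h = - ip g h"
  using ip_scale_left[of g h "-1"] by simp

lemma ip_diff_left: "g \<in> L2 M \<Longrightarrow> h \<in> L2 M \<Longrightarrow> k \<in> L2 M \<Longrightarrow> ip (\<lambda>x. g x - h x) k = ip g k - ip h k"
  using ip_add_left[of g "\<lambda>x. - h x" k] ip_uminus_left[of h k] L2_uminus[of h M] by simp

lemma ip_norm_nonneg: "g \<in> L2 M \<Longrightarrow> 0 \<le> ip_norm ip g"
  and ip_norm_power2: "g \<in> L2 M \<Longrightarrow> (ip_norm ip g)\<^sup>2 = ip g g"
  by (simp_all add: ip_norm_def ip_nonneg)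

lemma ip_norm_scale: "g \<in> L2 M \<Longrightarrow> ip_norm ip (\<lambda>x. a * g x) = \<bar>a\<bar> * ip_norm ip g"
  using L2_scale[of g M a]
  by (simp add: ip_norm_def ip_scale_left ip_scale_right real_sqrt_mult flip: mult.assoc)

lemma ip_square_add_scale:
  assumes "g \<in> L2 M" "h \<in> L2 M"
  shows "ip (\<lambda>x. g x + s * h x) (\<lambda>x. g x + s * h x) = ip g g + 2 * s * ip g h + s\<^sup>2 * ip h h"
proof -
  have sh: "(\<lambda>x. s * h x) \<in> L2 M" using assms by auto
  show ?thesis
    using assms sh L2_add[OF assms(1) sh] ip_commute[OF assms]
    by (simp add: ip_add_left ip_add_right ip_scale_left ip_scale_right power2_eq_square algebra_simps)
qed

lemma Cauchy_Schwarz: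
  assumes g: "g \<in> L2 M" and h: "h \<in> L2 M"
  shows "\<bar>ip g h\<bar> \<le> ip_norm ip g * ip_norm ip h"
proof -
  have pos: "0 \<le> ip g g + 2 * s * ip g h + s\<^sup>2 * ip h h" for s
    using ip_nonneg[OF L2_add[OF g L2_scale[OF h, of s]]] by (simp add: ip_square_add_scale g h)
  have "(ip g h)\<^sup>2 \<le> ip g g * ip h h"
  proof (cases "ip h h = 0")
    case True
    have "ip g h = 0"
    proof (rule ccontr)
      assume "ip g h \<noteq> 0"
      then show False
        \<comment> \<open>As \<open>ip h h = 0\<close>, the polynomial is affine in \<open>s\<close>; its value here is \<open>- 1\<close>.\<close>
        using pos[of "- (ip g g + 1) / (2 * ip g h)"] True by (simp add: field_simps)
    qed
    then show ?thesis using True by simp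
  next
    case False
    then have "0 < ip h h" using ip_nonneg[OF h] by simp
    then show ?thesis
      using pos[of "- ip g h / ip h h"] by (simp add: field_simps power2_eq_square)
  qed
  then have "sqrt ((ip g h)\<^sup>2) \<le> sqrt (ip g g * ip h h)" by (rule real_sqrt_le_mono)
  then show ?thesis by (simp add: ip_norm_def real_sqrt_mult)
qed

lemma ip_norm_triangle:
  assumes g: "g \<in> L2 M" and h: "h \<in> L2 M"
  shows "ip_norm ip (\<lambda>x. g x + h x) \<le> ip_norm ip g + ip_norm ip h"
proof (rule power2_le_imp_le)
  show "0 \<le> ip_norm ip g + ip_norm ip h" using g h by (simp add: ip_norm_nonneg)
  have "ip (\<lambda>x. g x + h x) (\<lambda>x. g x + h x) = ip g g + 2 * ip g h + ip h h"
    using ip_square_add_scale[OF g h, of 1] by simp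
  then show "(ip_norm ip (\<lambda>x. g x + h x))\<^sup>2 \<le> (ip_norm ip g + ip_norm ip h)\<^sup>2"
    using Cauchy_Schwarz[OF g h] g h by (simp add: power2_sum ip_norm_power2 L2_add)
qed

text \<open>
  The difference of two representatives of one class has norm zero, so Cauchy-Schwarz makes it invisible
  to \<open>ip\<close>.
\<close>

lemma ip_cong_AE:
  assumes "g \<in> L2 M" "g' \<in> L2 M" "h \<in> L2 M" and ae: "AE x in M. g x = g' x"
  shows "ip g h = ip g' h"
proof -
  have "ip_norm ip (\<lambda>x. g x - g' x) = 0"
    using ip_eq_0_iff[of "\<lambda>x. g x - g' x"] assms by (auto simp: ip_norm_def)
  then show ?thesis
    using Cauchy_Schwarz[of "\<lambda>x. g x - g' x" h] assms by (auto simp: ip_diff_left)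
qed

end

lemma (in prob_space) abs_integral_le_L2_norm:
  assumes "g \<in> L2 M"
  shows "\<bar>\<integral>x. g x \<partial>M\<bar> \<le> L2_norm M g"
proof -
  interpret L2_form M "L2_inner M" by unfold_locales (rule L2_inner_product_L2_inner)
  have "(\<lambda>_. 1) \<in> L2 M" by (rule bounded_in_L2[of _ 1]) auto
  from Cauchy_Schwarz[OF assms this] show ?thesis
    by (simp add: L2_inner_def ip_norm_def prob_space)
qed

section \<open>Completeness of the square-integrable functions and Riesz representation\<close>

lemma nn_integral_power2_L2:
  "g \<in> L2 M \<Longrightarrow> (\<integral>\<^sup>+x. ennreal ((g x)\<^sup>2) \<partial>M) = ennreal ((L2_norm M g)\<^sup>2)"
  by (simp add: L2_def L2_inner_def ip_norm_def nn_integral_eq_integral power2_eq_square)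

lemma L2_power2_boundI:
  assumes [measurable]: "g \<in> borel_measurable M" and B: "0 \<le> B"
    and le: "(\<integral>\<^sup>+x. ennreal ((g x)\<^sup>2) \<partial>M) \<le> ennreal (B\<^sup>2)"
  shows "g \<in> L2 M" "L2_norm M g \<le> B"
proof -
  show L2: "g \<in> L2 M"
    unfolding L2_def using le by (auto intro!: integrableI_bounded simp: le_less_trans[OF le])
  interpret L2_form M "L2_inner M" by unfold_locales (rule L2_inner_product_L2_inner)
  have "(L2_norm M g)\<^sup>2 \<le> B\<^sup>2"
    using le B by (simp add: nn_integral_power2_L2[OF L2])
  then show "L2_norm M g \<le> B" using B by (rule power2_le_imp_le)
qed

text \<open>
  The Riesz-Fischer theorem for sequences with geometrically small increments. These increments are summable
  in \<open>L\<^sup>1\<close>, hence the sequence converges almost everywhere without passing to a subsequence, and Fatou's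
  lemma gives the rate of convergence to the pointwise limit.
\<close>

lemma (in prob_space) L2_complete:
  assumes g: "\<And>n. g n \<in> L2 M"
    and fast: "\<And>n. L2_norm M (\<lambda>x. g (Suc n) x - g n x) \<le> (1/2)^n"
  shows "\<exists>w\<in>L2 M. \<forall>n. L2_norm M (\<lambda>x. g n x - w x) \<le> 2 * (1/2)^n"
proof -
  interpret L2_form M "L2_inner M" by unfold_locales (rule L2_inner_product_L2_inner)
  note [measurable] = L2_measurable[OF g]
  define d where "d n x = g (Suc n) x - g n x" for n x
  have d: "d n \<in> L2 M" for n unfolding d_def using g by auto
  note [measurable] = L2_measurable[OF d]
  have d1: "(\<integral>\<^sup>+x. ennreal \<bar>d n x\<bar> \<partial>M) \<le> ennreal ((1/2)^n)" for n
  proof -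
    have ad: "(\<lambda>x. \<bar>d n x\<bar>) \<in> L2 M" using d by (auto simp: L2_def)
    have "(\<lambda>_. 1) \<in> L2 M" by (rule bounded_in_L2[of _ 1]) auto
    then have "integrable M (\<lambda>x. \<bar>d n x\<bar>)"
      using integrable_mult_L2[OF ad, of "\<lambda>_. 1"] by simp
    then have "(\<integral>\<^sup>+x. ennreal \<bar>d n x\<bar> \<partial>M) = ennreal (\<integral>x. \<bar>d n x\<bar> \<partial>M)"
      by (intro nn_integral_eq_integral) auto
    also have "(\<integral>x. \<bar>d n x\<bar> \<partial>M) \<le> L2_norm M (\<lambda>x. \<bar>d n x\<bar>)"
      using abs_integral_le_L2_norm[OF ad] by simp
    also have "\<dots> = L2_norm M (d n)" by (simp add: ip_norm_def L2_inner_def)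
    also have "\<dots> \<le> (1/2)^n" using fast[of n] unfolding d_def .
    finally show ?thesis by (simp add: ennreal_leI)
  qed
  have "(\<integral>\<^sup>+x. (\<Sum>n. ennreal \<bar>d n x\<bar>) \<partial>M) = (\<Sum>n. \<integral>\<^sup>+x. ennreal \<bar>d n x\<bar> \<partial>M)"
    by (rule nn_integral_suminf) auto
  also have "\<dots> \<le> (\<Sum>n. ennreal ((1/2)^n))"
    by (intro suminf_le d1) auto
  also have "\<dots> = ennreal (\<Sum>n. (1/2)^n)"
    by (intro suminf_ennreal2) (auto intro!: summable_geometric)
  finally have "(\<integral>\<^sup>+x. (\<Sum>n. ennreal \<bar>d n x\<bar>) \<partial>M) \<noteq> \<infinity>"
    by (auto simp: top_unique)
  then have "AE x in M. (\<Sum>n. ennreal \<bar>d n x\<bar>) \<noteq> \<infinity>"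
    by (intro nn_integral_PInf_AE) auto
  then have conv: "AE x in M. convergent (\<lambda>n. g n x)"
  proof eventually_elim
    case (elim x)
    have "summable (\<lambda>n. \<bar>d n x\<bar>)"
      using elim by (intro summable_suminf_not_top) auto
    then have "summable (\<lambda>n. d n x)" by (rule summable_rabs_cancel)
    then have "convergent (\<lambda>n. \<Sum>k<n. d k x)"
      by (simp add: summable_iff_convergent)
    moreover have "(\<Sum>k<n. d k x) = g n x - g 0 x" for n
      unfolding d_def by (rule sum_lessThan_telescope)
    ultimately have "convergent (\<lambda>n. g n x - g 0 x)" by simp
    then have "convergent (\<lambda>n. (g n x - g 0 x) + g 0 x)"
      by (intro convergent_add convergent_const)
    then show ?case by simp
  qed
  define w where "w x = lim (\<lambda>n. g n x)" for x
  have [measurable]: "w \<in> borel_measurable M"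
    unfolding w_def by measurable
  have lim: "AE x in M. (\<lambda>n. g n x) \<longlonglongrightarrow> w x"
    using conv by eventually_elim (simp add: w_def convergent_LIMSEQ_iff)
  have near: "L2_norm M (\<lambda>x. g n x - g (n + m) x) \<le> 2 * (1/2)^n - 2 * (1/2)^(n + m)" for n m
  proof (induction m)
    case 0
    then show ?case by (simp add: ip_norm_def L2_inner_def)
  next
    case (Suc m)
    have "L2_norm M (\<lambda>x. g n x - g (n + Suc m) x)
        = L2_norm M (\<lambda>x. (g n x - g (n + m) x) + (-1) * d (n + m) x)"
      by (simp add: d_def)
    also have "\<dots> \<le> L2_norm M (\<lambda>x. g n x - g (n + m) x) + L2_norm M (\<lambda>x. (-1) * d (n + m) x)"
      by (intro ip_norm_triangle L2_diff L2_scale g d)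
    also have "L2_norm M (\<lambda>x. (-1) * d (n + m) x) \<le> (1/2)^(n + m)"
      using fast[of "n + m"] by (subst ip_norm_scale[OF d]) (simp add: d_def[abs_def])
    also note Suc.IH
    finally show ?case by (simp add: field_simps)
  qed
  have bound: "(\<integral>\<^sup>+x. ennreal ((g n x - w x)\<^sup>2) \<partial>M) \<le> ennreal ((2 * (1/2)^n)\<^sup>2)" for n
  proof -
    have "(\<integral>\<^sup>+x. ennreal ((g n x - w x)\<^sup>2) \<partial>M)
        = (\<integral>\<^sup>+x. liminf (\<lambda>m. ennreal ((g n x - g m x)\<^sup>2)) \<partial>M)"
    proof (rule nn_integral_cong_AE, use lim in eventually_elim)
      case (elim x)
      have "(\<lambda>m. ennreal ((g n x - g m x)\<^sup>2)) \<longlonglongrightarrow> ennreal ((g n x - w x)\<^sup>2)"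
        by (intro tendsto_intros elim)
      then show ?case by (intro lim_imp_Liminf[symmetric]) auto
    qed
    also have "\<dots> \<le> liminf (\<lambda>m. \<integral>\<^sup>+x. ennreal ((g n x - g m x)\<^sup>2) \<partial>M)"
      by (rule nn_integral_liminf) auto
    also have "\<dots> \<le> ennreal ((2 * (1/2)^n)\<^sup>2)"
    proof (rule order_trans[OF Liminf_le_Limsup Limsup_bounded], simp, rule eventually_sequentiallyI[of n])
      fix m assume "n \<le> m"
      then have "L2_norm M (\<lambda>x. g n x - g m x) \<le> 2 * (1/2)^n"
        using near[of n "m - n"] by (auto intro: order_trans)
      then have "(L2_norm M (\<lambda>x. g n x - g m x))\<^sup>2 \<le> (2 * (1/2)^n)\<^sup>2"
        using g by (intro power_mono ip_norm_nonneg) auto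
      then show "(\<integral>\<^sup>+x. ennreal ((g n x - g m x)\<^sup>2) \<partial>M) \<le> ennreal ((2 * (1/2)^n)\<^sup>2)"
        using g by (subst nn_integral_power2_L2) (auto intro!: ennreal_leI)
    qed
    finally show ?thesis .
  qed
  have gw: "(\<lambda>x. g n x - w x) \<in> L2 M" "L2_norm M (\<lambda>x. g n x - w x) \<le> 2 * (1/2)^n" for n
    using L2_power2_boundI[OF _ _ bound[of n]] by auto
  have "w \<in> L2 M"
    using L2_diff[OF g[of 0] gw(1)[of 0]] by simp
  then show ?thesis using gw by auto
qed

locale equivalent_L2_form = L2_form M ip + prob_space M
  for M :: "'a measure" and ip :: "('a \<Rightarrow> real) \<Rightarrow> ('a \<Rightarrow> real) \<Rightarrow> real" +
  fixes c C :: real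
  assumes c_pos: "0 < c"
    and norm_lower: "g \<in> L2 M \<Longrightarrow> c * L2_norm M g \<le> ip_norm ip g"
    and norm_upper: "g \<in> L2 M \<Longrightarrow> ip_norm ip g \<le> C * L2_norm M g"
begin

sublocale L2: L2_form M "L2_inner M"
  by unfold_locales (rule L2_inner_product_L2_inner)

text \<open>
  The representing element is the minimiser of \<open>J g = ip g g - 2 L2_inner M g V\<close>. A minimising sequence is
  Cauchy by the parallelogram identity, it converges because the equivalent \<open>L\<^sup>2\<close> norm is complete, and the
  first-order condition at the minimiser is the claim.
\<close>

theorem Riesz_representation:
  assumes V: "V \<in> L2 M"
  shows "\<exists>w\<in>L2 M. \<forall>g\<in>L2 M. ip g w = L2_inner M g V"
proof -
  define \<phi> where "\<phi> g = L2_inner M g V" for g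
  define J where "J g = ip g g - 2 * \<phi> g" for g
  define m where "m = Inf (J ` L2 M)"
  have phi: "\<bar>\<phi> g\<bar> \<le> ip_norm ip g * (L2_norm M V / c)" if g: "g \<in> L2 M" for g
  proof -
    have "\<bar>\<phi> g\<bar> \<le> L2_norm M g * L2_norm M V"
      unfolding \<phi>_def by (rule L2.Cauchy_Schwarz[OF g V])
    also have "\<dots> \<le> (ip_norm ip g / c) * L2_norm M V"
      using norm_lower[OF g] c_pos L2.ip_norm_nonneg[OF V]
      by (intro mult_right_mono) (auto simp: field_simps)
    finally show ?thesis by simp
  qed
  have lower: "- (L2_norm M V / c)\<^sup>2 \<le> J g" if g: "g \<in> L2 M" for g
  proof -
    have "0 \<le> (ip_norm ip g - L2_norm M V / c)\<^sup>2" by simp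
    then have "2 * (ip_norm ip g * (L2_norm M V / c)) \<le> ip g g + (L2_norm M V / c)\<^sup>2"
      unfolding power2_diff ip_norm_power2[OF g] by linarith
    then show ?thesis using phi[OF g] unfolding J_def by linarith
  qed
  have m_le: "m \<le> J g" if "g \<in> L2 M" for g
    unfolding m_def using lower that by (intro cINF_lower bdd_belowI2) auto
  have ne: "J ` L2 M \<noteq> {}" using V by auto
  \<comment> \<open>The slack is chosen so that the increments of the minimising sequence are at most \<open>(1/2)^n\<close> in \<open>L\<^sup>2\<close>.\<close>
  have "\<exists>g. g \<in> L2 M \<and> J g \<le> m + (c * (1/2)^n)\<^sup>2 / 4" for n
  proof -
    have "m < m + (c * (1/2)^n)\<^sup>2 / 4" using c_pos by simp
    from cInf_lessD[OF ne, of "m + (c * (1/2)^n)\<^sup>2 / 4"] this show ?thesis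
      unfolding m_def by force
  qed
  then obtain g where g: "\<And>n. g n \<in> L2 M" and Jg: "\<And>n. J (g n) \<le> m + (c * (1/2)^n)\<^sup>2 / 4"
    by metis
  have phi_add: "\<phi> (\<lambda>x. g x + s * h x) = \<phi> g + s * \<phi> h" if "g \<in> L2 M" "h \<in> L2 M" for g h s
    unfolding \<phi>_def using that V by (simp add: L2.ip_add_left L2.ip_scale_left L2_scale)
  \<comment> \<open>The parallelogram identity turns almost-minimality into closeness.\<close>
  have para: "(ip_norm ip (\<lambda>x. g x - h x))\<^sup>2 \<le> 2 * (J g - m) + 2 * (J h - m)"
    if gh: "g \<in> L2 M" "h \<in> L2 M" for g h
  proof -
    define d where "d x = h x - g x" for x
    have d: "d \<in> L2 M" unfolding d_def using gh by auto
    have "J (\<lambda>x. g x + s * d x) = J g + 2 * s * ip g d + s\<^sup>2 * ip d d - 2 * s * \<phi> d" for s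
      unfolding J_def using gh d by (simp add: ip_square_add_scale phi_add)
    from this[of "1/2"] this[of 1]
    have "4 * J (\<lambda>x. g x + 1/2 * d x) = 2 * J g + 2 * J (\<lambda>x. g x + 1 * d x) - ip d d"
      by (simp add: power2_eq_square)
    moreover have "(\<lambda>x. g x + 1 * d x) = h" by (simp add: d_def)
    moreover have "m \<le> J (\<lambda>x. g x + 1/2 * d x)" by (intro m_le L2_add L2_scale gh d)
    moreover have "ip_norm ip (\<lambda>x. g x - h x) = ip_norm ip d"
      using ip_norm_scale[OF d, of "-1"] by (simp add: d_def)
    ultimately show ?thesis using ip_norm_power2[OF d] by simp
  qed
  have "L2_norm M (\<lambda>x. g (Suc n) x - g n x) \<le> (1/2)^n" for n
  proof -
    have "(c * (1/2)^Suc n)\<^sup>2 \<le> (c * (1/2)^n)\<^sup>2"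
      using c_pos by (intro power_mono mult_left_mono) auto
    then have "(ip_norm ip (\<lambda>x. g (Suc n) x - g n x))\<^sup>2 \<le> (c * (1/2)^n)\<^sup>2"
      using para[OF g g, of "Suc n" n] Jg[of n] Jg[of "Suc n"] by simp
    then have "ip_norm ip (\<lambda>x. g (Suc n) x - g n x) \<le> c * (1/2)^n"
      by (rule power2_le_imp_le) (use c_pos in simp)
    moreover have "c * L2_norm M (\<lambda>x. g (Suc n) x - g n x) \<le> ip_norm ip (\<lambda>x. g (Suc n) x - g n x)"
      using g by (intro norm_lower) auto
    ultimately have "c * L2_norm M (\<lambda>x. g (Suc n) x - g n x) \<le> c * (1/2)^n" by linarith
    then show ?thesis using c_pos by simp
  qed
  from L2_complete[OF g this] obtain w where w: "w \<in> L2 M"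
    and gw: "\<And>n. L2_norm M (\<lambda>x. g n x - w x) \<le> 2 * (1/2)^n" by auto
  have gw_lim: "(\<lambda>n. ip_norm ip (\<lambda>x. g n x - w x)) \<longlonglongrightarrow> 0"
  proof (rule tendsto_sandwich[OF _ _ tendsto_const])
    show "\<forall>\<^sub>F n in sequentially. 0 \<le> ip_norm ip (\<lambda>x. g n x - w x)"
      using g w by (auto intro!: always_eventually ip_norm_nonneg)
    have "ip_norm ip (\<lambda>x. g n x - w x) \<le> \<bar>C\<bar> * (2 * (1/2)^n)" for n
    proof -
      have "ip_norm ip (\<lambda>x. g n x - w x) \<le> C * L2_norm M (\<lambda>x. g n x - w x)"
        using g w by (intro norm_upper) auto
      also have "\<dots> \<le> \<bar>C\<bar> * L2_norm M (\<lambda>x. g n x - w x)"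
        using g w by (intro mult_right_mono L2.ip_norm_nonneg) auto
      also have "\<dots> \<le> \<bar>C\<bar> * (2 * (1/2)^n)" by (intro mult_left_mono gw) auto
      finally show ?thesis .
    qed
    then show "\<forall>\<^sub>F n in sequentially. ip_norm ip (\<lambda>x. g n x - w x) \<le> \<bar>C\<bar> * (2 * (1/2)^n)"
      by (intro always_eventually) auto
    show "(\<lambda>n. \<bar>C\<bar> * (2 * (1/2)^n)) \<longlonglongrightarrow> 0"
      by (intro tendsto_mult_right_zero LIMSEQ_realpow_zero) auto
  qed
  have first_order: "\<bar>ip h w - \<phi> h\<bar> \<le> s * ip h h" if h: "h \<in> L2 M" and s: "0 < s" for h s
  proof -
    have *: "- ((c * (1/2)^n)\<^sup>2 / 4) \<le> 2 * r * (ip (g n) h - \<phi> h) + r\<^sup>2 * ip h h" for n r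
    proof -
      have "m \<le> J (\<lambda>x. g n x + r * h x)" by (intro m_le L2_add L2_scale g h)
      also have "\<dots> = J (g n) + 2 * r * (ip (g n) h - \<phi> h) + r\<^sup>2 * ip h h"
        unfolding J_def using g h by (simp add: ip_square_add_scale phi_add algebra_simps)
      finally show ?thesis using Jg[of n] by simp
    qed
    have lim_ip: "(\<lambda>n. ip (g n) h) \<longlonglongrightarrow> ip w h"
    proof (rule LIM_zero_cancel, rule tendsto_rabs_zero_cancel, rule tendsto_sandwich[OF _ _ tendsto_const])
      show "\<forall>\<^sub>F n in sequentially. \<bar>ip (g n) h - ip w h\<bar> \<le> ip_norm ip (\<lambda>x. g n x - w x) * ip_norm ip h"
        using Cauchy_Schwarz[OF L2_diff[OF g w] h] g w h by (auto simp: ip_diff_left)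
      show "(\<lambda>n. ip_norm ip (\<lambda>x. g n x - w x) * ip_norm ip h) \<longlonglongrightarrow> 0"
        using gw_lim by (rule tendsto_mult_left_zero)
    qed auto
    have "(\<lambda>n. - ((c * (1/2)^n)\<^sup>2 / 4)) \<longlonglongrightarrow> - ((c * 0)\<^sup>2 / 4)"
      by (intro tendsto_intros LIMSEQ_realpow_zero) auto
    then have slack: "(\<lambda>n. - ((c * (1/2)^n)\<^sup>2 / 4)) \<longlonglongrightarrow> 0" by simp
    have lim0: "0 \<le> 2 * r * (ip w h - \<phi> h) + r\<^sup>2 * ip h h" for r
    proof (rule LIMSEQ_le[OF slack])
      show "(\<lambda>n. 2 * r * (ip (g n) h - \<phi> h) + r\<^sup>2 * ip h h) \<longlonglongrightarrow> 2 * r * (ip w h - \<phi> h) + r\<^sup>2 * ip h h"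
        by (intro tendsto_intros lim_ip)
    qed (use * in auto)
    have "0 \<le> s * (2 * (ip w h - \<phi> h) + s * ip h h)" "0 \<le> s * (- 2 * (ip w h - \<phi> h) + s * ip h h)"
      using lim0[of s] lim0[of "- s"] by (simp_all add: algebra_simps power2_eq_square)
    then have "\<bar>2 * (ip w h - \<phi> h)\<bar> \<le> s * ip h h"
      using s by (auto simp: zero_le_mult_iff)
    then show ?thesis using ip_commute[OF w h] by simp
  qed
  have "ip h w = \<phi> h" if h: "h \<in> L2 M" for h
  proof -
    have "\<bar>ip h w - \<phi> h\<bar> \<le> 0"
    proof (rule field_le_epsilon)
      fix e :: real assume e: "0 < e"
      have "\<bar>ip h w - \<phi> h\<bar> \<le> e / (ip h h + 1) * ip h h"
        using e ip_nonneg[OF h] by (intro first_order h) auto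
      also have "\<dots> \<le> e" using e ip_nonneg[OF h] by (simp add: field_simps)
      finally show "\<bar>ip h w - \<phi> h\<bar> \<le> 0 + e" by simp
    qed
    then show ?thesis by simp
  qed
  then show ?thesis using w unfolding \<phi>_def by auto
qed

end

section \<open>Calculus of bounded measurable functions of time\<close>

lemma set_integrable_bounded:
  fixes w :: "real \<Rightarrow> real"
  assumes [measurable]: "w \<in> borel_measurable borel" and w: "\<And>r. r \<in> {a..b} \<Longrightarrow> \<bar>w r\<bar> \<le> K"
  shows "set_integrable lborel {a..b} w"
  unfolding set_integrable_def
proof (rule integrableI_bounded_set_indicator[where B = K])
  show "emeasure lborel {a..b} < \<infinity>" by (simp add: emeasure_lborel_Icc_eq)
qed (use w in auto)

lemma abs_set_integral_mono:
  fixes w v :: "real \<Rightarrow> real"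
  assumes "set_integrable lborel {a..b} w" "set_integrable lborel {a..b} v"
    and "\<And>r. r \<in> {a..b} \<Longrightarrow> \<bar>w r\<bar> \<le> v r"
  shows "\<bar>LINT r:{a..b}|lborel. w r\<bar> \<le> (LINT r:{a..b}|lborel. v r)"
proof -
  have "\<bar>LINT r:{a..b}|lborel. w r\<bar> \<le> (LINT r:{a..b}|lborel. \<bar>w r\<bar>)"
    using set_integral_norm_bound[OF assms(1)] by simp
  also have "\<dots> \<le> (LINT r:{a..b}|lborel. v r)"
    using assms by (intro set_integral_mono set_integrable_abs) auto
  finally show ?thesis .
qed

lemma set_integral_const_Icc: "a \<le> b \<Longrightarrow> (LINT r:{a..b}|lborel. (K::real)) = K * (b - a)"
  by (simp add: set_lebesgue_integral_def)

lemma abs_set_integral_bounded: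
  fixes w :: "real \<Rightarrow> real"
  assumes "w \<in> borel_measurable borel" "a \<le> b" "\<And>r. r \<in> {a..b} \<Longrightarrow> \<bar>w r\<bar> \<le> K"
  shows "\<bar>LINT r:{a..b}|lborel. w r\<bar> \<le> K * (b - a)"
  using abs_set_integral_mono[of a b w "\<lambda>_. K"] set_integrable_bounded[of w a b K]
    set_integrable_bounded[of "\<lambda>_. K" a b "\<bar>K\<bar>"] assms by (simp add: set_integral_const_Icc)

lemma set_integral_singleton [simp]: "(LINT r:{a}|lborel. (w r :: real)) = 0"
proof -
  have "AE r in lborel. indicator {a} r *\<^sub>R w r = 0"
    using AE_lborel_singleton[of a] by eventually_elim (auto simp: indicator_def)
  then show ?thesis unfolding set_lebesgue_integral_def by (rule integral_eq_zero_AE)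
qed

lemma set_integral_Icc_combine:
  fixes w :: "real \<Rightarrow> real"
  assumes "set_integrable lborel {a..c} w" "a \<le> b" "b \<le> c"
  shows "(LINT r:{a..c}|lborel. w r) = (LINT r:{a..b}|lborel. w r) + (LINT r:{b..c}|lborel. w r)"
proof -
  have "{a..c} = {a..b} \<union> {b..c}" using assms by auto
  moreover have "(LINT r:{a..b} \<union> {b..c}|lborel. w r) = (LINT r:{a..b}|lborel. w r) + (LINT r:{b..c}|lborel. w r)"
  proof (rule set_integral_Un_AE)
    show "AE r in lborel. \<not> (r \<in> {a..b} \<and> r \<in> {b..c})"
      using AE_lborel_singleton[of b] by eventually_elim auto
  qed (use assms in \<open>auto intro: set_integrable_subset\<close>)
  ultimately show ?thesis by simp
qed

lemma set_integral_Icc_shift: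
  fixes w :: "real \<Rightarrow> real"
  shows "(LINT r:{a..b}|lborel. w (s + r)) = (LINT r:{s + a..s + b}|lborel. w r)"
proof -
  have "(LINT r:{s + a..s + b}|lborel. w r) = (\<integral>r. indicator {s + a..s + b} (s + r) * w (s + r) \<partial>lborel)"
    unfolding set_lebesgue_integral_def
    using lborel_integral_real_affine[of 1 "\<lambda>r. indicator {s + a..s + b} r *\<^sub>R w r" s] by simp
  also have "\<dots> = (LINT r:{a..b}|lborel. w (s + r))"
    unfolding set_lebesgue_integral_def by (intro Bochner_Integration.integral_cong) (auto simp: indicator_def)
  finally show ?thesis by simp
qed

lemma measurable_set_integral_Icc:
  fixes f :: "'b \<Rightarrow> real \<Rightarrow> real"
  assumes [measurable]: "(\<lambda>p. f (fst p) (snd p)) \<in> borel_measurable (N \<Otimes>\<^sub>M borel)" "t \<in> borel_measurable N"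
  shows "(\<lambda>y. LINT r:{0..t y}|lborel. f y r) \<in> borel_measurable N"
proof -
  have eq: "sets (N \<Otimes>\<^sub>M lborel) = sets (N \<Otimes>\<^sub>M (borel :: real measure))"
    by (rule sets_pair_measure_cong) auto
  have "(\<lambda>p. indicator {r. 0 \<le> r \<and> r \<le> t (fst p)} (snd p) *\<^sub>R f (fst p) (snd p)) \<in> borel_measurable (N \<Otimes>\<^sub>M borel)"
    by measurable
  then have "(\<lambda>p. indicator {0..t (fst p)} (snd p) *\<^sub>R f (fst p) (snd p)) \<in> borel_measurable (N \<Otimes>\<^sub>M lborel)"
    by (simp add: atLeastAtMost_def atLeast_def atMost_def Collect_conj_eq[symmetric] cong: measurable_cong_sets[OF eq refl])
  then show ?thesis
    unfolding set_lebesgue_integral_def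
    by (intro lborel.borel_measurable_lebesgue_integral) (simp add: case_prod_beta')
qed

lemma exp_diff_le:
  fixes u v m :: real
  assumes "u \<le> m" "v \<le> m"
  shows "\<bar>exp u - exp v\<bar> \<le> exp m * \<bar>u - v\<bar>"
proof -
  have *: "\<bar>exp a - exp b\<bar> \<le> exp m * \<bar>a - b\<bar>" if ab: "b < a" "a \<le> m" for a b :: real
  proof -
    obtain z where z: "b < z" "z < a" "exp a - exp b = (a - b) * exp z"
      using MVT2[of b a exp exp] ab by (auto intro: DERIV_exp)
    then have "\<bar>exp a - exp b\<bar> = (a - b) * exp z" using ab by simp
    also have "\<dots> \<le> (a - b) * exp m" using ab z by (intro mult_left_mono) auto
    finally show ?thesis using ab by (simp add: mult.commute)
  qed
  show ?thesis
    using *[of u v] *[of v u] assms by (cases u v rule: linorder_cases) (auto simp: abs_minus_commute)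
qed

lemma exp_first_order:
  fixes u v m :: real
  assumes "u \<le> m" "v \<le> m"
  shows "\<bar>exp u - exp v - exp v * (u - v)\<bar> \<le> exp m * (u - v)\<^sup>2"
proof -
  have *: "\<exists>z\<le>m. \<bar>z - v\<bar> \<le> \<bar>u - v\<bar> \<and> exp u - exp v = exp z * (u - v)"
  proof (cases u v rule: linorder_cases)
    case less
    then obtain z where "u < z" "z < v" "exp v - exp u = (v - u) * exp z"
      using MVT2[of u v exp exp] by (auto intro: DERIV_exp)
    then show ?thesis using assms by (intro exI[of _ z]) (auto simp: algebra_simps)
  next
    case greater
    then obtain z where "v < z" "z < u" "exp u - exp v = (u - v) * exp z"
      using MVT2[of v u exp exp] by (auto intro: DERIV_exp)
    then show ?thesis using assms by (intro exI[of _ z]) (auto simp: algebra_simps)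
  qed (use assms in auto)
  then obtain z where z: "z \<le> m" "\<bar>z - v\<bar> \<le> \<bar>u - v\<bar>" "exp u - exp v = exp z * (u - v)" by auto
  have "\<bar>exp u - exp v - exp v * (u - v)\<bar> = \<bar>exp z - exp v\<bar> * \<bar>u - v\<bar>"
    unfolding z(3) abs_mult[symmetric] by (simp add: algebra_simps)
  also have "\<dots> \<le> (exp m * \<bar>u - v\<bar>) * \<bar>u - v\<bar>"
  proof (rule mult_right_mono)
    have "\<bar>exp z - exp v\<bar> \<le> exp m * \<bar>z - v\<bar>" using z assms by (intro exp_diff_le) auto
    also have "\<dots> \<le> exp m * \<bar>u - v\<bar>" using z by simp
    finally show "\<bar>exp z - exp v\<bar> \<le> exp m * \<bar>u - v\<bar>" .
  qed simp
  finally show ?thesis by (simp add: power2_eq_square mult.assoc)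
qed

text \<open>
  Quadratic increments force the derivative to vanish everywhere.
\<close>

lemma constant_of_quadratic_increments:
  fixes G :: "real \<Rightarrow> real"
  assumes le: "\<And>a b. 0 \<le> a \<Longrightarrow> a \<le> b \<Longrightarrow> b \<le> T \<Longrightarrow> \<bar>G b - G a\<bar> \<le> L * (b - a)\<^sup>2" and T: "0 \<le> T"
  shows "G T = G 0"
proof -
  have quad: "\<bar>G y - G x\<bar> \<le> L * (y - x)\<^sup>2" if "x \<in> {0..T}" "y \<in> {0..T}" for x y
    using le[of x y] le[of y x] that by (cases "x \<le> y") (auto simp: abs_minus_commute power2_commute)
  have "(G has_field_derivative 0) (at x within {0..T})" if x: "x \<in> {0..T}" for x
    unfolding has_field_derivative_iff
  proof (rule Lim_null_comparison)
    show "\<forall>\<^sub>F y in at x within {0..T}. norm ((G y - G x) / (y - x)) \<le> L * \<bar>y - x\<bar>"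
      unfolding eventually_at_filter
    proof (intro always_eventually allI impI)
      fix y assume y: "y \<noteq> x" "y \<in> {0..T}"
      have eq: "L * (y - x)\<^sup>2 = (L * \<bar>y - x\<bar>) * \<bar>y - x\<bar>"
        by (simp add: power2_eq_square mult.assoc flip: abs_mult)
      have "\<bar>G y - G x\<bar> \<le> (L * \<bar>y - x\<bar>) * \<bar>y - x\<bar>"
        using quad[OF x y(2)] unfolding eq .
      then show "norm ((G y - G x) / (y - x)) \<le> L * \<bar>y - x\<bar>"
        using y(1) by (simp add: divide_le_eq)
    qed
    show "((\<lambda>y. L * \<bar>y - x\<bar>) \<longlongrightarrow> 0) (at x within {0..T})"
      by (rule tendsto_eq_intros refl | simp)+
  qed
  then obtain k where "\<And>x. x \<in> {0..T} \<Longrightarrow> G x = k"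
    using has_field_derivative_zero_constant[of "{0..T}" G] by auto
  then show ?thesis using T by auto
qed

text \<open>
  This is the fundamental theorem of calculus for \<open>exp (z t)\<close>. As \<open>w\<close> is merely bounded and measurable, \<open>z\<close> need
  not be differentiable. Instead, over a short interval both sides change by
  \<open>exp (z a) * (z b - z a)\<close> up to an error of second order in the length, so their difference has
  quadratic increments.
\<close>

lemma exp_set_integral:
  fixes w :: "real \<Rightarrow> real"
  defines "z \<equiv> \<lambda>t. LINT r:{0..t}|lborel. w r"
  assumes w[measurable]: "w \<in> borel_measurable borel" and K: "\<And>r. \<bar>w r\<bar> \<le> K" and t: "0 \<le> t"
  shows "exp (z t) = 1 + (LINT r:{0..t}|lborel. w r * exp (z r))"
proof -
  have K0: "0 \<le> K" using K[of 0] by simp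
  have [measurable]: "z \<in> borel_measurable borel"
    unfolding z_def by (intro measurable_set_integral_Icc) measurable
  have z_inc: "z b - z a = (LINT r:{a..b}|lborel. w r)" if "0 \<le> a" "a \<le> b" for a b
    unfolding z_def using set_integral_Icc_combine[of 0 b w a] set_integrable_bounded[of w 0 b K] K that by simp
  have z_lip: "\<bar>z b - z a\<bar> \<le> K * (b - a)" if "0 \<le> a" "a \<le> b" for a b
    unfolding z_inc[OF that] using that K by (intro abs_set_integral_bounded) auto
  have z0: "z 0 = 0" unfolding z_def by simp
  have z_le: "z r \<le> K * t" if "r \<in> {0..t}" for r
    using z_lip[of 0 r] that z0 mult_left_mono[of r t K] K0 by auto
  define G where "G s = exp (z s) - (LINT r:{0..s}|lborel. w r * exp (z r))" for s
  have int: "set_integrable lborel {a..b} (\<lambda>r. w r * exp (z r))" if "0 \<le> a" "b \<le> t" for a b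
  proof (rule set_integrable_bounded[where K = "K * exp (K * t)"])
    fix r assume "r \<in> {a..b}"
    then show "\<bar>w r * exp (z r)\<bar> \<le> K * exp (K * t)"
      unfolding abs_mult using z_le[of r] K[of r] that K0 by (intro mult_mono) auto
  qed simp
  have "\<bar>G b - G a\<bar> \<le> (2 * exp (K * t) * K\<^sup>2) * (b - a)\<^sup>2" if ab: "0 \<le> a" "a \<le> b" "b \<le> t" for a b
  proof -
    have int': "set_integrable lborel {a..b} w" using K by (intro set_integrable_bounded) auto
    have "G b - G a = exp (z b) - exp (z a) - (LINT r:{a..b}|lborel. w r * exp (z r))"
      unfolding G_def using set_integral_Icc_combine[OF int[of 0 b], of a] ab by simp
    also have "\<dots> = (exp (z b) - exp (z a) - exp (z a) * (z b - z a))
        - (LINT r:{a..b}|lborel. w r * exp (z r) - exp (z a) * w r)"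
      using z_inc[of a b] ab int[of a b] int' by (subst set_integral_diff) auto
    finally have split: "\<bar>G b - G a\<bar> \<le> \<bar>exp (z b) - exp (z a) - exp (z a) * (z b - z a)\<bar>
        + \<bar>LINT r:{a..b}|lborel. w r * exp (z r) - exp (z a) * w r\<bar>" by linarith
    have "\<bar>exp (z b) - exp (z a) - exp (z a) * (z b - z a)\<bar> \<le> exp (K * t) * (z b - z a)\<^sup>2"
      using z_le[of a] z_le[of b] ab by (intro exp_first_order) auto
    also have "\<dots> \<le> exp (K * t) * (K * (b - a))\<^sup>2"
      using z_lip[of a b] ab by (intro mult_left_mono) (auto intro: abs_le_square_iff[THEN iffD1] order_trans[OF _ abs_ge_self])
    finally have 1: "\<bar>exp (z b) - exp (z a) - exp (z a) * (z b - z a)\<bar> \<le> exp (K * t) * K\<^sup>2 * (b - a)\<^sup>2"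
      by (simp add: power_mult_distrib mult.assoc)
    have "\<bar>LINT r:{a..b}|lborel. w r * exp (z r) - exp (z a) * w r\<bar> \<le> (K * (exp (K * t) * (K * (b - a)))) * (b - a)"
    proof (rule abs_set_integral_bounded)
      fix r assume r: "r \<in> {a..b}"
      have "\<bar>exp (z r) - exp (z a)\<bar> \<le> exp (K * t) * \<bar>z r - z a\<bar>"
        using z_le[of a] z_le[of r] ab r by (intro exp_diff_le) auto
      also have "\<dots> \<le> exp (K * t) * (K * (b - a))"
        using z_lip[of a r] ab r mult_left_mono[of "r - a" "b - a" K] K0 by (intro mult_left_mono) auto
      finally have "\<bar>w r\<bar> * \<bar>exp (z r) - exp (z a)\<bar> \<le> K * (exp (K * t) * (K * (b - a)))"
        using K[of r] K0 by (intro mult_mono) auto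
      then show "\<bar>w r * exp (z r) - exp (z a) * w r\<bar> \<le> K * (exp (K * t) * (K * (b - a)))"
        unfolding abs_mult[symmetric] by (simp add: algebra_simps)
    qed (use ab in auto)
    then show ?thesis using split 1 by (simp add: power2_eq_square algebra_simps)
  qed
  from constant_of_quadratic_increments[OF this t] have "G t = G 0" by simp
  then show ?thesis unfolding G_def z0 by simp
qed

lemma (in finite_measure) integral_set_integral_swap:
  fixes f :: "real \<Rightarrow> 'a \<Rightarrow> real"
  assumes [measurable]: "(\<lambda>p. f (fst p) (snd p)) \<in> borel_measurable (borel \<Otimes>\<^sub>M M)"
    and B: "\<And>r \<omega>. r \<in> {0..t} \<Longrightarrow> \<omega> \<in> space M \<Longrightarrow> \<bar>f r \<omega>\<bar> \<le> B"
  shows "(\<integral>\<omega>. (LINT r:{0..t}|lborel. f r \<omega>) \<partial>M) = (LINT r:{0..t}|lborel. \<integral>\<omega>. f r \<omega> \<partial>M)"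
proof -
  interpret P: pair_sigma_finite lborel M ..
  have *: "integrable (lborel \<Otimes>\<^sub>M M) (\<lambda>(r, \<omega>). indicator {0..t} r * f r \<omega>)"
  proof (rule integrableI_bounded_set[where A = "{0..t} \<times> space M" and B = B])
    show "emeasure (lborel \<Otimes>\<^sub>M M) ({0..t} \<times> space M) < \<infinity>"
      by (subst sigma_finite_measure.emeasure_pair_measure_Times[OF sigma_finite_measure_axioms])
        (auto simp: emeasure_lborel_Icc_eq ennreal_mult_less_top emeasure_eq_measure)
    show "AE p in lborel \<Otimes>\<^sub>M M. p \<in> {0..t} \<times> space M \<longrightarrow> norm (case p of (r, \<omega>) \<Rightarrow> indicator {0..t} r * f r \<omega>) \<le> B"
      using B by (intro AE_I2) auto
    show "AE p in lborel \<Otimes>\<^sub>M M. p \<notin> {0..t} \<times> space M \<longrightarrow> (case p of (r, \<omega>) \<Rightarrow> indicator {0..t} r * f r \<omega>) = 0"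
      by (intro AE_I2) (auto simp: space_pair_measure indicator_def)
  qed (auto simp: case_prod_beta')
  show ?thesis
    unfolding set_lebesgue_integral_def using P.Fubini_integral[OF *] by simp
qed

text \<open>
  The parameter \<open>y\<close> occurs in the integrand and in the measure. Transporting \<open>L y\<close> to the graph \<open>{y} \<times> space F\<close>
  moves it into the measure alone.
\<close>

lemma measurable_integral_kernel:
  fixes f :: "'b \<Rightarrow> 'w \<Rightarrow> real"
  assumes [measurable]: "(\<lambda>p. f (fst p) (snd p)) \<in> borel_measurable (N \<Otimes>\<^sub>M F)"
    and L[measurable]: "L \<in> N \<rightarrow>\<^sub>M prob_algebra F"
  shows "(\<lambda>y. \<integral>\<omega>. f y \<omega> \<partial>L y) \<in> borel_measurable N"
proof -
  have [measurable]: "L \<in> N \<rightarrow>\<^sub>M subprob_algebra F" using L by (rule measurable_prob_algebraD)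
  have "(\<lambda>y. integral\<^sup>L (distr (L y) (N \<Otimes>\<^sub>M F) (Pair y)) (\<lambda>p. f (fst p) (snd p))) \<in> borel_measurable N"
  proof (rule measurable_compose[OF _ integral_measurable_subprob_algebra])
    show "(\<lambda>y. distr (L y) (N \<Otimes>\<^sub>M F) (Pair y)) \<in> N \<rightarrow>\<^sub>M subprob_algebra (N \<Otimes>\<^sub>M F)"
      by (rule measurable_distr2[where M = F]) auto
  qed measurable
  moreover have "integral\<^sup>L (distr (L y) (N \<Otimes>\<^sub>M F) (Pair y)) (\<lambda>p. f (fst p) (snd p)) = (\<integral>\<omega>. f y \<omega> \<partial>L y)"
    if y: "y \<in> space N" for y
  proof -
    have sL [measurable_cong]: "sets (L y) = sets F"
      using measurable_space[OF L y] by (simp add: space_prob_algebra)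
    have [measurable]: "Pair y \<in> L y \<rightarrow>\<^sub>M N \<Otimes>\<^sub>M F"
      by (subst measurable_cong_sets[OF sL refl]) (rule measurable_Pair1'[OF y])
    show ?thesis by (subst integral_distr) auto
  qed
  ultimately show ?thesis by (simp cong: measurable_cong)
qed

text \<open>
  Sample the process at the next point of the grid of mesh \<open>1 / Suc n\<close> strictly to the right. Each of these
  approximations is pieced together from countably many random variables, and right continuity yields the limit.
\<close>

lemma measurable_pair_right_continuous:
  fixes Y :: "real \<Rightarrow> 'w \<Rightarrow> 'a::metric_space"
  assumes [measurable]: "\<And>t. Y t \<in> G \<rightarrow>\<^sub>M borel"
    and rc: "\<And>t \<omega>. \<omega> \<in> space G \<Longrightarrow> ((\<lambda>s. Y s \<omega>) \<longlongrightarrow> Y t \<omega>) (at_right t)"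
  shows "(\<lambda>p. Y (fst p) (snd p)) \<in> borel \<Otimes>\<^sub>M G \<rightarrow>\<^sub>M borel"
proof (rule borel_measurable_LIMSEQ_metric)
  define q where "q n t = (real_of_int \<lfloor>real (Suc n) * t\<rfloor> + 1) / real (Suc n)" for n and t :: real
  have gt: "t < q n t" for n t
    unfolding q_def by (simp add: pos_less_divide_eq mult.commute)
  have le: "q n t \<le> t + 1 / real (Suc n)" for n t
  proof -
    have "q n t \<le> (real (Suc n) * t + 1) / real (Suc n)"
      unfolding q_def by (intro divide_right_mono) auto
    also have "\<dots> = t + 1 / real (Suc n)" by (simp add: add_divide_distrib)
    finally show ?thesis .
  qed
  show "(\<lambda>p. Y (q n (fst p)) (snd p)) \<in> borel \<Otimes>\<^sub>M G \<rightarrow>\<^sub>M borel" for n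
  proof -
    have "(\<lambda>p. (\<lambda>i::int. \<lambda>p. Y ((real_of_int i + 1) / real (Suc n)) (snd p)) \<lfloor>real (Suc n) * fst p\<rfloor> p) \<in> borel \<Otimes>\<^sub>M G \<rightarrow>\<^sub>M borel"
      by (rule measurable_compose_countable; measurable)
    then show ?thesis by (simp add: q_def)
  qed
  fix p assume "p \<in> space (borel \<Otimes>\<^sub>M G :: (real \<times> 'w) measure)"
  then have \<omega>: "snd p \<in> space G" by (auto simp: space_pair_measure)
  have "(\<lambda>n. q n (fst p)) \<longlonglongrightarrow> fst p"
  proof (rule tendsto_sandwich[OF _ _ tendsto_const])
    show "(\<lambda>n. fst p + 1 / real (Suc n)) \<longlonglongrightarrow> fst p"
      using tendsto_add[OF tendsto_const LIMSEQ_inverse_real_of_nat, of "fst p"] by (simp add: inverse_eq_divide)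
  qed (use gt le in \<open>auto intro!: always_eventually less_imp_le\<close>)
  then have "filterlim (\<lambda>n. q n (fst p)) (at_right (fst p)) sequentially"
    unfolding filterlim_at using gt by (auto intro!: always_eventually simp: neq_iff)
  then show "(\<lambda>n. Y (q n (fst p)) (snd p)) \<longlonglongrightarrow> Y (fst p) (snd p)"
    by (rule filterlim_compose[OF rc[OF \<omega>]])
qed

section \<open>The Markov property and the Feynman-Kac semigroup\<close>

text \<open>
  Transition operators are applied to everywhere defined functions and not to almost everywhere classes,
  since for an individual \<open>x\<close> the law of \<open>X t\<close> under \<open>P\<^sup>x\<close> may charge a null set of states. The explicit bound is what the
  contraction argument for the Feynman-Kac equation keeps track of.
\<close>

definition bounded_Borel :: "real \<Rightarrow> ('a::topological_space \<Rightarrow> real) \<Rightarrow> bool" where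
  "bounded_Borel G g \<longleftrightarrow> g \<in> borel_measurable borel \<and> (\<forall>x. \<bar>g x\<bar> \<le> G)"

lemma bounded_BorelD:
  "bounded_Borel G g \<Longrightarrow> g \<in> borel_measurable borel" "bounded_Borel G g \<Longrightarrow> \<bar>g x\<bar> \<le> G"
  "bounded_Borel G g \<Longrightarrow> 0 \<le> G"
  by (auto simp: bounded_Borel_def intro: order_trans[OF abs_ge_zero])

lemma bounded_Borel_const: "bounded_Borel \<bar>a\<bar> (\<lambda>_. a)"
  by (simp add: bounded_Borel_def)

lemma bounded_Borel_mult: "bounded_Borel G g \<Longrightarrow> bounded_Borel H h \<Longrightarrow> bounded_Borel (G * H) (\<lambda>x. g x * h x)"
  by (auto simp: bounded_Borel_def abs_mult intro!: mult_mono intro: order_trans[OF abs_ge_zero])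

lemma bounded_Borel_add: "bounded_Borel G g \<Longrightarrow> bounded_Borel H h \<Longrightarrow> bounded_Borel (G + H) (\<lambda>x. g x + h x)"
  by (auto simp: bounded_Borel_def intro!: order_trans[OF abs_triangle_ineq] add_mono)

lemma bounded_Borel_scale: "bounded_Borel G g \<Longrightarrow> bounded_Borel (\<bar>a\<bar> * G) (\<lambda>x. a * g x)"
  by (auto simp: bounded_Borel_def abs_mult intro!: mult_left_mono)

lemma bounded_Borel_diff: "bounded_Borel G g \<Longrightarrow> bounded_Borel H h \<Longrightarrow> bounded_Borel (G + H) (\<lambda>x. g x - h x)"
  using bounded_Borel_add[of G g H "\<lambda>x. -1 * h x"] bounded_Borel_scale[of H h "-1"] by simp

locale cadlag_Markov =
  fixes F :: "'w measure"
    and \<FF> :: "real \<Rightarrow> 'w measure"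
    and X :: "real \<Rightarrow> 'w \<Rightarrow> 'a::polish_space"
    and P :: "'a \<Rightarrow> 'w measure"
  assumes Markov_family: "cadlag_Markov_family F \<FF> X P"
begin

text \<open>
  Freezing the process at its initial state for negative times makes it jointly measurable on the whole
  real line, without a restriction to nonnegative times.
\<close>

definition Y :: "real \<Rightarrow> 'w \<Rightarrow> 'a" where
  "Y t = X (max 0 t)"

definition T :: "real \<Rightarrow> ('a \<Rightarrow> real) \<Rightarrow> 'a \<Rightarrow> real" where
  "T t g x = (\<integral>\<omega>. g (Y t \<omega>) \<partial>P x)"

lemma T_eq_Markov_semigroup: "0 \<le> t \<Longrightarrow> Markov_semigroup X P t g = T t g"
  by (simp add: fun_eq_iff T_def Y_def Markov_semigroup_def)

lemma subalgebra_F: "0 \<le> t \<Longrightarrow> subalgebra F (\<FF> t)"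
  and filtration_mono: "0 \<le> s \<Longrightarrow> s \<le> t \<Longrightarrow> sets (\<FF> s) \<subseteq> sets (\<FF> t)"
  and X_adapted: "0 \<le> t \<Longrightarrow> X t \<in> \<FF> t \<rightarrow>\<^sub>M borel"
  and X_cadlag: "\<omega> \<in> space F \<Longrightarrow> cadlag (\<lambda>t. X t \<omega>)"
  and P_kernel [measurable]: "P \<in> borel \<rightarrow>\<^sub>M prob_algebra F"
  and P_start: "distr (P x) borel (X 0) = return borel x"
  and Markov_indicator: "0 \<le> s \<Longrightarrow> 0 \<le> t \<Longrightarrow> B \<in> sets borel \<Longrightarrow> AE \<omega> in P x.
    real_cond_exp (P x) (\<FF> s) (\<lambda>\<omega>'. indicator B (X (s + t) \<omega>')) \<omega>
      = measure (P (X s \<omega>)) {\<omega>' \<in> space F. X t \<omega>' \<in> B}"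
  using Markov_family unfolding cadlag_Markov_family_def by blast+

lemma space_filtration: "0 \<le> t \<Longrightarrow> space (\<FF> t) = space F"
  using subalgebra_F[of t] by (simp add: subalgebra_def)

lemma filtration_measurable_mono:
  assumes "0 \<le> s" "s \<le> t" "f \<in> \<FF> s \<rightarrow>\<^sub>M N"
  shows "f \<in> \<FF> t \<rightarrow>\<^sub>M N"
  by (rule measurable_from_subalg[OF _ assms(3)])
    (use assms filtration_mono[of s t] in \<open>auto simp: subalgebra_def space_filtration\<close>)

lemma filtration_measurable_F: "0 \<le> t \<Longrightarrow> f \<in> \<FF> t \<rightarrow>\<^sub>M N \<Longrightarrow> f \<in> F \<rightarrow>\<^sub>M N"
  by (rule measurable_from_subalg[OF subalgebra_F])

lemma sets_P [measurable_cong]: "sets (P x) = sets F"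
  and prob_space_P: "prob_space (P x)"
  using measurable_space[OF P_kernel, of x] by (auto simp: space_prob_algebra)

lemma space_P: "space (P x) = space F"
  using sets_eq_imp_space_eq[OF sets_P] .

lemma X_right_limit: "0 \<le> t \<Longrightarrow> \<omega> \<in> space F \<Longrightarrow> ((\<lambda>s. X s \<omega>) \<longlongrightarrow> X t \<omega>) (at_right t)"
  using X_cadlag[of \<omega>] by (simp add: cadlag_def)

lemma X_clamped_right_continuous:
  assumes \<omega>: "\<omega> \<in> space F" and u: "0 \<le> u"
  shows "((\<lambda>s. X (max 0 (min u s)) \<omega>) \<longlongrightarrow> X (max 0 (min u t)) \<omega>) (at_right t)"
proof -
  consider "t < 0" | "0 \<le> t" "t < u" | "u \<le> t" by linarith
  then show ?thesis
  proof cases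
    case 1
    then have "\<forall>\<^sub>F s in at_right t. X (max 0 (min u t)) \<omega> = X (max 0 (min u s)) \<omega>"
      using u by (auto simp: eventually_at_right_field intro!: exI[of _ 0])
    then show ?thesis by (rule tendsto_eventually[OF eventually_mono]) simp
  next
    case 2
    then have "\<forall>\<^sub>F s in at_right t. X s \<omega> = X (max 0 (min u s)) \<omega>"
      by (auto simp: eventually_at_right_field intro!: exI[of _ u])
    from Lim_transform_eventually[OF X_right_limit[OF 2(1) \<omega>] this] show ?thesis using 2 by simp
  next
    case 3
    then have "\<forall>\<^sub>F s in at_right t. X (max 0 (min u t)) \<omega> = X (max 0 (min u s)) \<omega>"
      by (auto simp: eventually_at_right_field intro!: exI[of _ "t + 1"])
    then show ?thesis by (rule tendsto_eventually[OF eventually_mono]) simp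
  qed
qed

text \<open>
  Integrals of a function of the path up to time \<open>u\<close> are known at time \<open>u\<close>; this requires joint
  measurability in time and path with respect to the information at time \<open>u\<close> alone. Stopping the time at \<open>u\<close>
  keeps the process adapted and right continuous.
\<close>

lemma progressively_measurable:
  assumes u: "0 \<le> u"
  shows "(\<lambda>p. X (max 0 (min u (fst p))) (snd p)) \<in> borel \<Otimes>\<^sub>M \<FF> u \<rightarrow>\<^sub>M borel"
proof (rule measurable_pair_right_continuous)
  show "X (max 0 (min u t)) \<in> \<FF> u \<rightarrow>\<^sub>M borel" for t
    using u by (intro filtration_measurable_mono[OF _ _ X_adapted]) auto
  show "((\<lambda>s. X (max 0 (min u s)) \<omega>) \<longlongrightarrow> X (max 0 (min u t)) \<omega>) (at_right t)"
    if "\<omega> \<in> space (\<FF> u)" for t \<omega>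
    using X_clamped_right_continuous[OF _ u] that space_filtration[OF u] by auto
qed

lemma Y_pair_measurable: "(\<lambda>p. Y (fst p) (snd p)) \<in> borel \<Otimes>\<^sub>M F \<rightarrow>\<^sub>M borel"
proof (rule measurable_pair_right_continuous)
  show "Y t \<in> F \<rightarrow>\<^sub>M borel" for t
    unfolding Y_def by (rule filtration_measurable_F[OF _ X_adapted]) auto
  show "((\<lambda>s. Y s \<omega>) \<longlongrightarrow> Y t \<omega>) (at_right t)" if \<omega>: "\<omega> \<in> space F" for t \<omega>
  proof -
    have ev: "\<forall>\<^sub>F s in at_right t. X (max 0 (min (\<bar>t\<bar> + 1) s)) \<omega> = Y s \<omega>"
      unfolding Y_def by (auto simp: eventually_at_right_field intro!: exI[of _ "\<bar>t\<bar> + 1"])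
    have "X (max 0 (min (\<bar>t\<bar> + 1) t)) \<omega> = Y t \<omega>" unfolding Y_def by simp
    then show ?thesis
      using Lim_transform_eventually[OF X_clamped_right_continuous[OF \<omega>, of "\<bar>t\<bar> + 1" t] ev] by simp
  qed
qed

lemma Y_measurable [measurable (raw)]:
  assumes "f \<in> borel_measurable N" "g \<in> N \<rightarrow>\<^sub>M F"
  shows "(\<lambda>x. Y (f x) (g x)) \<in> N \<rightarrow>\<^sub>M borel"
  using measurable_compose[OF measurable_Pair[OF assms] Y_pair_measurable] by simp

lemma T_measurable [measurable (raw)]:
  assumes [measurable]: "f \<in> borel_measurable N" "g \<in> N \<rightarrow>\<^sub>M borel" "h \<in> borel_measurable borel"
  shows "(\<lambda>x. T (f x) h (g x)) \<in> borel_measurable N"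
  unfolding T_def by (rule measurable_integral_kernel[where F = F]) measurable

lemma integrable_P:
  fixes f :: "'w \<Rightarrow> real"
  assumes "f \<in> borel_measurable F" "\<And>\<omega>. \<omega> \<in> space F \<Longrightarrow> \<bar>f \<omega>\<bar> \<le> B"
  shows "integrable (P x) f"
proof -
  interpret prob_space "P x" by (rule prob_space_P)
  show ?thesis
    by (rule integrable_const_bound[of _ B])
      (use assms in \<open>auto simp: space_P cong: measurable_cong_sets\<close>)
qed

lemma abs_integral_P_le:
  fixes f :: "'w \<Rightarrow> real"
  assumes "f \<in> borel_measurable F" "\<And>\<omega>. \<omega> \<in> space F \<Longrightarrow> \<bar>f \<omega>\<bar> \<le> B"
  shows "\<bar>\<integral>\<omega>. f \<omega> \<partial>P x\<bar> \<le> B"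
proof -
  interpret prob_space "P x" by (rule prob_space_P)
  have "\<bar>\<integral>\<omega>. f \<omega> \<partial>P x\<bar> \<le> (\<integral>\<omega>. \<bar>f \<omega>\<bar> \<partial>P x)" by simp
  also have "\<dots> \<le> (\<integral>\<omega>. B \<partial>P x)"
    using assms by (intro integral_mono integrable_abs integrable_P) (auto simp: space_P)
  finally show ?thesis by (simp add: prob_space)
qed

lemma T_bounded: "bounded_Borel G g \<Longrightarrow> bounded_Borel G (T t g)"
  unfolding bounded_Borel_def T_def[symmetric]
  by (auto simp: T_def intro!: abs_integral_P_le)

lemma T_0:
  fixes g :: "'a \<Rightarrow> real"
  assumes [measurable]: "g \<in> borel_measurable borel"
  shows "(\<integral>\<omega>. g (Y 0 \<omega>) \<partial>P x) = g x"
proof -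
  have "(\<integral>\<omega>. g (Y 0 \<omega>) \<partial>P x) = (\<integral>y. g y \<partial>distr (P x) borel (Y 0))"
    by (rule integral_distr[symmetric]) measurable
  then show ?thesis by (simp add: Y_def P_start integral_return)
qed

lemma integral_bind_P:
  assumes N: "prob_space N" "sets N = sets borel"
    and f: "f \<in> borel_measurable F" "\<And>\<omega>. \<omega> \<in> space F \<Longrightarrow> \<bar>f \<omega>\<bar> \<le> (B::real)"
  shows "(\<integral>\<omega>. f \<omega> \<partial>(N \<bind> P)) = (\<integral>x. \<integral>\<omega>. f \<omega> \<partial>P x \<partial>N)"
proof (rule integral_bind[OF f])
  show "P \<in> N \<rightarrow>\<^sub>M subprob_algebra F"
    using measurable_prob_algebraD[OF P_kernel] measurable_cong_sets[OF N(2) refl] by blast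
  show "finite_measure N" using N(1) by (rule prob_space.finite_measure)
  show "AE x in N. emeasure (P x) (space (P x)) \<le> ennreal 1"
    using prob_space.emeasure_space_1[OF prob_space_P] by (intro AE_I2) simp
qed

text \<open>
  Multiplying a conditional expectation by a function \<open>H\<close> of the past leaves the defining identity intact, and
  a monotone class argument replaces indicators by bounded functions.
\<close>

theorem Markov_property:
  assumes s: "0 \<le> s" and t: "0 \<le> t"
    and H: "H \<in> borel_measurable (\<FF> s)" "\<And>\<omega>. \<omega> \<in> space F \<Longrightarrow> \<bar>H \<omega>\<bar> \<le> B"
    and g: "bounded_Borel G g"
  shows "(\<integral>\<omega>. H \<omega> * g (Y (s + t) \<omega>) \<partial>P x) = (\<integral>\<omega>. H \<omega> * T t g (Y s \<omega>) \<partial>P x)"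
proof -
  interpret prob_space "P x" by (rule prob_space_P)
  have [measurable]: "H \<in> borel_measurable F" using filtration_measurable_F[OF s H(1)] .
  have B0: "0 \<le> B" using H(2) not_empty by (force simp: space_P intro: order_trans[OF abs_ge_zero])
  have sub: "subalgebra (P x) (\<FF> s)"
    using subalgebra_F[OF s] by (simp add: subalgebra_def sets_P space_P)
  interpret sub: sigma_finite_subalgebra "P x" "\<FF> s"
    by (rule finite_measure_subalgebra_is_sigma_finite) (unfold_locales, rule sub)
  have int: "integrable (P x) (\<lambda>\<omega>. H \<omega> * k (Y u \<omega>))" if "bounded_Borel D k" for k u D
  proof (rule integrable_P)
    have [measurable]: "k \<in> borel_measurable borel" using that by (rule bounded_BorelD)
    show "(\<lambda>\<omega>. H \<omega> * k (Y u \<omega>)) \<in> borel_measurable F" by measurable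
    show "\<bar>H \<omega> * k (Y u \<omega>)\<bar> \<le> B * D" if "\<omega> \<in> space F" for \<omega>
      using H(2)[OF that] bounded_BorelD(2,3)[OF \<open>bounded_Borel D k\<close>] B0 by (auto simp: abs_mult intro!: mult_mono)
  qed
  let ?claim = "\<lambda>k. (\<integral>\<omega>. H \<omega> * k (Y (s + t) \<omega>) \<partial>P x) = (\<integral>\<omega>. H \<omega> * T t k (Y s \<omega>) \<partial>P x)"
  have T_sum: "T t (\<lambda>x. a x + b x) y = T t a y + T t b y" if "bounded_Borel D a" "bounded_Borel D' b" for a b D D' y
    unfolding T_def using that
    by (intro Bochner_Integration.integral_add integrable_P) (auto dest: bounded_BorelD)
  have T_scale: "T t (\<lambda>x. a * b x) y = a * T t b y" for a b y
    unfolding T_def by simp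
  \<comment> \<open>Indicators are the definition of the Markov property; monotone classes do the rest.\<close>
  have nonneg: "(\<forall>y. k y \<le> D) \<longrightarrow> ?claim k" if k: "k \<in> borel_measurable borel" "\<And>y. 0 \<le> k y" for k D
    using k
  proof (induction arbitrary: D rule: borel_measurable_induct_real)
    case (set A)
    have eq: "T t (indicator A) y = measure (P y) {\<omega> \<in> space F. X t \<omega> \<in> A}" for y
    proof -
      have "{\<omega> \<in> space F. Y t \<omega> \<in> A} \<in> sets F" using set by measurable
      then have "(\<integral>\<omega>. indicator {\<omega> \<in> space F. Y t \<omega> \<in> A} \<omega> \<partial>P y) = measure (P y) {\<omega> \<in> space F. Y t \<omega> \<in> A}"
        by (simp add: space_P Int_absorb1)
      moreover have "(\<integral>\<omega>. indicator {\<omega> \<in> space F. Y t \<omega> \<in> A} \<omega> \<partial>P y) = T t (indicator A) y"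
        unfolding T_def by (rule Bochner_Integration.integral_cong) (auto simp: space_P indicator_def)
      ultimately show ?thesis using t by (simp add: Y_def)
    qed
    have ind: "bounded_Borel 1 (indicator A)"
      using set by (auto simp: bounded_Borel_def indicator_def)
    have st: "(\<lambda>\<omega>. indicator A (Y (s + t) \<omega>)) = (\<lambda>\<omega>. indicat_real A (X (s + t) \<omega>))"
      using s t by (simp add: Y_def)
    have [measurable]: "(\<lambda>\<omega>. indicat_real A (Y (s + t) \<omega>)) \<in> borel_measurable (P x)"
      using set by measurable
    have "(\<integral>\<omega>. H \<omega> * indicator A (Y (s + t) \<omega>) \<partial>P x)
        = (\<integral>\<omega>. H \<omega> * real_cond_exp (P x) (\<FF> s) (\<lambda>\<omega>. indicator A (Y (s + t) \<omega>)) \<omega> \<partial>P x)"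
      by (rule sub.real_cond_exp_intg(2)[symmetric]) (use int[OF ind] H in auto)
    also have "\<dots> = (\<integral>\<omega>. H \<omega> * T t (indicator A) (Y s \<omega>) \<partial>P x)"
    proof (rule integral_cong_AE)
      have "AE \<omega> in P x. real_cond_exp (P x) (\<FF> s) (\<lambda>\<omega>. indicator A (Y (s + t) \<omega>)) \<omega> = T t (indicator A) (Y s \<omega>)"
        using Markov_indicator[OF s t set] unfolding eq st using s by (simp add: Y_def)
      then show "AE \<omega> in P x. H \<omega> * real_cond_exp (P x) (\<FF> s) (\<lambda>\<omega>. indicator A (Y (s + t) \<omega>)) \<omega>
          = H \<omega> * T t (indicator A) (Y s \<omega>)"
        by eventually_elim simp
      show "(\<lambda>\<omega>. H \<omega> * real_cond_exp (P x) (\<FF> s) (\<lambda>\<omega>. indicator A (Y (s + t) \<omega>)) \<omega>) \<in> borel_measurable (P x)"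
        by measurable
      show "(\<lambda>\<omega>. H \<omega> * T t (indicator A) (Y s \<omega>)) \<in> borel_measurable (P x)"
        using set by measurable
    qed
    finally show ?case by simp
  next
    case (mult u c)
    show ?case
    proof (cases "c = 0")
      case True
      then show ?thesis by (simp add: T_def)
    next
      case False
      show ?thesis
      proof
        assume "\<forall>y. c * u y \<le> D"
        then have "\<forall>y. u y \<le> D / c" using False mult by (simp add: field_simps)
        then have "?claim u" using mult.IH by blast
        then have "c * (\<integral>\<omega>. H \<omega> * u (Y (s + t) \<omega>) \<partial>P x) = c * (\<integral>\<omega>. H \<omega> * T t u (Y s \<omega>) \<partial>P x)"
          by (rule arg_cong)
        then show "?claim (\<lambda>y. c * u y)" unfolding T_scale by (simp only: mult.left_commute[of _ c] integral_mult_right_zero)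
      qed
    qed
  next
    case (add u v)
    show ?case
    proof
      assume *: "\<forall>y. v y + u y \<le> D"
      have "u y \<le> D \<and> v y \<le> D" for y
        using *[rule_format, of y] add.hyps(2)[of y] add.hyps(4)[of y] by linarith
      then have uD: "\<forall>y. u y \<le> D" and vD: "\<forall>y. v y \<le> D" by auto
      have u: "bounded_Borel D u" and v: "bounded_Borel D v"
        using uD vD add by (auto simp: bounded_Borel_def)
      show "?claim (\<lambda>y. v y + u y)"
        using add.IH uD vD int[OF u] int[OF v] int[OF T_bounded[OF u]] int[OF T_bounded[OF v]]
        by (simp add: T_sum[OF v u] distrib_left)
    qed
  next
    case (seq U)
    show ?case
    proof
      assume kD: "\<forall>y. k y \<le> D"
      have U_le: "U i y \<le> k y" for i y
        using seq.hyps(3) seq.hyps(4)[of y] by (intro incseq_le) (auto simp: incseq_def le_fun_def)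
      have UD: "bounded_Borel D (U i)" for i
        using seq.hyps(1,2) order_trans[OF U_le kD[rule_format]] by (auto simp: bounded_Borel_def)
      have kb: "bounded_Borel D k"
        using k kD by (auto simp: bounded_Borel_def)
      have [measurable]: "U i \<in> borel_measurable borel" "k \<in> borel_measurable borel" for i
        using seq.hyps k by auto
      have T_lim: "(\<lambda>i. T t (U i) y) \<longlonglongrightarrow> T t k y" for y
        unfolding T_def
      proof (rule integral_dominated_convergence[where w = "\<lambda>_. D"])
        interpret Py: prob_space "P y" by (rule prob_space_P)
        show "integrable (P y) (\<lambda>_. D)" by simp
      qed (use seq.hyps(4) bounded_BorelD(2)[OF UD] in auto)
      have dom: "(\<lambda>i. \<integral>\<omega>. H \<omega> * h i (Y u \<omega>) \<partial>P x) \<longlonglongrightarrow> (\<integral>\<omega>. H \<omega> * h' (Y u \<omega>) \<partial>P x)"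
        if h: "\<And>i. bounded_Borel D (h i)" "bounded_Borel D h'" and lim: "\<And>y. (\<lambda>i. h i y) \<longlonglongrightarrow> h' y" for h h' u
      proof (rule integral_dominated_convergence[where w = "\<lambda>_. B * D"])
        have [measurable]: "h i \<in> borel_measurable borel" "h' \<in> borel_measurable borel" for i
          using h by (auto dest: bounded_BorelD)
        show "(\<lambda>\<omega>. H \<omega> * h' (Y u \<omega>)) \<in> borel_measurable (P x)"
          "\<And>i. (\<lambda>\<omega>. H \<omega> * h i (Y u \<omega>)) \<in> borel_measurable (P x)" by measurable
        show "AE \<omega> in P x. (\<lambda>i. H \<omega> * h i (Y u \<omega>)) \<longlonglongrightarrow> H \<omega> * h' (Y u \<omega>)"
          by (intro AE_I2 tendsto_mult tendsto_const lim)
        show "AE \<omega> in P x. norm (H \<omega> * h i (Y u \<omega>)) \<le> B * D" for i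
          using H(2) bounded_BorelD(2)[OF h(1)] B0 by (intro AE_I2) (auto simp: abs_mult space_P intro!: mult_mono)
      qed simp
      have "(\<lambda>i. \<integral>\<omega>. H \<omega> * U i (Y (s + t) \<omega>) \<partial>P x) \<longlonglongrightarrow> (\<integral>\<omega>. H \<omega> * k (Y (s + t) \<omega>) \<partial>P x)"
        by (rule dom[OF UD kb]) (use seq.hyps(4) in auto)
      moreover have "(\<lambda>i. \<integral>\<omega>. H \<omega> * T t (U i) (Y s \<omega>) \<partial>P x) \<longlonglongrightarrow> (\<integral>\<omega>. H \<omega> * T t k (Y s \<omega>) \<partial>P x)"
        by (rule dom[OF T_bounded[OF UD] T_bounded[OF kb] T_lim])
      moreover have "?claim (U i)" for i
        using seq.IH[of i D] bounded_BorelD(2)[OF UD[of i]] by (auto dest: abs_le_D1)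
      ultimately show "?claim k" using LIMSEQ_unique by simp
    qed
  qed
  have shift: "bounded_Borel (G + \<bar>G\<bar>) (\<lambda>y. g y + G)"
    using bounded_Borel_add[OF g bounded_Borel_const[of G]] .
  have c1: "?claim (\<lambda>y. g y + G)"
  proof (rule nonneg[rule_format])
    show "(\<lambda>y. g y + G) \<in> borel_measurable borel" using shift by (rule bounded_BorelD)
    show "0 \<le> g y + G" for y using bounded_BorelD(2)[OF g, of y] by (simp add: abs_le_iff)
    show "g y + G \<le> G + \<bar>G\<bar>" for y using bounded_BorelD(2)[OF shift, of y] by (simp add: abs_le_iff)
  qed
  have T1: "T t (\<lambda>_. G) y = G" for y
    using prob_space.prob_space[OF prob_space_P, of y] by (simp add: T_def)
  show ?thesis
    using c1 int[OF g, of "s + t"] int[OF T_bounded[OF g, of t], of s] int[OF bounded_Borel_const[of G]]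
    by (simp add: T_sum[OF g bounded_Borel_const] T1 distrib_left)
qed

end

locale bounded_potential = cadlag_Markov F \<FF> X P
  for F :: "'w measure" and \<FF> :: "real \<Rightarrow> 'w measure"
    and X :: "real \<Rightarrow> 'w \<Rightarrow> 'a::polish_space" and P :: "'a \<Rightarrow> 'w measure" +
  fixes W :: "'a \<Rightarrow> real" and K :: real
  assumes W: "bounded_Borel K W"
begin

lemma W_measurable [measurable]: "W \<in> borel_measurable borel"
  and W_le: "\<bar>W x\<bar> \<le> K"
  and K_nonneg: "0 \<le> K"
  using bounded_BorelD[OF W] by auto

text \<open>
  The second argument is the length of the time interval and not its end point, which suits the
  recursion over the time that remains.
\<close>

definition Z :: "real \<Rightarrow> real \<Rightarrow> 'w \<Rightarrow> real" where
  "Z s t \<omega> = (LINT r:{0..t}|lborel. W (Y (s + r) \<omega>))"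

text \<open>
  This is the Feynman-Kac semigroup with potential \<open>W\<close>; its generator is formally \<open>A + W\<close>.
\<close>

definition Q :: "real \<Rightarrow> ('a \<Rightarrow> real) \<Rightarrow> 'a \<Rightarrow> real" where
  "Q t g x = (\<integral>\<omega>. exp (Z 0 t \<omega>) * g (Y t \<omega>) \<partial>P x)"

lemma Z_measurable [measurable (raw)]:
  assumes [measurable]: "s \<in> borel_measurable N" "t \<in> borel_measurable N" "h \<in> N \<rightarrow>\<^sub>M F"
  shows "(\<lambda>x. Z (s x) (t x) (h x)) \<in> borel_measurable N"
  unfolding Z_def by (rule measurable_set_integral_Icc) measurable

lemma path_measurable:
  assumes "\<omega> \<in> space F"
  shows "(\<lambda>r. W (Y (s + r) \<omega>)) \<in> borel_measurable borel"
  using assms by measurable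

lemma abs_Z_le:
  assumes "0 \<le> t" "\<omega> \<in> space F"
  shows "\<bar>Z s t \<omega>\<bar> \<le> K * t"
  unfolding Z_def
  using abs_set_integral_bounded[OF path_measurable[OF assms(2)] assms(1), of s K] W_le by simp

lemma exp_Z_le:
  assumes "0 \<le> t" "\<omega> \<in> space F"
  shows "exp (Z s t \<omega>) \<le> exp (K * t)"
  using abs_Z_le[OF assms, of s] by simp

lemma Z_add:
  assumes "0 \<le> s" "0 \<le> t" "\<omega> \<in> space F"
  shows "Z u (s + t) \<omega> = Z u s \<omega> + Z (u + s) t \<omega>"
proof -
  have "set_integrable lborel {0..s + t} (\<lambda>r. W (Y (u + r) \<omega>))"
    using path_measurable[OF assms(3)] W_le by (intro set_integrable_bounded) auto
  then have "Z u (s + t) \<omega> = Z u s \<omega> + (LINT r:{s..s + t}|lborel. W (Y (u + r) \<omega>))"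
    unfolding Z_def using assms by (intro set_integral_Icc_combine) auto
  also have "(LINT r:{s..s + t}|lborel. W (Y (u + r) \<omega>)) = Z (u + s) t \<omega>"
    unfolding Z_def using set_integral_Icc_shift[of 0 t "\<lambda>r. W (Y (u + r) \<omega>)" s] by (simp add: add.assoc)
  finally show ?thesis .
qed

lemma exp_Z_eq:
  assumes "0 \<le> t" "\<omega> \<in> space F"
  shows "exp (Z s t \<omega>) = 1 + (LINT r:{0..t}|lborel. W (Y (s + r) \<omega>) * exp (Z s r \<omega>))"
  unfolding Z_def using exp_set_integral[OF path_measurable[OF assms(2)] _ assms(1)] W_le by blast

lemma Z_adapted:
  assumes s: "0 \<le> s" and t: "0 \<le> t"
  shows "Z s t \<in> borel_measurable (\<FF> (s + t))"
proof -
  have u: "0 \<le> s + t" using s t by simp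
  have "(\<lambda>\<omega>. LINT r:{0..t}|lborel. W (X (max 0 (min (s + t) (s + r))) \<omega>)) \<in> borel_measurable (\<FF> (s + t))"
  proof (rule measurable_set_integral_Icc)
    have "(\<lambda>p. (s + snd p, fst p)) \<in> \<FF> (s + t) \<Otimes>\<^sub>M borel \<rightarrow>\<^sub>M borel \<Otimes>\<^sub>M \<FF> (s + t)"
      by measurable
    from measurable_compose[OF measurable_compose[OF this progressively_measurable[OF u]] W_measurable]
    show "(\<lambda>p. W (X (max 0 (min (s + t) (s + snd p))) (fst p))) \<in> borel_measurable (\<FF> (s + t) \<Otimes>\<^sub>M borel)"
      by simp
  qed simp
  moreover have "(LINT r:{0..t}|lborel. W (X (max 0 (min (s + t) (s + r))) \<omega>)) = Z s t \<omega>" for \<omega>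
    unfolding Z_def Y_def by (rule set_lebesgue_integral_cong) (use s in \<open>auto simp: min_def\<close>)
  ultimately show ?thesis by simp
qed

lemma Y_adapted: "0 \<le> t \<Longrightarrow> Y t \<in> \<FF> t \<rightarrow>\<^sub>M borel"
  using X_adapted[of t] by (simp add: Y_def)

lemma Q_measurable [measurable (raw)]:
  assumes [measurable]: "t \<in> borel_measurable N" "h \<in> N \<rightarrow>\<^sub>M borel" "g \<in> borel_measurable borel"
  shows "(\<lambda>x. Q (t x) g (h x)) \<in> borel_measurable N"
  unfolding Q_def by (rule measurable_integral_kernel[where F = F]) measurable

lemma Q_bounded:
  assumes "0 \<le> t" "bounded_Borel G g"
  shows "bounded_Borel (exp (K * t) * G) (Q t g)"
proof -
  have [measurable]: "g \<in> borel_measurable borel" using assms(2) by (rule bounded_BorelD)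
  have "\<bar>Q t g x\<bar> \<le> exp (K * t) * G" for x
    unfolding Q_def
  proof (rule abs_integral_P_le)
    show "\<bar>exp (Z 0 t \<omega>) * g (Y t \<omega>)\<bar> \<le> exp (K * t) * G" if "\<omega> \<in> space F" for \<omega>
      using exp_Z_le[OF assms(1) that] bounded_BorelD(2)[OF assms(2)] by (auto simp: abs_mult intro!: mult_mono)
  qed measurable
  then show ?thesis by (auto simp: bounded_Borel_def)
qed

lemma abs_future_le:
  assumes "0 \<le> t" "bounded_Borel G g" "\<omega> \<in> space F" "\<bar>h\<bar> \<le> B"
  shows "\<bar>h * (exp (Z s t \<omega>) * g (Y u \<omega>))\<bar> \<le> B * (exp (K * t) * G)"
  using exp_Z_le[OF assms(1,3), of s] bounded_BorelD(2,3)[OF assms(2)] assms(4)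
  by (auto simp: abs_mult intro!: mult_mono)

text \<open>
  Expand the exponential by \<open>exp_Z_eq\<close> and condition the integrand at time \<open>s + r\<close>. All its factors except
  \<open>g (Y (s + t) \<omega>)\<close> are known by then, so the Markov property for a single future time is enough.
\<close>

lemma Duhamel:
  assumes s: "0 \<le> s" and t: "0 \<le> t"
    and H: "H \<in> borel_measurable (\<FF> s)" "\<And>\<omega>. \<omega> \<in> space F \<Longrightarrow> \<bar>H \<omega>\<bar> \<le> B"
    and g: "bounded_Borel G g"
  shows "(\<integral>\<omega>. H \<omega> * (exp (Z s t \<omega>) * g (Y (s + t) \<omega>)) \<partial>P x)
    = (\<integral>\<omega>. H \<omega> * T t g (Y s \<omega>) \<partial>P x)
      + (LINT r:{0..t}|lborel. \<integral>\<omega>. H \<omega> * (exp (Z s r \<omega>) * (W (Y (s + r) \<omega>) * T (t - r) g (Y (s + r) \<omega>))) \<partial>P x)"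
proof -
  interpret prob_space "P x" by (rule prob_space_P)
  have [measurable]: "H \<in> borel_measurable F" using filtration_measurable_F[OF s H(1)] .
  have [measurable]: "g \<in> borel_measurable borel" using g by (rule bounded_BorelD)
  have B0: "0 \<le> B" using H(2) not_empty by (force simp: space_P intro: order_trans[OF abs_ge_zero])
  define I where "I r \<omega> = H \<omega> * (exp (Z s r \<omega>) * (W (Y (s + r) \<omega>) * g (Y (s + t) \<omega>)))" for r \<omega>
  have I_meas [measurable]: "(\<lambda>p. I (fst p) (snd p)) \<in> borel_measurable (borel \<Otimes>\<^sub>M F)"
    unfolding I_def by measurable
  have I_le: "\<bar>I r \<omega>\<bar> \<le> B * (exp (K * t) * (K * G))" if "r \<in> {0..t}" "\<omega> \<in> space F" for r \<omega>
  proof -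
    have "exp (Z s r \<omega>) \<le> exp (K * t)"
      using exp_Z_le[of r \<omega> s] that mult_left_mono[of r t K] K_nonneg by (auto intro: order_trans)
    then show ?thesis
      unfolding I_def using H(2)[OF that(2)] W_le bounded_BorelD(2,3)[OF g] B0 K_nonneg
      by (auto simp: abs_mult intro!: mult_mono mult_nonneg_nonneg)
  qed
  have expand: "H \<omega> * (exp (Z s t \<omega>) * g (Y (s + t) \<omega>))
      = H \<omega> * g (Y (s + t) \<omega>) + (LINT r:{0..t}|lborel. I r \<omega>)" if \<omega>: "\<omega> \<in> space F" for \<omega>
  proof -
    have "(LINT r:{0..t}|lborel. I r \<omega>)
        = (LINT r:{0..t}|lborel. (H \<omega> * g (Y (s + t) \<omega>)) * (W (Y (s + r) \<omega>) * exp (Z s r \<omega>)))"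
      unfolding I_def by (rule arg_cong[where f = "set_lebesgue_integral lborel {0..t}"]) (auto simp: fun_eq_iff)
    also have "\<dots> = (H \<omega> * g (Y (s + t) \<omega>)) * (LINT r:{0..t}|lborel. W (Y (s + r) \<omega>) * exp (Z s r \<omega>))"
      by (rule set_integral_mult_right)
    also have "\<dots> = (H \<omega> * g (Y (s + t) \<omega>)) * (exp (Z s t \<omega>) - 1)"
      unfolding exp_Z_eq[OF t \<omega>, of s] by simp
    finally show ?thesis by (simp add: algebra_simps)
  qed
  have int: "integrable (P x) (\<lambda>\<omega>. LINT r:{0..t}|lborel. I r \<omega>)"
  proof (rule integrable_P)
    show "(\<lambda>\<omega>. LINT r:{0..t}|lborel. I r \<omega>) \<in> borel_measurable F"
    proof (rule measurable_set_integral_Icc)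
      show "(\<lambda>p. I (snd p) (fst p)) \<in> borel_measurable (F \<Otimes>\<^sub>M borel)" unfolding I_def by measurable
    qed simp
    show "\<bar>LINT r:{0..t}|lborel. I r \<omega>\<bar> \<le> B * (exp (K * t) * (K * G)) * (t - 0)" if "\<omega> \<in> space F" for \<omega>
    proof (rule abs_set_integral_bounded)
      show "(\<lambda>r. I r \<omega>) \<in> borel_measurable borel" unfolding I_def using that by measurable
    qed (use t I_le that in auto)
  qed
  have int': "integrable (P x) (\<lambda>\<omega>. H \<omega> * g (Y (s + t) \<omega>))"
    by (rule integrable_P[of _ "B * G"])
      (use H(2) bounded_BorelD(2)[OF g] B0 in \<open>auto simp: abs_mult intro!: mult_mono\<close>)
  have "(\<integral>\<omega>. H \<omega> * (exp (Z s t \<omega>) * g (Y (s + t) \<omega>)) \<partial>P x)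
      = (\<integral>\<omega>. H \<omega> * g (Y (s + t) \<omega>) + (LINT r:{0..t}|lborel. I r \<omega>) \<partial>P x)"
    by (rule Bochner_Integration.integral_cong) (auto simp: space_P expand)
  also have "\<dots> = (\<integral>\<omega>. H \<omega> * g (Y (s + t) \<omega>) \<partial>P x) + (\<integral>\<omega>. (LINT r:{0..t}|lborel. I r \<omega>) \<partial>P x)"
    using int int' by simp
  also have "(\<integral>\<omega>. H \<omega> * g (Y (s + t) \<omega>) \<partial>P x) = (\<integral>\<omega>. H \<omega> * T t g (Y s \<omega>) \<partial>P x)"
    by (rule Markov_property[OF s t H g])
  also have "(\<integral>\<omega>. (LINT r:{0..t}|lborel. I r \<omega>) \<partial>P x) = (LINT r:{0..t}|lborel. \<integral>\<omega>. I r \<omega> \<partial>P x)"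
    by (rule integral_set_integral_swap[where B = "B * (exp (K * t) * (K * G))"]) (use I_le in \<open>auto simp: space_P\<close>)
  also have "\<dots> = (LINT r:{0..t}|lborel. \<integral>\<omega>. H \<omega> * (exp (Z s r \<omega>) * (W (Y (s + r) \<omega>) * T (t - r) g (Y (s + r) \<omega>))) \<partial>P x)"
  proof (rule set_lebesgue_integral_cong)
    show "\<forall>r. r \<in> {0..t} \<longrightarrow> (\<integral>\<omega>. I r \<omega> \<partial>P x)
        = (\<integral>\<omega>. H \<omega> * (exp (Z s r \<omega>) * (W (Y (s + r) \<omega>) * T (t - r) g (Y (s + r) \<omega>))) \<partial>P x)"
    proof (intro allI impI)
      fix r assume r: "r \<in> {0..t}"
      let ?H = "\<lambda>\<omega>. H \<omega> * (exp (Z s r \<omega>) * W (Y (s + r) \<omega>))"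
      have [measurable]: "H \<in> borel_measurable (\<FF> (s + r))" "Z s r \<in> borel_measurable (\<FF> (s + r))"
          "Y (s + r) \<in> \<FF> (s + r) \<rightarrow>\<^sub>M borel"
        using s r by (auto intro!: Z_adapted Y_adapted intro: filtration_measurable_mono[OF s _ H(1)])
      have "(\<integral>\<omega>. ?H \<omega> * g (Y (s + r + (t - r)) \<omega>) \<partial>P x) = (\<integral>\<omega>. ?H \<omega> * T (t - r) g (Y (s + r) \<omega>) \<partial>P x)"
      proof (rule Markov_property)
        show "?H \<in> borel_measurable (\<FF> (s + r))" by measurable
        show "\<bar>?H \<omega>\<bar> \<le> B * (exp (K * r) * K)" if "\<omega> \<in> space F" for \<omega>
          using r by (intro abs_future_le[OF _ W that H(2)[OF that]]) auto
      qed (use s r g in auto)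
      then show "(\<integral>\<omega>. I r \<omega> \<partial>P x)
          = (\<integral>\<omega>. H \<omega> * (exp (Z s r \<omega>) * (W (Y (s + r) \<omega>) * T (t - r) g (Y (s + r) \<omega>))) \<partial>P x)"
        unfolding I_def by (simp add: mult.assoc)
    qed
  qed simp
  finally show ?thesis .
qed

lemma Duhamel_Q:
  assumes t: "0 \<le> t" and g: "bounded_Borel G g"
  shows "Q t g x = T t g x + (LINT r:{0..t}|lborel. Q r (\<lambda>y. W y * T (t - r) g y) x)"
proof -
  have [measurable]: "g \<in> borel_measurable borel" using g by (rule bounded_BorelD)
  have "Q t g x = (\<integral>\<omega>. 1 * T t g (Y 0 \<omega>) \<partial>P x)
      + (LINT r:{0..t}|lborel. \<integral>\<omega>. 1 * (exp (Z 0 r \<omega>) * (W (Y (0 + r) \<omega>) * T (t - r) g (Y (0 + r) \<omega>))) \<partial>P x)"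
    using Duhamel[of 0 t "\<lambda>_. 1" 1 G g x] t g unfolding Q_def by simp
  then show ?thesis by (simp add: Q_def T_0)
qed

lemma set_integral_exp_le:
  assumes "0 \<le> t"
  shows "(LINT r:{0..t}|lborel. K * exp (2 * K * r)) \<le> exp (2 * K * t) / 2"
proof -
  have "(LINT r:{0..t}|lborel. K * exp (2 * K * r)) = exp (2 * K * t) / 2 - exp (2 * K * 0) / 2"
    unfolding set_lebesgue_integral_def using assms
    by (intro integral_FTC_Icc)
      (auto intro!: derivative_eq_intros continuous_intros simp: has_real_derivative_iff_has_vector_derivative[symmetric])
  then show ?thesis by simp
qed

text \<open>
  The Markov property for a functional of a whole path segment. Replacing the integral in the exponent by
  Riemann sums would ask for continuity of \<open>W\<close>, which is only measurable. Instead, both sides satisfy Duhamel's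
  equation as functions of \<open>t\<close> and \<open>g\<close>, and that equation has only one solution.
\<close>

theorem Feynman_Kac_Markov_property:
  assumes s: "0 \<le> s" and t: "0 \<le> t"
    and H: "H \<in> borel_measurable (\<FF> s)" "\<And>\<omega>. \<omega> \<in> space F \<Longrightarrow> \<bar>H \<omega>\<bar> \<le> B"
    and g: "bounded_Borel G g"
  shows "(\<integral>\<omega>. H \<omega> * (exp (Z s t \<omega>) * g (Y (s + t) \<omega>)) \<partial>P x) = (\<integral>\<omega>. H \<omega> * Q t g (Y s \<omega>) \<partial>P x)"
proof -
  interpret prob_space "P x" by (rule prob_space_P)
  have [measurable]: "H \<in> borel_measurable F" using filtration_measurable_F[OF s H(1)] .
  have B0: "0 \<le> B" using H(2) not_empty by (force simp: space_P intro: order_trans[OF abs_ge_zero])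
  define a where "a t g = (\<integral>\<omega>. H \<omega> * (exp (Z s t \<omega>) * g (Y (s + t) \<omega>)) \<partial>P x)" for t g
  define b where "b t g = (\<integral>\<omega>. H \<omega> * Q t g (Y s \<omega>) \<partial>P x)" for t g
  have a_le: "\<bar>a t g\<bar> \<le> B * (exp (K * t) * G)" if "0 \<le> t" "bounded_Borel G g" for t g G
  proof -
    have [measurable]: "g \<in> borel_measurable borel" using that(2) by (rule bounded_BorelD)
    show ?thesis
      unfolding a_def by (rule abs_integral_P_le) (use that abs_future_le H(2) in auto)
  qed
  have HQ_le: "\<bar>H \<omega> * Q t g y\<bar> \<le> B * (exp (K * t) * G)"
    if "0 \<le> t" "bounded_Borel G g" "\<omega> \<in> space F" for t g G \<omega> y
    using H(2)[OF that(3)] bounded_BorelD(2)[OF Q_bounded[OF that(1,2)], of y] B0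
    by (auto simp: abs_mult intro!: mult_mono)
  have b_le: "\<bar>b t g\<bar> \<le> B * (exp (K * t) * G)" if "0 \<le> t" "bounded_Borel G g" for t g G
  proof -
    have [measurable]: "g \<in> borel_measurable borel" using that(2) by (rule bounded_BorelD)
    show ?thesis
      unfolding b_def by (rule abs_integral_P_le) (use that HQ_le in auto)
  qed
  have WT: "bounded_Borel (K * G) (\<lambda>y. W y * T u g y)" if "bounded_Borel G g" for u g G
    by (intro bounded_Borel_mult W T_bounded that)
  have mono: "exp (K * r) * (K * G) \<le> exp (K * t) * (K * G)" if "r \<in> {0..t}" "0 \<le> G" for r t G
    using that K_nonneg by (intro mult_right_mono) (auto intro!: mult_left_mono)
  have a_eq: "a t g = b' + (LINT r:{0..t}|lborel. a r (\<lambda>y. W y * T (t - r) g y))"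
    if "b' = (\<integral>\<omega>. H \<omega> * T t g (Y s \<omega>) \<partial>P x)" "0 \<le> t" "bounded_Borel G g" for t g G b'
    unfolding a_def that(1) by (rule Duhamel[OF s that(2) H that(3)])
  have b_eq: "b t g = (\<integral>\<omega>. H \<omega> * T t g (Y s \<omega>) \<partial>P x)
      + (LINT r:{0..t}|lborel. b r (\<lambda>y. W y * T (t - r) g y))"
    if t: "0 \<le> t" and g: "bounded_Borel G g" for t g G
  proof -
    have [measurable]: "g \<in> borel_measurable borel" using g by (rule bounded_BorelD)
    have G0: "0 \<le> G" using g by (rule bounded_BorelD)
    define J where "J r \<omega> = H \<omega> * Q r (\<lambda>y. W y * T (t - r) g y) (Y s \<omega>)" for r \<omega>
    have Qr: "(\<lambda>p. Q (fst p) (\<lambda>y. W y * T (t - fst p) g y) (snd p)) \<in> borel_measurable (borel \<Otimes>\<^sub>M borel)"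
      unfolding Q_def by (rule measurable_integral_kernel[where F = F]) measurable
    have J_meas: "(\<lambda>p. J (fst p) (snd p)) \<in> borel_measurable (borel \<Otimes>\<^sub>M F)"
    proof -
      have "(\<lambda>p. (fst p, Y s (snd p))) \<in> borel \<Otimes>\<^sub>M F \<rightarrow>\<^sub>M borel \<Otimes>\<^sub>M borel" by measurable
      from measurable_compose[OF this Qr] show ?thesis unfolding J_def by simp
    qed
    have J_le: "\<bar>J r \<omega>\<bar> \<le> B * (exp (K * t) * (K * G))" if r: "r \<in> {0..t}" and \<omega>: "\<omega> \<in> space F" for r \<omega>
    proof -
      have "\<bar>J r \<omega>\<bar> \<le> B * (exp (K * r) * (K * G))"
        unfolding J_def using r by (intro HQ_le WT g \<omega>) auto
      also have "\<dots> \<le> B * (exp (K * t) * (K * G))"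
        by (intro mult_left_mono mono r G0 B0)
      finally show ?thesis .
    qed
    have "b t g = (\<integral>\<omega>. H \<omega> * T t g (Y s \<omega>) + (LINT r:{0..t}|lborel. J r \<omega>) \<partial>P x)"
      unfolding b_def J_def Duhamel_Q[OF t g] by (simp add: distrib_left)
    also have "\<dots> = (\<integral>\<omega>. H \<omega> * T t g (Y s \<omega>) \<partial>P x) + (\<integral>\<omega>. (LINT r:{0..t}|lborel. J r \<omega>) \<partial>P x)"
    proof (rule Bochner_Integration.integral_add)
      show "integrable (P x) (\<lambda>\<omega>. H \<omega> * T t g (Y s \<omega>))"
        by (rule integrable_P[of _ "B * G"])
          (use H(2) bounded_BorelD(2)[OF T_bounded[OF g]] B0 in \<open>auto simp: abs_mult intro!: mult_mono\<close>)
      show "integrable (P x) (\<lambda>\<omega>. LINT r:{0..t}|lborel. J r \<omega>)"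
      proof (rule integrable_P)
        have "(\<lambda>p. (snd p, fst p)) \<in> F \<Otimes>\<^sub>M borel \<rightarrow>\<^sub>M borel \<Otimes>\<^sub>M F" by measurable
        from measurable_compose[OF this J_meas]
        show "(\<lambda>\<omega>. LINT r:{0..t}|lborel. J r \<omega>) \<in> borel_measurable F"
          by (intro measurable_set_integral_Icc) auto
        show "\<bar>LINT r:{0..t}|lborel. J r \<omega>\<bar> \<le> B * (exp (K * t) * (K * G)) * (t - 0)" if "\<omega> \<in> space F" for \<omega>
        proof (rule abs_set_integral_bounded)
          show "(\<lambda>r. J r \<omega>) \<in> borel_measurable borel"
            using measurable_compose[OF measurable_Pair2'[OF that] J_meas] by simp
        qed (use t J_le that in auto)
      qed
    qed
    also have "(\<integral>\<omega>. (LINT r:{0..t}|lborel. J r \<omega>) \<partial>P x) = (LINT r:{0..t}|lborel. \<integral>\<omega>. J r \<omega> \<partial>P x)"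
      by (rule integral_set_integral_swap[where B = "B * (exp (K * t) * (K * G))"])
        (use J_le J_meas in \<open>auto simp: space_P cong: measurable_cong_sets\<close>)
    finally show ?thesis by (simp add: b_def J_def)
  qed
  \<comment> \<open>Both sides solve the same Volterra equation; in the weighted supremum norm with weight
    \<open>exp (- 2 K t)\<close> the equation is a contraction with factor one half.\<close>
  have contract: "\<bar>a t g - b t g\<bar> \<le> (2 * B / 2 ^ n) * (exp (2 * K * t) * G)"
    if "0 \<le> t" "bounded_Borel G g" for n t g G
    using that
  proof (induction n arbitrary: t g G)
    case 0
    have "\<bar>a t g - b t g\<bar> \<le> 2 * (B * (exp (K * t) * G))"
      using a_le[OF 0] b_le[OF 0] by linarith
    also have "\<dots> \<le> 2 * (B * (exp (2 * K * t) * G))"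
      using B0 K_nonneg 0 bounded_BorelD(3)[OF 0(2)] by (intro mult_left_mono mult_right_mono) auto
    finally show ?case by simp
  next
    case (Suc n)
    note t = Suc.prems(1) and g = Suc.prems(2)
    have [measurable]: "g \<in> borel_measurable borel" using g by (rule bounded_BorelD)
    have G0: "0 \<le> G" using g by (rule bounded_BorelD)
    define \<alpha> where "\<alpha> r = a r (\<lambda>y. W y * T (t - r) g y)" for r
    define \<beta> where "\<beta> r = b r (\<lambda>y. W y * T (t - r) g y)" for r
    have meas: "\<alpha> \<in> borel_measurable borel" "\<beta> \<in> borel_measurable borel"
    proof -
      interpret sigma_finite_measure "P x" ..
      show "\<alpha> \<in> borel_measurable borel"
        unfolding \<alpha>_def a_def by measurable
      have "(\<lambda>p. Q (fst p) (\<lambda>y. W y * T (t - fst p) g y) (snd p)) \<in> borel_measurable (borel \<Otimes>\<^sub>M borel)"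
        unfolding Q_def by (rule measurable_integral_kernel[where F = F]) measurable
      from measurable_compose[OF _ this, of "\<lambda>p. (fst p, Y s (snd p))" "borel \<Otimes>\<^sub>M P x"]
      have [measurable]: "(\<lambda>p. Q (fst p) (\<lambda>y. W y * T (t - fst p) g y) (Y s (snd p))) \<in> borel_measurable (borel \<Otimes>\<^sub>M P x)"
        by simp
      show "\<beta> \<in> borel_measurable borel"
        unfolding \<beta>_def b_def by (rule borel_measurable_lebesgue_integral) (simp add: case_prod_beta')
    qed
    have int: "set_integrable lborel {0..t} \<alpha>" "set_integrable lborel {0..t} \<beta>"
    proof -
      have "\<bar>\<alpha> r\<bar> \<le> B * (exp (K * t) * (K * G))" "\<bar>\<beta> r\<bar> \<le> B * (exp (K * t) * (K * G))" if "r \<in> {0..t}" for r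
        unfolding \<alpha>_def \<beta>_def
        using that order_trans[OF a_le[OF _ WT[OF g]] mult_left_mono[OF mono[OF that G0] B0]]
          order_trans[OF b_le[OF _ WT[OF g]] mult_left_mono[OF mono[OF that G0] B0]] by auto
      then show "set_integrable lborel {0..t} \<alpha>" "set_integrable lborel {0..t} \<beta>"
        using meas by (auto intro!: set_integrable_bounded[where K = "B * (exp (K * t) * (K * G))"])
    qed
    have exp_int: "set_integrable lborel {0..t} (\<lambda>r. K * exp (2 * K * r))"
      by (rule borel_integrable_atLeastAtMost'[unfolded set_integrable_def[symmetric]]) (intro continuous_intros)
    have "a t g - b t g = (LINT r:{0..t}|lborel. \<alpha> r - \<beta> r)"
      using a_eq[OF refl t g] b_eq[OF t g] int by (simp add: \<alpha>_def[symmetric] \<beta>_def[symmetric])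
    also have "\<bar>\<dots>\<bar> \<le> (LINT r:{0..t}|lborel. (2 * B / 2 ^ n * G) * (K * exp (2 * K * r)))"
    proof (rule abs_set_integral_mono)
      fix r assume r: "r \<in> {0..t}"
      have "\<bar>\<alpha> r - \<beta> r\<bar> \<le> (2 * B / 2 ^ n) * (exp (2 * K * r) * (K * G))"
        unfolding \<alpha>_def \<beta>_def using r by (intro Suc.IH WT g) auto
      then show "\<bar>\<alpha> r - \<beta> r\<bar> \<le> (2 * B / 2 ^ n * G) * (K * exp (2 * K * r))" by (simp add: mult_ac)
    qed (use int exp_int in auto)
    also have "\<dots> = (2 * B / 2 ^ n * G) * (LINT r:{0..t}|lborel. K * exp (2 * K * r))" by simp
    also have "\<dots> \<le> (2 * B / 2 ^ n * G) * (exp (2 * K * t) / 2)"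
      by (intro mult_left_mono set_integral_exp_le t) (use B0 G0 in auto)
    finally show ?case by (simp add: mult_ac)
  qed
  have "(\<lambda>n. 2 * B * (exp (2 * K * t) * G) * (1 / 2) ^ n) \<longlonglongrightarrow> 2 * B * (exp (2 * K * t) * G) * 0"
    by (intro tendsto_intros LIMSEQ_realpow_zero) auto
  then have "(\<lambda>n. 2 * B * (exp (2 * K * t) * G) * (1 / 2) ^ n) \<longlonglongrightarrow> 0" by simp
  then have "\<bar>a t g - b t g\<bar> \<le> 0"
  proof (rule LIMSEQ_le_const, intro exI allI impI)
    fix n
    show "\<bar>a t g - b t g\<bar> \<le> 2 * B * (exp (2 * K * t) * G) * (1 / 2) ^ n"
      using contract[OF t g, of n] by (simp add: power_one_over field_simps)
  qed
  then show ?thesis by (simp add: a_def b_def)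
qed

text \<open>
  Split the exponential at time \<open>s\<close> and take its first factor as the function of the past.
\<close>

corollary Q_semigroup:
  assumes s: "0 \<le> s" and t: "0 \<le> t" and g: "bounded_Borel G g"
  shows "Q (s + t) g x = Q s (Q t g) x"
proof -
  have "Q (s + t) g x = (\<integral>\<omega>. exp (Z 0 s \<omega>) * (exp (Z s t \<omega>) * g (Y (s + t) \<omega>)) \<partial>P x)"
    unfolding Q_def
    by (rule Bochner_Integration.integral_cong) (auto simp: space_P Z_add[OF s t] exp_add mult.assoc)
  also have "\<dots> = (\<integral>\<omega>. exp (Z 0 s \<omega>) * Q t g (Y s \<omega>) \<partial>P x)"
  proof (rule Feynman_Kac_Markov_property[OF s t _ _ g])
    show "(\<lambda>\<omega>. exp (Z 0 s \<omega>)) \<in> borel_measurable (\<FF> s)" using Z_adapted[of 0 s] s by simp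
    show "\<bar>exp (Z 0 s \<omega>)\<bar> \<le> exp (K * s)" if "\<omega> \<in> space F" for \<omega>
      using exp_Z_le[OF s that] by simp
  qed
  finally show ?thesis by (simp add: Q_def)
qed

end

section \<open>The Feynman-Kac semigroup on square-integrable functions\<close>

lemma L2_norm_mono:
  assumes "h \<in> L2 M" "g \<in> borel_measurable M" "\<And>x. \<bar>g x\<bar> \<le> h x"
  shows "L2_norm M g \<le> L2_norm M h"
proof -
  have "(\<integral>x. g x * g x \<partial>M) \<le> (\<integral>x. h x * h x \<partial>M)"
  proof (rule integral_mono')
    show "integrable M (\<lambda>x. h x * h x)" using assms(1) by (rule integrable_mult_L2) (rule assms(1))
    show "g x * g x \<le> h x * h x" for x
      using mult_mono'[OF assms(3)[of x] assms(3)[of x]] by simp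
  qed auto
  then show ?thesis by (simp add: ip_norm_def L2_inner_def)
qed

lemma (in prob_space) L2_norm_bounded:
  assumes "g \<in> borel_measurable M" "\<And>x. \<bar>g x\<bar> \<le> B"
  shows "L2_norm M g \<le> B"
proof -
  have "L2_norm M g \<le> L2_norm M (\<lambda>_. B)"
    using assms by (intro L2_norm_mono bounded_in_L2[of _ "\<bar>B\<bar>"]) auto
  also have "\<dots> = \<bar>B\<bar>" by (simp add: ip_norm_def L2_inner_def prob_space)
  also have "\<dots> = B" using assms(2)[of undefined] by simp
  finally show ?thesis .
qed

locale stationary_potential = bounded_potential F \<FF> X P W K + M: prob_space M
  for F :: "'w measure" and \<FF> :: "real \<Rightarrow> 'w measure"
    and X :: "real \<Rightarrow> 'w \<Rightarrow> 'a::polish_space" and P :: "'a \<Rightarrow> 'w measure"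
    and W :: "'a \<Rightarrow> real" and K :: real and M :: "'a measure" +
  assumes sets_M [measurable_cong]: "sets M = sets borel"
    and invariant: "invariant_measure X P M"
    and strongly_continuous: "strongly_continuous_L2 M (Markov_semigroup X P)"
begin

sublocale L2: L2_form M "L2_inner M"
  by unfold_locales (rule L2_inner_product_L2_inner)

lemma borel_measurable_M: "borel_measurable M = borel_measurable borel"
  by (rule measurable_cong_sets[OF sets_M refl])

lemma bounded_L2: "bounded_Borel G g \<Longrightarrow> g \<in> L2 M"
  by (rule M.bounded_in_L2[of _ G]) (auto simp: borel_measurable_M dest: bounded_BorelD)

lemma integrable_M: "bounded_Borel G g \<Longrightarrow> integrable M g"
  by (rule M.integrable_const_bound[of _ G]) (auto simp: borel_measurable_M dest: bounded_BorelD)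

lemma integral_T:
  assumes t: "0 \<le> t" and g: "bounded_Borel G g"
  shows "(\<integral>x. T t g x \<partial>M) = (\<integral>x. g x \<partial>M)"
proof -
  have [measurable]: "g \<in> borel_measurable borel" using g by (rule bounded_BorelD)
  have "M \<in> space (prob_algebra borel)"
    using M.prob_space_axioms sets_M by (simp add: space_prob_algebra)
  then have sets_bind [measurable_cong]: "sets (M \<bind> P) = sets F"
    using P_kernel by (rule sets_bind')
  have "(\<integral>x. g x \<partial>M) = (\<integral>x. g x \<partial>distr (M \<bind> P) borel (Y t))"
    using invariant t by (simp add: invariant_measure_def Y_def)
  also have "\<dots> = (\<integral>\<omega>. g (Y t \<omega>) \<partial>(M \<bind> P))"
    by (rule integral_distr) measurable
  also have "\<dots> = (\<integral>x. T t g x \<partial>M)"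
    unfolding T_def
    by (rule integral_bind_P[where B = G]) (use bounded_BorelD(2)[OF g] sets_M M.prob_space_axioms in auto)
  finally show ?thesis by simp
qed

text \<open>
  Jensen's inequality for each \<open>P\<^sup>x\<close>, followed by invariance of \<open>M\<close>.
\<close>

lemma T_contraction:
  assumes t: "0 \<le> t" and g: "bounded_Borel G g"
  shows "L2_norm M (T t g) \<le> L2_norm M g"
proof -
  have [measurable]: "g \<in> borel_measurable borel" using g by (rule bounded_BorelD)
  have g2: "bounded_Borel (G * G) (\<lambda>x. g x * g x)" using g g by (rule bounded_Borel_mult)
  have Jensen: "T t g x * T t g x \<le> T t (\<lambda>x. g x * g x) x" for x
  proof -
    interpret prob_space "P x" by (rule prob_space_P)
    have "(\<lambda>\<omega>. g (Y t \<omega>)) \<in> L2 (P x)"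
      by (rule bounded_in_L2[where K = G]) (use bounded_BorelD(2)[OF g] in auto)
    then have "\<bar>T t g x\<bar> \<le> sqrt (T t (\<lambda>x. g x * g x) x)"
      using abs_integral_le_L2_norm by (simp add: T_def ip_norm_def L2_inner_def)
    then have "(T t g x)\<^sup>2 \<le> (sqrt (T t (\<lambda>x. g x * g x) x))\<^sup>2"
      by (rule power2_le_iff_abs_le[THEN iffD2, rotated]) (simp add: T_def)
    then show ?thesis by (simp add: power2_eq_square T_def)
  qed
  have "(\<integral>x. T t g x * T t g x \<partial>M) \<le> (\<integral>x. T t (\<lambda>x. g x * g x) x \<partial>M)"
    by (intro integral_mono Jensen integrable_M[OF bounded_Borel_mult[OF T_bounded[OF g] T_bounded[OF g]]]
        integrable_M[OF T_bounded[OF g2]])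
  then show ?thesis
    by (simp add: ip_norm_def L2_inner_def integral_T[OF t g2])
qed

lemma Q_norm_le:
  assumes t: "0 \<le> t" and g: "bounded_Borel G g"
  shows "L2_norm M (Q t g) \<le> exp (K * t) * L2_norm M g"
proof -
  have [measurable]: "g \<in> borel_measurable borel" using g by (rule bounded_BorelD)
  have ag: "bounded_Borel G (\<lambda>x. \<bar>g x\<bar>)" using g by (simp add: bounded_Borel_def)
  have "\<bar>Q t g x\<bar> \<le> exp (K * t) * T t (\<lambda>x. \<bar>g x\<bar>) x" for x
  proof -
    have int: "integrable (P x) (\<lambda>\<omega>. exp (Z 0 t \<omega>) * g (Y t \<omega>))"
      by (rule integrable_P[where B = "1 * (exp (K * t) * G)"])
        (use abs_future_le[OF t g, of _ 1 1] in auto)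
    have "\<bar>Q t g x\<bar> \<le> (\<integral>\<omega>. \<bar>exp (Z 0 t \<omega>) * g (Y t \<omega>)\<bar> \<partial>P x)"
      unfolding Q_def by simp
    also have "\<dots> \<le> (\<integral>\<omega>. exp (K * t) * \<bar>g (Y t \<omega>)\<bar> \<partial>P x)"
    proof (rule integral_mono)
      show "integrable (P x) (\<lambda>\<omega>. exp (K * t) * \<bar>g (Y t \<omega>)\<bar>)"
        by (rule integrable_mult_right, rule integrable_P[where B = G]) (use bounded_BorelD(2)[OF g] in auto)
      show "\<bar>exp (Z 0 t \<omega>) * g (Y t \<omega>)\<bar> \<le> exp (K * t) * \<bar>g (Y t \<omega>)\<bar>" if "\<omega> \<in> space (P x)" for \<omega>
        using exp_Z_le[OF t, of \<omega> 0] that by (auto simp: abs_mult space_P intro!: mult_right_mono)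
    qed (use int in auto)
    finally show ?thesis by (simp add: T_def)
  qed
  then have "L2_norm M (Q t g) \<le> L2_norm M (\<lambda>x. exp (K * t) * T t (\<lambda>x. \<bar>g x\<bar>) x)"
    using bounded_BorelD(1)[OF Q_bounded[OF t g]]
    by (intro L2_norm_mono bounded_L2[OF bounded_Borel_scale[OF T_bounded[OF ag]]]) (auto simp: borel_measurable_M)
  also have "\<dots> = exp (K * t) * L2_norm M (T t (\<lambda>x. \<bar>g x\<bar>))"
    by (simp add: L2.ip_norm_scale[OF bounded_L2[OF T_bounded[OF ag]]])
  also have "\<dots> \<le> exp (K * t) * L2_norm M (\<lambda>x. \<bar>g x\<bar>)"
    by (intro mult_left_mono T_contraction[OF t ag]) auto
  finally show ?thesis by (simp add: ip_norm_def L2_inner_def)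
qed

lemma T_diff:
  assumes "bounded_Borel G g" "bounded_Borel H h"
  shows "T t (\<lambda>x. g x - h x) y = T t g y - T t h y"
proof -
  have [measurable]: "g \<in> borel_measurable borel" "h \<in> borel_measurable borel"
    using assms by (auto dest: bounded_BorelD)
  have "integrable (P y) (\<lambda>\<omega>. g (Y t \<omega>))"
    by (rule integrable_P[where B = G]) (use bounded_BorelD(2)[OF assms(1)] in auto)
  moreover have "integrable (P y) (\<lambda>\<omega>. h (Y t \<omega>))"
    by (rule integrable_P[where B = H]) (use bounded_BorelD(2)[OF assms(2)] in auto)
  ultimately
  show ?thesis unfolding T_def by simp
qed

lemma integrable_Q:
  assumes "0 \<le> t" "bounded_Borel G g"
  shows "integrable (P y) (\<lambda>\<omega>. exp (Z 0 t \<omega>) * g (Y t \<omega>))"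
proof (rule integrable_P[where B = "1 * (exp (K * t) * G)"])
  have [measurable]: "g \<in> borel_measurable borel" using assms(2) by (rule bounded_BorelD)
  show "(\<lambda>\<omega>. exp (Z 0 t \<omega>) * g (Y t \<omega>)) \<in> borel_measurable F" by measurable
qed (use abs_future_le[OF assms, of _ 1 1] in auto)

lemma Q_diff:
  assumes "0 \<le> t" "bounded_Borel G g" "bounded_Borel H h"
  shows "Q t (\<lambda>x. g x - h x) y = Q t g y - Q t h y"
  unfolding Q_def using integrable_Q[OF assms(1,2)] integrable_Q[OF assms(1,3)]
  by (simp add: right_diff_distrib)

lemma Q_scale: "Q t (\<lambda>x. a * g x) y = a * Q t g y"
  unfolding Q_def by (simp add: mult.left_commute[of _ a])

lemma Q_minus_T_le:
  assumes t: "0 \<le> t" and g: "bounded_Borel G g"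
  shows "\<bar>Q t g x - T t g x\<bar> \<le> exp (K * t) * (K * t) * G"
proof -
  have [measurable]: "g \<in> borel_measurable borel" using g by (rule bounded_BorelD)
  have "integrable (P x) (\<lambda>\<omega>. g (Y t \<omega>))"
    using bounded_BorelD(2)[OF g] by (auto intro!: integrable_P[where B = G])
  then have "Q t g x - T t g x = (\<integral>\<omega>. (exp (Z 0 t \<omega>) - 1) * g (Y t \<omega>) \<partial>P x)"
    unfolding Q_def T_def using integrable_Q[OF t g] by (simp add: left_diff_distrib)
  also have "\<bar>\<dots>\<bar> \<le> exp (K * t) * (K * t) * G"
  proof (rule abs_integral_P_le)
    show "\<bar>(exp (Z 0 t \<omega>) - 1) * g (Y t \<omega>)\<bar> \<le> exp (K * t) * (K * t) * G" if \<omega>: "\<omega> \<in> space F" for \<omega>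
    proof -
      have "\<bar>exp (Z 0 t \<omega>) - exp 0\<bar> \<le> exp (K * t) * \<bar>Z 0 t \<omega> - 0\<bar>"
        using abs_Z_le[OF t \<omega>, of 0] K_nonneg t by (intro exp_diff_le) auto
      also have "\<dots> \<le> exp (K * t) * (K * t)"
        using abs_Z_le[OF t \<omega>, of 0] by (intro mult_left_mono) auto
      finally show ?thesis
        using bounded_BorelD(2)[OF g] K_nonneg t by (auto simp: abs_mult intro!: mult_mono)
    qed
  qed measurable
  finally show ?thesis .
qed

lemma T_right_continuous_0:
  assumes g: "bounded_Borel G g" and e: "0 < e"
  shows "\<exists>d>0. \<forall>r. 0 \<le> r \<longrightarrow> r < d \<longrightarrow> L2_norm M (\<lambda>x. T r g x - g x) \<le> e"
proof -
  have "((\<lambda>t. L2_norm M (\<lambda>x. Markov_semigroup X P t g x - g x)) \<longlongrightarrow> 0) (at_right 0)"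
    using strongly_continuous bounded_L2[OF g] by (simp add: strongly_continuous_L2_def)
  then have "\<forall>\<^sub>F t in at_right 0. dist (L2_norm M (\<lambda>x. Markov_semigroup X P t g x - g x)) 0 < e"
    using e by (rule tendstoD)
  then obtain d where d: "0 < d"
    and *: "\<And>r. 0 < r \<Longrightarrow> r < d \<Longrightarrow> \<bar>L2_norm M (\<lambda>x. Markov_semigroup X P r g x - g x)\<bar> < e"
    unfolding eventually_at_right_field by auto
  have "L2_norm M (\<lambda>x. T r g x - g x) \<le> e" if r: "0 \<le> r" "r < d" for r
  proof (cases "r = 0")
    case True
    then show ?thesis
      using e T_0[OF bounded_BorelD(1)[OF g]] by (simp add: T_def ip_norm_def L2_inner_def)
  next
    case False
    then show ?thesis using *[of r] r T_eq_Markov_semigroup[of r g] by simp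
  qed
  then show ?thesis using d by blast
qed

text \<open>
  Minkowski's integral inequality, by duality: the square of the norm of the integral \<open>A\<close> is the time
  integral of its inner products with \<open>J r\<close>, and each of these is at most \<open>L2_norm M A * e\<close>.
\<close>

lemma L2_norm_time_integral_le:
  assumes J: "(\<lambda>p. J (fst p) (snd p)) \<in> borel_measurable (borel \<Otimes>\<^sub>M borel)"
    and h: "0 \<le> h" and B: "\<And>r x. r \<in> {0..h} \<Longrightarrow> \<bar>J r x\<bar> \<le> B"
    and e: "\<And>r. r \<in> {0..h} \<Longrightarrow> L2_norm M (J r) \<le> e"
  shows "L2_norm M (\<lambda>x. LINT r:{0..h}|lborel. J r x) \<le> h * e"
proof -
  note [measurable] = J
  define A where "A x = (LINT r:{0..h}|lborel. J r x)" for x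
  have "(\<lambda>p. J (snd p) (fst p)) \<in> borel_measurable (borel \<Otimes>\<^sub>M borel)"
    using measurable_compose[OF measurable_pair_swap' J] by (simp add: case_prod_beta')
  then have [measurable]: "A \<in> borel_measurable borel"
    unfolding A_def by (rule measurable_set_integral_Icc) simp
  have Jr: "J r \<in> borel_measurable borel" for r
    using measurable_compose[OF measurable_Pair1' J, of r] by simp
  have Jx: "(\<lambda>r. J r x) \<in> borel_measurable borel" for x
    using measurable_compose[OF measurable_Pair2' J, of x] by simp
  have A_le: "\<bar>A x\<bar> \<le> B * h" for x
    unfolding A_def using abs_set_integral_bounded[OF Jx h B, of x] by simp
  have A: "bounded_Borel (B * h) A" using A_le by (simp add: bounded_Borel_def)
  have JL2: "J r \<in> L2 M" if "r \<in> {0..h}" for r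
    by (rule bounded_L2[of B]) (use B[OF that] Jr in \<open>simp add: bounded_Borel_def\<close>)
  \<comment> \<open>Test the integral against itself.\<close>
  have "(L2_norm M A)\<^sup>2 = (\<integral>x. (LINT r:{0..h}|lborel. A x * J r x) \<partial>M)"
    by (simp add: L2.ip_norm_power2[OF bounded_L2[OF A]] L2_inner_def A_def)
  also have "\<dots> = (LINT r:{0..h}|lborel. \<integral>x. A x * J r x \<partial>M)"
  proof (rule M.integral_set_integral_swap[where B = "B * h * B"])
    show "\<bar>A x * J r x\<bar> \<le> B * h * B" if "r \<in> {0..h}" for r x
      using A_le[of x] B[OF that, of x] unfolding abs_mult by (intro mult_mono) auto
  qed measurable
  also have "\<dots> \<le> (LINT r:{0..h}|lborel. L2_norm M A * e)"
  proof -
    have le: "\<bar>\<integral>x. A x * J r x \<partial>M\<bar> \<le> L2_norm M A * e" if "r \<in> {0..h}" for r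
      using L2.Cauchy_Schwarz[OF bounded_L2[OF A] JL2[OF that]] e[OF that] L2.ip_norm_nonneg[OF bounded_L2[OF A]]
      unfolding L2_inner_def[symmetric] by (auto intro: order_trans mult_left_mono)
    have [measurable]: "(\<lambda>r. \<integral>x. A x * J r x \<partial>M) \<in> borel_measurable borel"
      by (rule M.borel_measurable_lebesgue_integral) (simp add: case_prod_beta')
    have "\<bar>LINT r:{0..h}|lborel. \<integral>x. A x * J r x \<partial>M\<bar> \<le> (LINT r:{0..h}|lborel. L2_norm M A * e)"
      by (intro abs_set_integral_mono set_integrable_bounded[where K = "\<bar>L2_norm M A * e\<bar>"])
        (use le in \<open>auto intro: order_trans[OF le abs_ge_self]\<close>)
    then show ?thesis by linarith
  qed
  also have "\<dots> = L2_norm M A * (h * e)" using h by (simp add: set_integral_const_Icc)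
  finally have "L2_norm M A * L2_norm M A \<le> L2_norm M A * (h * e)" by (simp add: power2_eq_square)
  moreover have "0 \<le> h * e"
    using h e[of 0] L2.ip_norm_nonneg[OF JL2[of 0]] by simp
  moreover have "0 \<le> L2_norm M A" by (rule L2.ip_norm_nonneg[OF bounded_L2[OF A]])
  ultimately have "L2_norm M A \<le> h * e"
    by (cases "L2_norm M A = 0") auto
  then show ?thesis by (simp add: A_def[abs_def])
qed

text \<open>
  The two semigroups differ to first order by the potential. By Duhamel's formula the difference quotient is
  the average over \<open>0 \<le> r \<le> h\<close> of \<open>Q r (W (T (h - r) g))\<close>, and strong continuity takes each of these terms to \<open>W g\<close>
  uniformly in \<open>r\<close>.
\<close>

theorem Q_minus_T_derivative:
  assumes g: "bounded_Borel G g"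
  shows "((\<lambda>h. L2_norm M (\<lambda>x. (Q h g x - T h g x) / h - W x * g x)) \<longlongrightarrow> 0) (at_right 0)"
proof (rule tendstoI)
  fix e :: real assume e: "0 < e"
  have [measurable]: "g \<in> borel_measurable borel" using g by (rule bounded_BorelD)
  have G0: "0 \<le> G" using g by (rule bounded_BorelD)
  have Wg: "bounded_Borel (K * G) (\<lambda>x. W x * g x)" by (rule bounded_Borel_mult[OF W g])
  define m where "m = K + 2"
  have m: "0 < m" using K_nonneg by (simp add: m_def)
  define e' where "e' = e / 2 / m"
  have "0 < e'" "m * e' = e / 2" using e m by (simp_all add: e'_def)
  then have e': "0 < e'" "K * e' + e' + e' = e / 2" by (simp_all add: m_def distrib_right)
  obtain d1 where d1: "0 < d1" "\<And>r. 0 \<le> r \<Longrightarrow> r < d1 \<Longrightarrow> L2_norm M (\<lambda>x. T r g x - g x) \<le> e'"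
    using T_right_continuous_0[OF g e'(1)] by auto
  obtain d2 where d2: "0 < d2" "\<And>r. 0 \<le> r \<Longrightarrow> r < d2 \<Longrightarrow> L2_norm M (\<lambda>x. T r (\<lambda>x. W x * g x) x - W x * g x) \<le> e'"
    using T_right_continuous_0[OF Wg e'(1)] by auto
  have "((\<lambda>r. exp (K * r) * (K * r) * (K * G)) \<longlongrightarrow> exp (K * 0) * (K * 0) * (K * G)) (at_right 0)"
    by (intro tendsto_intros)
  then have "\<forall>\<^sub>F r in at_right 0. exp (K * r) * (K * r) * (K * G) < e'"
    using e' by (intro order_tendstoD) auto
  then obtain d3 where d3: "0 < d3" "\<And>r. 0 < r \<Longrightarrow> r < d3 \<Longrightarrow> exp (K * r) * (K * r) * (K * G) < e'"
    unfolding eventually_at_right_field by auto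
  define d where "d = min d1 (min d2 d3)"
  have "L2_norm M (\<lambda>x. (Q h g x - T h g x) / h - W x * g x) < e" if h: "0 < h" "h < d" for h
  proof -
    define J where "J r x = Q r (\<lambda>y. W y * T (h - r) g y) x - W x * g x" for r x
    have WT: "bounded_Borel (K * G) (\<lambda>y. W y * T u g y)" for u
      by (intro bounded_Borel_mult W T_bounded g)
    have [measurable]: "(\<lambda>p. Q (fst p) (\<lambda>y. W y * T (h - fst p) g y) (snd p)) \<in> borel_measurable (borel \<Otimes>\<^sub>M borel)"
      unfolding Q_def by (rule measurable_integral_kernel[where F = F]) measurable
    have J_meas: "(\<lambda>p. J (fst p) (snd p)) \<in> borel_measurable (borel \<Otimes>\<^sub>M borel)"
      unfolding J_def by measurable
    have JB: "bounded_Borel (exp (K * r) * (K * G) + K * G) (J r)" if "r \<in> {0..h}" for r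
      unfolding J_def using that by (intro bounded_Borel_diff Q_bounded WT Wg) auto
    have J_le: "\<bar>J r x\<bar> \<le> exp (K * h) * (K * G) + K * G" if "r \<in> {0..h}" for r x
    proof -
      have "exp (K * r) * (K * G) \<le> exp (K * h) * (K * G)"
        using that K_nonneg G0 by (intro mult_right_mono) (auto intro!: mult_left_mono)
      then show ?thesis using bounded_BorelD(2)[OF JB[OF that], of x] by linarith
    qed
    have J_norm: "L2_norm M (J r) \<le> e / 2" if r: "r \<in> {0..h}" for r
    proof -
      let ?k = "\<lambda>y. W y * T (h - r) g y"
      have r0: "0 \<le> r" "0 \<le> h - r" using r by auto
      have j1: "bounded_Borel (exp (K * r) * (K * G) + K * G) (\<lambda>x. Q r ?k x - T r ?k x)"
        by (intro bounded_Borel_diff Q_bounded T_bounded WT r0)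
      have dk: "bounded_Borel (K * (G + G)) (\<lambda>y. W y * (T (h - r) g y - g y))"
        by (intro bounded_Borel_mult W bounded_Borel_diff T_bounded g)
      have j2: "bounded_Borel (K * (G + G)) (T r (\<lambda>y. W y * (T (h - r) g y - g y)))"
        by (rule T_bounded[OF dk])
      have j3: "bounded_Borel (K * G + K * G) (\<lambda>x. T r (\<lambda>x. W x * g x) x - W x * g x)"
        by (intro bounded_Borel_diff T_bounded Wg)
      \<comment> \<open>Replace \<open>Q r\<close> by \<open>T r\<close>, then \<open>T (h - r) g\<close> by \<open>g\<close>, then \<open>T r\<close> by the identity.\<close>
      have split: "J r = (\<lambda>x. (Q r ?k x - T r ?k x)
          + (T r (\<lambda>y. W y * (T (h - r) g y - g y)) x + (T r (\<lambda>x. W x * g x) x - W x * g x)))"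
        unfolding J_def right_diff_distrib T_diff[OF WT Wg] by auto
      have "L2_norm M (\<lambda>x. Q r ?k x - T r ?k x) \<le> e'"
      proof (rule M.L2_norm_bounded)
        show "(\<lambda>x. Q r ?k x - T r ?k x) \<in> borel_measurable M"
          using bounded_BorelD(1)[OF j1] by (simp add: borel_measurable_M)
        show "\<bar>Q r ?k x - T r ?k x\<bar> \<le> e'" for x
          using Q_minus_T_le[OF r0(1) WT[of "h - r"], of x] d3(2)[of r] r h e'(1)
          by (cases "r = 0") (auto simp: d_def intro: order_trans)
      qed
      moreover have "L2_norm M (T r (\<lambda>y. W y * (T (h - r) g y - g y))) \<le> K * e'"
      proof -
        have Tg: "bounded_Borel (G + G) (\<lambda>y. T (h - r) g y - g y)"
          by (intro bounded_Borel_diff T_bounded g)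
        have "L2_norm M (T r (\<lambda>y. W y * (T (h - r) g y - g y))) \<le> L2_norm M (\<lambda>y. W y * (T (h - r) g y - g y))"
          by (rule T_contraction[OF r0(1) dk])
        also have "\<dots> \<le> L2_norm M (\<lambda>y. K * \<bar>T (h - r) g y - g y\<bar>)"
        proof (rule L2_norm_mono)
          show "(\<lambda>y. K * \<bar>T (h - r) g y - g y\<bar>) \<in> L2 M"
            by (rule bounded_L2[of "\<bar>K\<bar> * (G + G)"], rule bounded_Borel_scale)
              (use Tg in \<open>simp add: bounded_Borel_def\<close>)
          show "(\<lambda>y. W y * (T (h - r) g y - g y)) \<in> borel_measurable M"
            using bounded_BorelD(1)[OF dk] by (simp add: borel_measurable_M)
        qed (auto simp: abs_mult intro!: mult_right_mono W_le)
        also have "\<dots> = K * L2_norm M (\<lambda>y. T (h - r) g y - g y)"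
        proof -
          have "(\<lambda>y. \<bar>T (h - r) g y - g y\<bar>) \<in> L2 M"
            by (rule bounded_L2[of "G + G"]) (use Tg in \<open>simp add: bounded_Borel_def\<close>)
          from L2.ip_norm_scale[OF this, of K] show ?thesis
            using K_nonneg by (simp add: ip_norm_def L2_inner_def)
        qed
        also have "\<dots> \<le> K * e'"
          using d1(2)[OF r0(2)] r h K_nonneg by (intro mult_left_mono) (auto simp: d_def)
        finally show ?thesis .
      qed
      moreover have "L2_norm M (\<lambda>x. T r (\<lambda>x. W x * g x) x - W x * g x) \<le> e'"
        using d2(2)[OF r0(1)] r h by (auto simp: d_def)
      ultimately show ?thesis
        unfolding split
        using L2.ip_norm_triangle[OF bounded_L2[OF j1] L2_add[OF bounded_L2[OF j2] bounded_L2[OF j3]]]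
          L2.ip_norm_triangle[OF bounded_L2[OF j2] bounded_L2[OF j3]] e'(2) by linarith
    qed
    have "(LINT r:{0..h}|lborel. J r x) = Q h g x - T h g x - h * (W x * g x)" for x
    proof -
      have "set_integrable lborel {0..h} (\<lambda>r. Q r (\<lambda>y. W y * T (h - r) g y) x)"
      proof (rule set_integrable_bounded)
        have "(\<lambda>r. (r, x)) \<in> borel \<rightarrow>\<^sub>M borel \<Otimes>\<^sub>M borel" by measurable
        from measurable_compose[OF this \<open>(\<lambda>p. Q (fst p) (\<lambda>y. W y * T (h - fst p) g y) (snd p)) \<in> _\<close>]
        show "(\<lambda>r. Q r (\<lambda>y. W y * T (h - r) g y) x) \<in> borel_measurable borel" by simp
        show "\<bar>Q r (\<lambda>y. W y * T (h - r) g y) x\<bar> \<le> (exp (K * h) * (K * G) + K * G) + K * G" if "r \<in> {0..h}" for r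
          using J_le[OF that, of x] bounded_BorelD(2)[OF Wg, of x] unfolding J_def by linarith
      qed
      moreover have "set_integrable lborel {0..h} (\<lambda>r. W x * g x)"
        by (rule set_integrable_bounded) auto
      ultimately show ?thesis
        unfolding J_def using Duhamel_Q[OF _ g, of h x] h by (simp add: set_integral_const_Icc mult.commute)
    qed
    then have eq: "(\<lambda>x. (Q h g x - T h g x) / h - W x * g x) = (\<lambda>x. (1 / h) * (LINT r:{0..h}|lborel. J r x))"
      using h by (auto simp: fun_eq_iff field_simps)
    have int: "(\<lambda>x. LINT r:{0..h}|lborel. J r x) \<in> L2 M"
    proof -
      have "bounded_Borel (exp (K * h) * G + G + \<bar>h\<bar> * (K * G)) (\<lambda>x. Q h g x - T h g x - h * (W x * g x))"
        using h by (intro bounded_Borel_diff Q_bounded T_bounded bounded_Borel_scale Wg g) auto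
      then show ?thesis
        unfolding \<open>\<And>x. (LINT r:{0..h}|lborel. J r x) = Q h g x - T h g x - h * (W x * g x)\<close>
        by (rule bounded_L2)
    qed
    have "L2_norm M (\<lambda>x. (Q h g x - T h g x) / h - W x * g x) = (1 / h) * L2_norm M (\<lambda>x. LINT r:{0..h}|lborel. J r x)"
      unfolding eq using L2.ip_norm_scale[OF int, of "1 / h"] h by simp
    also have "\<dots> \<le> (1 / h) * (h * (e / 2))"
      using h by (intro mult_left_mono L2_norm_time_integral_le[OF J_meas _ J_le J_norm]) auto
    also have "\<dots> < e" using h e by simp
    finally show ?thesis .
  qed
  moreover have "0 \<le> L2_norm M (\<lambda>x. (Q h g x - T h g x) / h - W x * g x)" for h
    by (simp add: ip_norm_def L2_inner_def)
  ultimately show "\<forall>\<^sub>F h in at_right 0. dist (L2_norm M (\<lambda>x. (Q h g x - T h g x) / h - W x * g x)) 0 < e"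
    unfolding eventually_at_right_field using d1 d2 d3 by (intro exI[of _ d]) (auto simp: d_def)
qed

text \<open>
  The exponential moment \<open>u t x = E\<^sup>x exp (\<integral>\<^sub>0\<^sup>t W (X s) ds)\<close>.
\<close>

definition u :: "real \<Rightarrow> 'a \<Rightarrow> real" where
  "u t = Q t (\<lambda>_. 1)"

lemma one_bounded: "bounded_Borel 1 (\<lambda>_::'a. 1)"
  by (simp add: bounded_Borel_def)

lemma u_bounded: "0 \<le> t \<Longrightarrow> bounded_Borel (exp (K * t)) (u t)"
  unfolding u_def using Q_bounded[OF _ one_bounded] by simp

lemma T_one: "T t (\<lambda>_. 1) = (\<lambda>_. 1)"
  using prob_space.prob_space[OF prob_space_P] by (simp add: fun_eq_iff T_def)

lemma u_0: "u 0 = (\<lambda>_. 1)"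
  using prob_space.prob_space[OF prob_space_P] by (simp add: fun_eq_iff u_def Q_def Z_def)

lemma QW_bounded: "0 \<le> t \<Longrightarrow> bounded_Borel (exp (K * t) * K) (Q t W)"
  by (rule Q_bounded[OF _ W])

text \<open>
  \<open>Q t\<close> is bounded on \<open>L\<^sup>2\<close>, so it may be applied to the limit of \<open>(Q h 1 - T h 1) / h\<close>, which is \<open>W\<close>.
\<close>

lemma u_right_derivative:
  assumes t: "0 \<le> t"
  shows "((\<lambda>h. L2_norm M (\<lambda>x. (u (t + h) x - u t x) / h - Q t W x)) \<longlongrightarrow> 0) (at_right 0)"
proof (rule tendsto_sandwich[OF _ _ tendsto_const])
  let ?r = "\<lambda>h x. (Q h (\<lambda>_. 1) x - T h (\<lambda>_. 1) x) / h - W x * 1"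
  show "((\<lambda>h. exp (K * t) * L2_norm M (?r h)) \<longlongrightarrow> 0) (at_right 0)"
    by (rule tendsto_mult_right_zero[OF Q_minus_T_derivative[OF one_bounded]])
  show "\<forall>\<^sub>F h in at_right 0. 0 \<le> L2_norm M (\<lambda>x. (u (t + h) x - u t x) / h - Q t W x)"
    by (simp add: ip_norm_def L2_inner_def)
  show "\<forall>\<^sub>F h in at_right 0. L2_norm M (\<lambda>x. (u (t + h) x - u t x) / h - Q t W x) \<le> exp (K * t) * L2_norm M (?r h)"
    unfolding eventually_at_right_field
  proof (intro exI[of _ 1] conjI allI impI)
    fix h :: real assume h: "0 < h"
    then have h0: "0 \<le> h" by simp
    have b1: "bounded_Borel (exp (K * h) * 1 + 1) (\<lambda>x. Q h (\<lambda>_. 1) x - 1)"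
      by (intro bounded_Borel_diff Q_bounded one_bounded h0)
    have b2: "bounded_Borel (\<bar>1 / h\<bar> * (exp (K * h) * 1 + 1)) (\<lambda>x. (1 / h) * (Q h (\<lambda>_. 1) x - 1))"
      by (rule bounded_Borel_scale[OF b1])
    have r_eq: "?r h = (\<lambda>x. (1 / h) * (Q h (\<lambda>_. 1) x - 1) - W x)"
      by (simp add: T_one)
    have "(\<lambda>x. (u (t + h) x - u t x) / h - Q t W x) = Q t (?r h)"
      unfolding r_eq Q_diff[OF t b2 W] Q_scale Q_diff[OF t Q_bounded[OF h0 one_bounded] one_bounded]
      using Q_semigroup[OF t h0 one_bounded] by (auto simp: u_def)
    then show "L2_norm M (\<lambda>x. (u (t + h) x - u t x) / h - Q t W x) \<le> exp (K * t) * L2_norm M (?r h)"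
      using Q_norm_le[OF t bounded_Borel_diff[OF b2 W]] unfolding r_eq by simp
  qed simp
qed

text \<open>
  Since \<open>Q h (u t) = u (t + h)\<close>, the difference quotient of \<open>T h (u t)\<close> is that of \<open>u\<close> in time minus
  that of \<open>Q h - T h\<close> at \<open>u t\<close>, and both have limits.
\<close>

theorem u_in_generator_domain:
  assumes t: "0 \<le> t"
  shows "is_generator_value M (Markov_semigroup X P) (u t) (\<lambda>x. Q t W x - W x * u t x)"
  unfolding is_generator_value_def
proof
  note ub = u_bounded[OF t]
  show "(\<lambda>x. Q t W x - W x * u t x) \<in> L2 M"
    by (rule bounded_L2[OF bounded_Borel_diff[OF QW_bounded[OF t] bounded_Borel_mult[OF W ub]]])
  let ?a = "\<lambda>h x. (u (t + h) x - u t x) / h - Q t W x"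
  let ?b = "\<lambda>h x. (Q h (u t) x - T h (u t) x) / h - W x * u t x"
  show "((\<lambda>h. L2_norm M (\<lambda>x. (Markov_semigroup X P h (u t) x - u t x) / h - (Q t W x - W x * u t x))) \<longlongrightarrow> 0) (at_right 0)"
  proof (rule tendsto_sandwich[OF _ _ tendsto_const])
    show "((\<lambda>h. L2_norm M (?a h) + L2_norm M (?b h)) \<longlongrightarrow> 0) (at_right 0)"
      using tendsto_add[OF u_right_derivative[OF t] Q_minus_T_derivative[OF ub]] by simp
    show "\<forall>\<^sub>F h in at_right 0. 0 \<le> L2_norm M (\<lambda>x. (Markov_semigroup X P h (u t) x - u t x) / h - (Q t W x - W x * u t x))"
      by (simp add: ip_norm_def L2_inner_def)
    show "\<forall>\<^sub>F h in at_right 0. L2_norm M (\<lambda>x. (Markov_semigroup X P h (u t) x - u t x) / h - (Q t W x - W x * u t x))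
        \<le> L2_norm M (?a h) + L2_norm M (?b h)"
      unfolding eventually_at_right_field
    proof (intro exI[of _ 1] conjI allI impI)
      fix h :: real assume h: "0 < h"
      then have h0: "0 \<le> h" by simp
      have th: "0 \<le> t + h" using t h by simp
      have a: "?a h \<in> L2 M"
        by (intro L2_diff L2_divide bounded_L2[OF u_bounded[OF th]] bounded_L2[OF ub] bounded_L2[OF QW_bounded[OF t]])
      have b: "?b h \<in> L2 M"
        by (intro L2_diff L2_divide bounded_L2[OF Q_bounded[OF h0 ub]] bounded_L2[OF T_bounded[OF ub]]
            bounded_L2[OF bounded_Borel_mult[OF W ub]])
      have "Q h (u t) x = u (t + h) x" for x
        using Q_semigroup[OF h0 t one_bounded, of x] by (simp add: u_def add.commute)
      then have "(\<lambda>x. (Markov_semigroup X P h (u t) x - u t x) / h - (Q t W x - W x * u t x))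
          = (\<lambda>x. ?a h x + (-1) * ?b h x)"
        unfolding T_eq_Markov_semigroup[OF h0] by (simp add: fun_eq_iff diff_divide_distrib)
      then show "L2_norm M (\<lambda>x. (Markov_semigroup X P h (u t) x - u t x) / h - (Q t W x - W x * u t x))
          \<le> L2_norm M (?a h) + L2_norm M (?b h)"
        using L2.ip_norm_triangle[OF a L2_scale[OF b, of "-1"]] L2.ip_norm_scale[OF b, of "-1"] by simp
    qed simp
  qed
qed

lemma u_Lipschitz:
  assumes s: "0 \<le> s" and h: "0 \<le> h"
  shows "\<bar>u (s + h) x - u s x\<bar> \<le> exp (K * s) * (exp (K * h) * (K * h))"
proof -
  have b: "bounded_Borel (exp (K * h) * (K * h)) (\<lambda>x. Q h (\<lambda>_. 1) x - 1)"
    using Q_minus_T_le[OF h one_bounded] bounded_BorelD(1)[OF Q_bounded[OF h one_bounded]]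
    by (simp add: bounded_Borel_def T_one)
  have "u (s + h) x - u s x = Q s (\<lambda>x. Q h (\<lambda>_. 1) x - 1) x"
    unfolding Q_diff[OF s Q_bounded[OF h one_bounded] one_bounded] u_def
    by (simp add: Q_semigroup[OF s h one_bounded])
  then show ?thesis using bounded_BorelD(2)[OF Q_bounded[OF s b], of x] by simp
qed

end

section \<open>Growth bound from the Poincare inequality\<close>

text \<open>
  The solution \<open>u\<close> of the Feynman-Kac equation is differentiated from the right. Up to any positive slope \<open>e\<close>, the
  last time at which \<open>\<psi> t \<le> \<psi> 0 + e * t\<close> cannot be before \<open>T\<close>, because the right derivative there would push the
  inequality further.
\<close>

lemma nonincreasing_of_right_derivative:
  fixes \<psi> :: "real \<Rightarrow> real"
  assumes cont: "continuous_on {0..T} \<psi>" and T: "0 \<le> T"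
    and deriv: "\<And>t. 0 \<le> t \<Longrightarrow> t < T \<Longrightarrow> \<exists>D\<le>0. (\<psi> has_real_derivative D) (at_right t)"
  shows "\<psi> T \<le> \<psi> 0"
proof (rule field_le_epsilon)
  fix e0 :: real assume e0: "0 < e0"
  define e where "e = e0 / (T + 1)"
  have e: "0 < e" "e * T \<le> e0" using e0 T by (auto simp: e_def field_simps)
  define S where "S = {t \<in> {0..T}. \<psi> t - e * t \<in> {..\<psi> 0}}"
  have "closed S"
  proof -
    have "continuous_on {0..T} (\<lambda>t. \<psi> t - e * t)" by (intro continuous_intros cont)
    from continuous_closed_preimage[OF this, of "{..\<psi> 0}"] show ?thesis
      by (simp add: S_def vimage_def Int_def)
  qed
  moreover have ne: "S \<noteq> {}" using T by (auto simp: S_def intro!: exI[of _ 0])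
  moreover have bdd: "bdd_above S" by (auto simp: S_def intro!: bdd_aboveI[of _ T])
  ultimately have sS: "Sup S \<in> S" by (intro closed_contains_Sup)
  define s where "s = Sup S"
  have s: "0 \<le> s" "s \<le> T" "\<psi> s - e * s \<le> \<psi> 0" using sS by (auto simp: S_def s_def)
  have "s = T"
  proof (rule ccontr)
    assume "s \<noteq> T"
    then have sT: "s < T" using s by simp
    obtain D where D: "D \<le> 0" "(\<psi> has_real_derivative D) (at_right s)" using deriv[OF s(1) sT] by auto
    then have "((\<lambda>y. (\<psi> y - \<psi> s) / (y - s)) \<longlongrightarrow> D) (at_right s)"
      by (simp add: has_field_derivative_iff)
    then have "\<forall>\<^sub>F y in at_right s. (\<psi> y - \<psi> s) / (y - s) < e"
      by (rule order_tendstoD) (use D e in auto)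
    then obtain b where b: "s < b" "\<And>y. s < y \<Longrightarrow> y < b \<Longrightarrow> (\<psi> y - \<psi> s) / (y - s) < e"
      unfolding eventually_at_right_field by auto
    obtain y where y: "s < y" "y < b" "y < T" using dense[of s "min b T"] b sT by auto
    have "\<psi> y - \<psi> s < e * (y - s)" using b(2)[OF y(1,2)] y(1) by (simp add: divide_less_eq)
    then have "y \<in> S" using s y by (auto simp: S_def algebra_simps)
    then have "y \<le> s" unfolding s_def by (intro cSup_upper bdd)
    then show False using y by simp
  qed
  then show "\<psi> T \<le> \<psi> 0 + e0" using s e by simp
qed

lemma Gronwall_right_derivative:
  fixes \<phi> D :: "real \<Rightarrow> real"
  assumes cont: "continuous_on {0..T} \<phi>" and T: "0 \<le> T"
    and deriv: "\<And>t. 0 \<le> t \<Longrightarrow> t < T \<Longrightarrow> (\<phi> has_real_derivative D t) (at_right t)"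
    and le: "\<And>t. 0 \<le> t \<Longrightarrow> t < T \<Longrightarrow> D t \<le> L * \<phi> t"
  shows "\<phi> T \<le> exp (L * T) * \<phi> 0"
proof -
  have "exp (- L * T) * \<phi> T \<le> exp (- L * 0) * \<phi> 0"
  proof (rule nonincreasing_of_right_derivative[OF _ T])
    show "continuous_on {0..T} (\<lambda>t. exp (- L * t) * \<phi> t)" by (intro continuous_intros cont)
    fix t assume t: "0 \<le> t" "t < T"
    have "((\<lambda>t. exp (- L * t) * \<phi> t) has_real_derivative exp (- L * t) * (D t - L * \<phi> t)) (at_right t)"
      by (rule derivative_eq_intros deriv[OF t] refl | simp)+ (simp add: algebra_simps)
    moreover have "exp (- L * t) * (D t - L * \<phi> t) \<le> 0"
      using le[OF t] by (simp add: mult_le_0_iff)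
    ultimately show "\<exists>D\<le>0. ((\<lambda>t. exp (- L * t) * \<phi> t) has_real_derivative D) (at_right t)" by blast
  qed
  then show ?thesis by (simp add: exp_minus field_simps)
qed

context equivalent_L2_form
begin

lemma ip_norm_le_bounded:
  assumes "g \<in> borel_measurable M" "\<And>x. \<bar>g x\<bar> \<le> B"
  shows "ip_norm ip g \<le> \<bar>C\<bar> * B"
proof -
  have g: "g \<in> L2 M" using assms by (rule bounded_in_L2)
  have "ip_norm ip g \<le> \<bar>C\<bar> * L2_norm M g"
    using norm_upper[OF g] mult_right_mono[OF abs_ge_self[of C] L2.ip_norm_nonneg[OF g]] by linarith
  also have "\<dots> \<le> \<bar>C\<bar> * B"
    using assms by (intro mult_left_mono L2_norm_bounded) auto
  finally show ?thesis .
qed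

lemma ip_norm_tendsto_0:
  assumes "((\<lambda>h. L2_norm M (r h)) \<longlongrightarrow> 0) A" "\<forall>\<^sub>F h in A. r h \<in> L2 M"
  shows "((\<lambda>h. ip_norm ip (r h)) \<longlongrightarrow> 0) A"
proof (rule tendsto_sandwich[OF _ _ tendsto_const])
  show "\<forall>\<^sub>F h in A. 0 \<le> ip_norm ip (r h)"
    using assms(2) by eventually_elim (rule ip_norm_nonneg)
  show "\<forall>\<^sub>F h in A. ip_norm ip (r h) \<le> C * L2_norm M (r h)"
    using assms(2) by eventually_elim (rule norm_upper)
  show "((\<lambda>h. C * L2_norm M (r h)) \<longlongrightarrow> 0) A"
    by (rule tendsto_mult_right_zero[OF assms(1)])
qed

text \<open>
  The adjoint is a choice among elements with a certain property; the Riesz representation of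
  \<open>g \<mapsto> L2_inner M g V\<close> shows that there is one.
\<close>

lemma adjoint_mult_op_one:
  assumes one: "\<And>g. g \<in> L2 M \<Longrightarrow> ip g (\<lambda>_. 1) = L2_inner M g (\<lambda>_. 1)"
    and V: "V \<in> borel_measurable M" "\<And>x. \<bar>V x\<bar> \<le> B"
  defines "w \<equiv> L2_adjoint M ip (mult_op V) (\<lambda>_. 1)"
  shows "w \<in> L2 M" "\<And>g. g \<in> L2 M \<Longrightarrow> ip (\<lambda>x. V x * g x) (\<lambda>_. 1) = ip g w"
proof -
  obtain w' where w': "w' \<in> L2 M" "\<And>g. g \<in> L2 M \<Longrightarrow> ip g w' = L2_inner M g V"
    using Riesz_representation[OF bounded_in_L2[OF V]] by auto
  have "ip (mult_op V g) (\<lambda>_. 1) = ip g w'" if g: "g \<in> L2 M" for g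
    using one[OF L2_bounded_mult[OF g V]] w'(2)[OF g] by (simp add: mult_op_def L2_inner_def mult.commute)
  then have "w' \<in> L2 M \<and> (\<forall>g\<in>L2 M. ip (mult_op V g) (\<lambda>_. 1) = ip g w')"
    using w'(1) by blast
  then have "w \<in> L2 M \<and> (\<forall>g\<in>L2 M. ip (mult_op V g) (\<lambda>_. 1) = ip g w)"
    unfolding w_def L2_adjoint_def
    by (rule someI[where P = "\<lambda>w. w \<in> L2 M \<and> (\<forall>g\<in>L2 M. ip (mult_op V g) (\<lambda>_. 1) = ip g w)"])
  then show "w \<in> L2 M" "\<And>g. g \<in> L2 M \<Longrightarrow> ip (\<lambda>x. V x * g x) (\<lambda>_. 1) = ip g w"
    by (auto simp: mult_op_def)
qed

text \<open>
  The supremum in \<open>scale_const\<close> is meaningful because multiplication by a bounded function is bounded for \<open>ip\<close>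
  by equivalence of the norms; the inequality then follows by homogeneity.
\<close>

lemma scale_const_bound:
  assumes V: "V \<in> borel_measurable M" "\<And>x. \<bar>V x\<bar> \<le> B" and g: "g \<in> L2 M" and \<alpha>: "0 < \<alpha>"
  shows "\<alpha> * ip (\<lambda>x. V x * g x) g \<le> scale_const M ip \<alpha> V * (ip_norm ip g)\<^sup>2"
proof -
  let ?U = "{g \<in> L2 M. ip_norm ip g = 1}"
  have B0: "0 \<le> B" using V(2)[of undefined] by simp
  have bdd: "bdd_above ((\<lambda>g. ip (mult_op V g) g) ` ?U)"
  proof (rule bdd_aboveI2)
    fix g assume "g \<in> ?U"
    then have g: "g \<in> L2 M" and g1: "ip_norm ip g = 1" by auto
    have Vg: "(\<lambda>x. V x * g x) \<in> L2 M" by (rule L2_bounded_mult[OF g V])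
    have "L2_norm M (\<lambda>x. V x * g x) \<le> L2_norm M (\<lambda>x. B * \<bar>g x\<bar>)"
      using g V(2) L2_measurable[OF Vg]
      by (intro L2_norm_mono L2_scale) (auto simp: L2_def abs_mult intro!: mult_right_mono)
    also have "\<dots> = B * L2_norm M g"
    proof -
      have "(\<lambda>x. \<bar>g x\<bar>) \<in> L2 M" using g by (auto simp: L2_def)
      from L2.ip_norm_scale[OF this, of B] show ?thesis
        using B0 by (simp add: ip_norm_def L2_inner_def)
    qed
    also have "\<dots> \<le> B * (1 / c)"
      using norm_lower[OF g] g1 c_pos B0 by (intro mult_left_mono) (auto simp: field_simps)
    finally have Vg_le: "L2_norm M (\<lambda>x. V x * g x) \<le> B * (1 / c)" .
    have "ip (mult_op V g) g \<le> ip_norm ip (\<lambda>x. V x * g x)"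
      using Cauchy_Schwarz[OF Vg g] g1 by (simp add: mult_op_def)
    also have "\<dots> \<le> \<bar>C\<bar> * L2_norm M (\<lambda>x. V x * g x)"
      using norm_upper[OF Vg] mult_right_mono[OF abs_ge_self[of C] L2.ip_norm_nonneg[OF Vg]] by linarith
    also have "\<dots> \<le> \<bar>C\<bar> * (B * (1 / c))" by (intro mult_left_mono Vg_le) auto
    finally show "ip (mult_op V g) g \<le> \<bar>C\<bar> * (B * (1 / c))" .
  qed
  define y where "y = ip_norm ip g"
  have Vg: "(\<lambda>x. V x * g x) \<in> L2 M" by (rule L2_bounded_mult[OF g V])
  show ?thesis
  proof (cases "y = 0")
    case True
    then show ?thesis using Cauchy_Schwarz[OF Vg g] by (simp add: y_def)
  next
    case False
    then have y: "0 < y" using ip_norm_nonneg[OF g] by (simp add: y_def)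
    let ?e = "\<lambda>x. (1 / y) * g x"
    have e: "?e \<in> L2 M" using g by (rule L2_scale)
    have "ip_norm ip ?e = 1" using ip_norm_scale[OF g, of "1 / y"] y by (simp add: y_def)
    then have "ip (mult_op V ?e) ?e \<le> (SUP g\<in>?U. ip (mult_op V g) g)"
      using e by (intro cSUP_upper[OF _ bdd]) auto
    also have "\<dots> \<le> max 0 (SUP g\<in>?U. ip (mult_op V g) g)" by simp
    finally have "\<alpha> * ip (mult_op V ?e) ?e \<le> scale_const M ip \<alpha> V"
      unfolding scale_const_def using \<alpha> by simp
    moreover have "ip (mult_op V ?e) ?e = (1 / y) * ((1 / y) * ip (\<lambda>x. V x * g x) g)"
      using ip_scale_left[OF Vg e, of "1 / y"] ip_scale_right[OF g Vg, of "1 / y"]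
      by (simp add: mult_op_def mult.left_commute)
    ultimately have "\<alpha> * ip (\<lambda>x. V x * g x) g / y\<^sup>2 \<le> scale_const M ip \<alpha> V"
      by (simp add: power2_eq_square)
    then show ?thesis using y by (simp add: divide_le_eq y_def)
  qed
qed

text \<open>
  Here \<open>h\<close> plays the role of \<open>A u\<close>. Writing \<open>u = a + g\<close> with \<open>a\<close> the mean of \<open>u\<close>, the form is at most
  \<open>- (1 - \<kappa> b) y\<^sup>2 / \<alpha> + 2 \<kappa> \<bar>a\<bar> y n\<close> with \<open>y = ip_norm ip g\<close> and \<open>n\<close> the norm of \<open>1/2 (V + V\<^sup>\<dagger> 1)\<close>. The maximum of
  this quadratic polynomial in \<open>y\<close> is a multiple of \<open>a\<^sup>2\<close>, and \<open>a\<^sup>2 \<le> ip u u\<close>.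
\<close>

theorem perturbed_form_bound:
  assumes one: "\<And>g. g \<in> L2 M \<Longrightarrow> ip g (\<lambda>_. 1) = L2_inner M g (\<lambda>_. 1)"
    and V: "V \<in> borel_measurable M" "\<And>x. \<bar>V x\<bar> \<le> B" and mean: "(\<integral>x. V x \<partial>M) = 0"
    and \<alpha>: "0 < \<alpha>" and \<kappa>: "0 \<le> \<kappa>" "\<kappa> * scale_const M ip \<alpha> V < 1"
    and u: "u \<in> L2 M" and h: "h \<in> L2 M" and h_mean: "(\<integral>x. h x \<partial>M) = 0"
    and Poincare: "(ip_norm ip (\<lambda>x. u x - (\<integral>x. u x \<partial>M)))\<^sup>2
      \<le> \<alpha> * ip (\<lambda>x. - h x) (\<lambda>x. u x - (\<integral>x. u x \<partial>M))"
  shows "ip (\<lambda>x. h x + \<kappa> * (V x * u x)) u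
    \<le> \<kappa>\<^sup>2 * variance_const M ip \<alpha> V / (2 * (1 - \<kappa> * scale_const M ip \<alpha> V)) * ip u u"
proof -
  define w where "w = L2_adjoint M ip (mult_op V) (\<lambda>_. 1)"
  have w: "w \<in> L2 M" and adj: "\<And>g. g \<in> L2 M \<Longrightarrow> ip (\<lambda>x. V x * g x) (\<lambda>_. 1) = ip g w"
    using adjoint_mult_op_one[OF one V] by (auto simp: w_def)
  define b where "b = scale_const M ip \<alpha> V"
  define k where "k x = 1/2 * (V x + w x)" for x
  have V2: "V \<in> L2 M" using V by (rule bounded_in_L2)
  have k: "k \<in> L2 M" unfolding k_def[abs_def] using V2 w by auto
  have v: "variance_const M ip \<alpha> V = 2 * \<alpha> * (ip_norm ip k)\<^sup>2"
    by (simp add: variance_const_def mult_op_def k_def[abs_def] w_def)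
  define a where "a = (\<integral>x. u x \<partial>M)"
  define g where "g x = u x - a" for x
  have cst: "(\<lambda>_. r) \<in> L2 M" for r :: real by (rule bounded_in_L2[of _ "\<bar>r\<bar>"]) auto
  have g: "g \<in> L2 M" unfolding g_def[abs_def] using u cst by auto
  have u_eq: "u = (\<lambda>x. g x + a * 1)" by (simp add: g_def)
  have int_u: "integrable M u" using integrable_mult_L2[OF u cst[of 1]] by simp
  have one_ip: "ip f (\<lambda>_. 1) = (\<integral>x. f x \<partial>M)" if "f \<in> L2 M" for f
    using one[OF that] by (simp add: L2_inner_def)
  have g1: "ip g (\<lambda>_. 1) = 0"
    unfolding one_ip[OF g] using int_u by (simp add: g_def[abs_def] a_def prob_space)
  have uu: "ip u u = (ip_norm ip g)\<^sup>2 + a\<^sup>2"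
  proof -
    have "ip (\<lambda>_. 1) (\<lambda>_. 1) = 1" using one_ip[OF cst[of 1]] by (simp add: prob_space)
    then show ?thesis
      unfolding u_eq ip_square_add_scale[OF g cst[of 1], of a] g1 ip_norm_power2[OF g] by simp
  qed
  have hu: "\<alpha> * ip h u \<le> - (ip_norm ip g)\<^sup>2"
  proof -
    have "ip h u = ip h g + a * ip h (\<lambda>_. 1)"
      by (subst u_eq) (simp only: ip_add_right[OF g L2_scale[OF cst] h] ip_scale_right[OF cst h])
    then have "ip h u = ip h g" using one_ip[OF h] h_mean by simp
    then show ?thesis
      using Poincare ip_uminus_left[OF h g] by (simp add: g_def[abs_def] a_def)
  qed
  have Vg: "(\<lambda>x. V x * g x) \<in> L2 M" by (rule L2_bounded_mult[OF g V])
  have Vu: "ip (\<lambda>x. V x * u x) u = 2 * a * ip g k + ip (\<lambda>x. V x * g x) g"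
  proof -
    have "(\<lambda>x. V x * u x) = (\<lambda>x. V x * g x + a * V x)" by (simp add: g_def algebra_simps)
    then have "ip (\<lambda>x. V x * u x) u = ip (\<lambda>x. V x * g x) u + a * ip V u"
      by (simp only: ip_add_left[OF Vg L2_scale[OF V2] u] ip_scale_left[OF V2 u])
    moreover have "ip f u = ip f g + a * ip f (\<lambda>_. 1)" if "f \<in> L2 M" for f
      by (subst u_eq) (simp only: ip_add_right[OF g L2_scale[OF cst] that] ip_scale_right[OF cst that])
    moreover have "ip V (\<lambda>_. 1) = 0" using one_ip[OF V2] mean by simp
    moreover have "ip g k = (ip V g + ip g w) / 2"
      unfolding k_def[abs_def] ip_scale_right[OF L2_add[OF V2 w] g] ip_add_right[OF V2 w g] ip_commute[OF V2 g] by simp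
    ultimately show ?thesis using Vg V2 adj[OF g] by (simp add: algebra_simps)
  qed
  define y where "y = ip_norm ip g"
  define n where "n = ip_norm ip k"
  define d where "d = 1 - \<kappa> * b"
  have d: "0 < d" using \<kappa> by (simp add: d_def b_def)
  have "a * ip g k \<le> \<bar>a\<bar> * (y * n)"
    using mult_left_mono[OF Cauchy_Schwarz[OF g k] abs_ge_zero[of a]] unfolding y_def n_def
    by (simp add: abs_mult[symmetric])
  then have "(\<alpha> * \<kappa>) * (2 * (a * ip g k)) \<le> (\<alpha> * \<kappa>) * (2 * (\<bar>a\<bar> * (y * n)))"
    using \<alpha> \<kappa> by (intro mult_left_mono) auto
  moreover have "\<kappa> * (\<alpha> * ip (\<lambda>x. V x * g x) g) \<le> \<kappa> * (b * y\<^sup>2)"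
    using scale_const_bound[OF V g \<alpha>] \<kappa>(1) by (intro mult_left_mono) (auto simp: b_def y_def)
  moreover have "ip (\<lambda>x. h x + \<kappa> * (V x * u x)) u = ip h u + \<kappa> * ip (\<lambda>x. V x * u x) u"
    by (simp only: ip_add_left[OF h L2_scale[OF L2_bounded_mult[OF u V]] u] ip_scale_left[OF L2_bounded_mult[OF u V] u])
  ultimately have main: "\<alpha> * ip (\<lambda>x. h x + \<kappa> * (V x * u x)) u \<le> - (d * y\<^sup>2) + 2 * \<alpha> * \<kappa> * \<bar>a\<bar> * y * n"
    using hu unfolding Vu by (simp add: d_def y_def algebra_simps)
  \<comment> \<open>Complete the square in \<open>y\<close>.\<close>
  have "0 \<le> (d * y - \<alpha> * \<kappa> * \<bar>a\<bar> * n)\<^sup>2" by simp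
  then have "d * (- (d * y\<^sup>2) + 2 * \<alpha> * \<kappa> * \<bar>a\<bar> * y * n) \<le> (\<alpha> * \<kappa> * \<bar>a\<bar> * n)\<^sup>2"
    by (simp add: power2_diff power2_eq_square algebra_simps)
  then have "- (d * y\<^sup>2) + 2 * \<alpha> * \<kappa> * \<bar>a\<bar> * y * n \<le> (\<alpha> * \<kappa> * \<bar>a\<bar> * n)\<^sup>2 / d"
    using d by (simp add: pos_le_divide_eq mult.commute)
  also have "\<dots> = \<alpha> * (\<kappa>\<^sup>2 * (2 * \<alpha> * n\<^sup>2) / (2 * d) * a\<^sup>2)"
    using d by (simp add: power_mult_distrib power2_eq_square field_simps)
  finally have "\<alpha> * ip (\<lambda>x. h x + \<kappa> * (V x * u x)) u \<le> \<alpha> * (\<kappa>\<^sup>2 * (2 * \<alpha> * n\<^sup>2) / (2 * d) * a\<^sup>2)"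
    using main by linarith
  then have "ip (\<lambda>x. h x + \<kappa> * (V x * u x)) u \<le> \<kappa>\<^sup>2 * (2 * \<alpha> * n\<^sup>2) / (2 * d) * a\<^sup>2"
    by (rule mult_left_le_imp_le) (rule \<alpha>)
  also have "\<dots> \<le> \<kappa>\<^sup>2 * (2 * \<alpha> * n\<^sup>2) / (2 * d) * ip u u"
    using d \<alpha> by (intro mult_left_mono) (auto simp: uu)
  finally show ?thesis by (simp add: v n_def d_def b_def)
qed

text \<open>
  Testing \<open>1/2 (V + V\<^sup>\<dagger> 1)\<close> against \<open>V\<close> gives half the sum of the squares of the two norms of \<open>V\<close>.
\<close>

lemma variance_const_pos:
  assumes one: "\<And>g. g \<in> L2 M \<Longrightarrow> ip g (\<lambda>_. 1) = L2_inner M g (\<lambda>_. 1)"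
    and V: "V \<in> borel_measurable M" "\<And>x. \<bar>V x\<bar> \<le> B"
    and nz: "\<not> (AE x in M. V x = 0)" and \<alpha>: "0 < \<alpha>"
  shows "0 < variance_const M ip \<alpha> V"
proof -
  define w where "w = L2_adjoint M ip (mult_op V) (\<lambda>_. 1)"
  have w: "w \<in> L2 M" and adj: "\<And>g. g \<in> L2 M \<Longrightarrow> ip (\<lambda>x. V x * g x) (\<lambda>_. 1) = ip g w"
    using adjoint_mult_op_one[OF one V] by (auto simp: w_def)
  define k where "k x = 1/2 * (V x + w x)" for x
  have V2: "V \<in> L2 M" using V by (rule bounded_in_L2)
  have k: "k \<in> L2 M" unfolding k_def[abs_def] using V2 w by auto
  have v: "variance_const M ip \<alpha> V = 2 * \<alpha> * (ip_norm ip k)\<^sup>2"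
    by (simp add: variance_const_def mult_op_def k_def[abs_def] w_def)
  have "ip V V \<noteq> 0" using ip_eq_0_iff[OF V2] nz by simp
  then have "0 < ip V V" using ip_nonneg[OF V2] by simp
  moreover have "0 \<le> ip (\<lambda>x. V x * V x) (\<lambda>_. 1)"
    using one[OF L2_bounded_mult[OF V2 V]] by (simp add: L2_inner_def)
  moreover have "ip V k = (ip V V + ip (\<lambda>x. V x * V x) (\<lambda>_. 1)) / 2"
    unfolding k_def[abs_def] ip_scale_right[OF L2_add[OF V2 w] V2] ip_add_right[OF V2 w V2] adj[OF V2] by simp
  ultimately have "ip V k \<noteq> 0" by simp
  then have "ip_norm ip k \<noteq> 0" using Cauchy_Schwarz[OF V2 k] by auto
  then show ?thesis using v \<alpha> by simp
qed

end

context stationary_potential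
begin

text \<open>
  By invariance the difference quotients of the semigroup have mean zero.
\<close>

lemma generator_value_mean:
  assumes g: "bounded_Borel G g" and gen: "is_generator_value M (Markov_semigroup X P) g h"
  shows "(\<integral>x. h x \<partial>M) = 0"
proof -
  have h: "h \<in> L2 M"
    and lim: "((\<lambda>t. L2_norm M (\<lambda>x. (Markov_semigroup X P t g x - g x) / t - h x)) \<longlongrightarrow> 0) (at_right 0)"
    using gen by (auto simp: is_generator_value_def)
  have "\<bar>\<integral>x. h x \<partial>M\<bar> \<le> 0"
  proof (rule tendsto_lowerbound[OF lim])
    show "\<forall>\<^sub>F t in at_right 0. \<bar>\<integral>x. h x \<partial>M\<bar> \<le> L2_norm M (\<lambda>x. (Markov_semigroup X P t g x - g x) / t - h x)"
      unfolding eventually_at_right_field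
    proof (intro exI[of _ 1] conjI allI impI)
      fix t :: real assume t: "0 < t"
      then have t0: "0 \<le> t" by simp
      have diff: "(\<lambda>x. (T t g x - g x) / t) \<in> L2 M"
        by (intro L2_divide L2_diff bounded_L2[OF T_bounded[OF g]] bounded_L2[OF g])
      have "(\<integral>x. (T t g x - g x) / t - h x \<partial>M) = - (\<integral>x. h x \<partial>M)"
        using integral_T[OF t0 g] integrable_M[OF g] integrable_M[OF T_bounded[OF g]]
          integrable_mult_L2[OF h bounded_L2[OF one_bounded]] by simp
      then show "\<bar>\<integral>x. h x \<partial>M\<bar> \<le> L2_norm M (\<lambda>x. (Markov_semigroup X P t g x - g x) / t - h x)"
        using M.abs_integral_le_L2_norm[OF L2_diff[OF diff h]] unfolding T_eq_Markov_semigroup[OF t0] by simp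
    qed simp
  qed simp
  then show ?thesis by simp
qed

lemma generator_value_unique:
  assumes g: "bounded_Borel G g"
    and h: "is_generator_value M (Markov_semigroup X P) g h"
    and h': "is_generator_value M (Markov_semigroup X P) g h'"
  shows "AE x in M. h x = h' x"
proof -
  let ?d = "\<lambda>t x. (Markov_semigroup X P t g x - g x) / t"
  have L: "h \<in> L2 M" "h' \<in> L2 M"
    and lim: "((\<lambda>t. L2_norm M (\<lambda>x. ?d t x - h x)) \<longlongrightarrow> 0) (at_right 0)"
      "((\<lambda>t. L2_norm M (\<lambda>x. ?d t x - h' x)) \<longlongrightarrow> 0) (at_right 0)"
    using h h' by (auto simp: is_generator_value_def)
  have lim2: "((\<lambda>t. L2_norm M (\<lambda>x. ?d t x - h' x) + L2_norm M (\<lambda>x. ?d t x - h x)) \<longlongrightarrow> 0) (at_right 0)"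
    using tendsto_add[OF lim(2,1)] by simp
  have "L2_norm M (\<lambda>x. h x - h' x) \<le> 0"
  proof (rule tendsto_lowerbound[OF lim2])
    show "\<forall>\<^sub>F t in at_right 0. L2_norm M (\<lambda>x. h x - h' x)
        \<le> L2_norm M (\<lambda>x. ?d t x - h' x) + L2_norm M (\<lambda>x. ?d t x - h x)"
      unfolding eventually_at_right_field
    proof (intro exI[of _ 1] conjI allI impI)
      fix t :: real assume "0 < t"
      then have t0: "0 \<le> t" by simp
      have "?d t \<in> L2 M"
        unfolding T_eq_Markov_semigroup[OF t0]
        by (intro L2_divide L2_diff bounded_L2[OF T_bounded[OF g]] bounded_L2[OF g])
      then have a: "(\<lambda>x. ?d t x - h' x) \<in> L2 M" and b: "(\<lambda>x. ?d t x - h x) \<in> L2 M" using L by auto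
      have "(\<lambda>x. h x - h' x) = (\<lambda>x. (?d t x - h' x) + (-1) * (?d t x - h x))" by auto
      then show "L2_norm M (\<lambda>x. h x - h' x) \<le> L2_norm M (\<lambda>x. ?d t x - h' x) + L2_norm M (\<lambda>x. ?d t x - h x)"
        using L2.ip_norm_triangle[OF a L2_scale[OF b, of "-1"]] L2.ip_norm_scale[OF b, of "-1"] by simp
    qed simp
  qed simp
  then have "L2_inner M (\<lambda>x. h x - h' x) (\<lambda>x. h x - h' x) = 0"
    using L2.ip_norm_nonneg[OF L2_diff[OF L]] L2.ip_norm_power2[OF L2_diff[OF L]] by simp
  then show ?thesis using L2.ip_eq_0_iff[OF L2_diff[OF L]] by simp
qed

lemma generator_value_diff_const:
  assumes g: "bounded_Borel G g" and h: "is_generator_value M (Markov_semigroup X P) g h"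
  shows "is_generator_value M (Markov_semigroup X P) (\<lambda>x. g x - a) h"
proof -
  have eq: "Markov_semigroup X P t (\<lambda>x. g x - a) x - (g x - a) = Markov_semigroup X P t g x - g x" if "0 < t" for t x
  proof -
    have "T t (\<lambda>_. a) x = a"
      using prob_space.prob_space[OF prob_space_P, of x] by (simp add: T_def)
    then have "T t (\<lambda>x. g x - a) x = T t g x - a"
      using T_diff[OF g bounded_Borel_const[of a], of t x] by simp
    then show ?thesis using that by (simp add: T_eq_Markov_semigroup)
  qed
  have "\<forall>\<^sub>F t in at_right 0. L2_norm M (\<lambda>x. (Markov_semigroup X P t g x - g x) / t - h x)
      = L2_norm M (\<lambda>x. (Markov_semigroup X P t (\<lambda>x. g x - a) x - (g x - a)) / t - h x)"
    unfolding eventually_at_right_field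
  proof (intro exI[of _ 1] conjI allI impI)
    fix t :: real assume "0 < t"
    then show "L2_norm M (\<lambda>x. (Markov_semigroup X P t g x - g x) / t - h x)
      = L2_norm M (\<lambda>x. (Markov_semigroup X P t (\<lambda>x. g x - a) x - (g x - a)) / t - h x)"
      by (simp only: eq)
  qed simp
  then show ?thesis
    using h unfolding is_generator_value_def by (auto intro: Lim_transform_eventually)
qed

end

locale form_stationary_potential = stationary_potential F \<FF> X P W K M + equivalent_L2_form M ip c C
  for F :: "'w measure" and \<FF> :: "real \<Rightarrow> 'w measure"
    and X :: "real \<Rightarrow> 'w \<Rightarrow> 'a::polish_space" and P :: "'a \<Rightarrow> 'w measure"
    and W :: "'a \<Rightarrow> real" and K :: real and M :: "'a measure"
    and ip :: "('a \<Rightarrow> real) \<Rightarrow> ('a \<Rightarrow> real) \<Rightarrow> real" and c C :: real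
begin

lemma energy_right_derivative:
  assumes t: "0 \<le> t"
  shows "((\<lambda>t. ip (u t) (u t)) has_real_derivative 2 * ip (Q t W) (u t)) (at_right t)"
proof -
  define w where "w = Q t W"
  have w: "w \<in> L2 M" unfolding w_def by (rule bounded_L2[OF QW_bounded[OF t]])
  have ut: "u s \<in> L2 M" if "0 \<le> s" for s by (rule bounded_L2[OF u_bounded[OF that]])
  define r where "r h x = (u (t + h) x - u t x) / h - w x" for h x
  have r: "r h \<in> L2 M" if "0 < h" for h
    unfolding r_def using t that by (intro L2_diff L2_divide ut w) auto
  have r_lim: "((\<lambda>h. ip_norm ip (r h)) \<longlongrightarrow> 0) (at_right 0)"
  proof (rule ip_norm_tendsto_0)
    show "((\<lambda>h. L2_norm M (r h)) \<longlongrightarrow> 0) (at_right 0)"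
      using u_right_derivative[OF t] by (simp add: r_def[abs_def] w_def)
    show "\<forall>\<^sub>F h in at_right 0. r h \<in> L2 M"
      using r by (auto simp: eventually_at_right_field intro!: exI[of _ 1])
  qed
  let ?\<Phi> = "\<lambda>t. ip (u t) (u t)"
  let ?b = "\<lambda>h. 2 * ip_norm ip (r h) * ip_norm ip (u t) + h * (ip_norm ip w + ip_norm ip (r h))\<^sup>2"
  have "((\<lambda>h. (?\<Phi> (t + h) - ?\<Phi> t) / h - 2 * ip w (u t)) \<longlongrightarrow> 0) (at_right 0)"
  proof (rule Lim_null_comparison)
    have "(?b \<longlongrightarrow> 2 * 0 * ip_norm ip (u t) + 0 * (ip_norm ip w + 0)\<^sup>2) (at_right 0)"
      by (intro tendsto_intros r_lim)
    then show "(?b \<longlongrightarrow> 0) (at_right 0)" by simp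
    show "\<forall>\<^sub>F h in at_right 0. norm ((?\<Phi> (t + h) - ?\<Phi> t) / h - 2 * ip w (u t)) \<le> ?b h"
      unfolding eventually_at_right_field
    proof (intro exI[of _ 1] conjI allI impI)
      fix h :: real assume h: "0 < h"
      define q where "q x = w x + r h x" for x
      have q: "q \<in> L2 M" unfolding q_def[abs_def] using w r[OF h] by auto
      have "u (t + h) = (\<lambda>x. u t x + h * q x)" using h by (auto simp: q_def r_def)
      then have "?\<Phi> (t + h) = ?\<Phi> t + 2 * h * ip (u t) q + h\<^sup>2 * ip q q"
        by (simp add: ip_square_add_scale[OF ut[OF t] q])
      then have "(?\<Phi> (t + h) - ?\<Phi> t) / h = 2 * ip (u t) q + h * ip q q"
        using h by (simp add: power2_eq_square field_simps)
      moreover have "ip (u t) q = ip w (u t) + ip (r h) (u t)"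
        using ip_commute[OF ut[OF t] q] unfolding q_def[abs_def] ip_add_left[OF w r[OF h] ut[OF t]] .
      ultimately have eq: "(?\<Phi> (t + h) - ?\<Phi> t) / h - 2 * ip w (u t) = 2 * ip (r h) (u t) + h * ip q q" by simp
      have "ip q q \<le> (ip_norm ip w + ip_norm ip (r h))\<^sup>2"
        using power_mono[OF ip_norm_triangle[OF w r[OF h]], of 2] ip_norm_nonneg[OF q] ip_norm_power2[OF q]
        by (simp add: q_def[abs_def])
      then have "h * ip q q \<le> h * (ip_norm ip w + ip_norm ip (r h))\<^sup>2" using h by simp
      moreover have "0 \<le> h * ip q q" using ip_nonneg[OF q] h by simp
      moreover have "\<bar>ip (r h) (u t)\<bar> \<le> ip_norm ip (r h) * ip_norm ip (u t)"
        by (rule Cauchy_Schwarz[OF r[OF h] ut[OF t]])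
      ultimately show "norm ((?\<Phi> (t + h) - ?\<Phi> t) / h - 2 * ip w (u t)) \<le> ?b h"
        unfolding eq real_norm_def by (simp add: mult.assoc)
    qed simp
  qed
  then have "((\<lambda>h. (?\<Phi> (h + t) - ?\<Phi> t) / h) \<longlongrightarrow> 2 * ip w (u t)) (at_right 0)"
    by (simp add: LIM_zero_iff add.commute)
  then show ?thesis
    unfolding has_field_derivative_iff filterlim_at_right_to_0[of _ _ t] by (simp add: w_def)
qed

text \<open>
  \<open>u\<close> is Lipschitz in time, on bounded time intervals and uniformly in the state.
\<close>

lemma energy_continuous: "continuous_on {0..S} (\<lambda>t. ip (u t) (u t))"
proof -
  have ut: "u s \<in> L2 M" if "0 \<le> s" for s by (rule bounded_L2[OF u_bounded[OF that]])
  define B where "B = \<bar>C\<bar> * exp (K * S)"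
  define L where "L = \<bar>C\<bar> * (exp (K * S) * (exp (K * S) * K)) * (2 * B)"
  have norm_u: "ip_norm ip (u s) \<le> B" if s: "s \<in> {0..S}" for s
    unfolding B_def
  proof (rule ip_norm_le_bounded)
    have s0: "0 \<le> s" using s by simp
    show "u s \<in> borel_measurable M"
      using bounded_BorelD(1)[OF u_bounded[OF s0]] by (simp add: borel_measurable_M)
    have "exp (K * s) \<le> exp (K * S)" using s K_nonneg by (auto intro!: mult_left_mono)
    then show "\<bar>u s x\<bar> \<le> exp (K * S)" for x
      using bounded_BorelD(2)[OF u_bounded[OF s0], of x] by linarith
  qed
  have incr: "\<bar>ip (u (s + h)) (u (s + h)) - ip (u s) (u s)\<bar> \<le> L * h" if s: "0 \<le> s" "0 \<le> h" "s + h \<le> S" for s h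
  proof -
    let ?d = "\<lambda>x. u (s + h) x - u s x"
    have sh: "0 \<le> s + h" using s by simp
    have d: "?d \<in> L2 M" by (intro L2_diff ut s sh)
    have dn: "ip_norm ip ?d \<le> \<bar>C\<bar> * (exp (K * S) * (exp (K * S) * (K * h)))"
    proof (rule ip_norm_le_bounded)
      show "?d \<in> borel_measurable M" using L2_measurable[OF d] .
      have "exp (K * s) * (exp (K * h) * (K * h)) \<le> exp (K * S) * (exp (K * S) * (K * h))"
        using s K_nonneg by (intro mult_mono) (auto intro!: mult_left_mono)
      then show "\<bar>?d x\<bar> \<le> exp (K * S) * (exp (K * S) * (K * h))" for x
        using u_Lipschitz[OF s(1,2), of x] by linarith
    qed
    have split: "ip (u (s + h)) (u (s + h)) - ip (u s) (u s) = ip ?d (u (s + h)) + ip ?d (u s)"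
      unfolding ip_diff_left[OF ut[OF sh] ut[OF s(1)] ut[OF sh]] ip_diff_left[OF ut[OF sh] ut[OF s(1)] ut[OF s(1)]]
      using ip_commute[OF ut[OF s(1)] ut[OF sh]] by simp
    have "\<bar>ip (u (s + h)) (u (s + h)) - ip (u s) (u s)\<bar>
        \<le> ip_norm ip ?d * ip_norm ip (u (s + h)) + ip_norm ip ?d * ip_norm ip (u s)"
      unfolding split using Cauchy_Schwarz[OF d ut[OF sh]] Cauchy_Schwarz[OF d ut[OF s(1)]] by linarith
    also have "\<dots> \<le> ip_norm ip ?d * B + ip_norm ip ?d * B"
      using s by (intro add_mono mult_left_mono norm_u ip_norm_nonneg[OF d]) auto
    also have "\<dots> = ip_norm ip ?d * (2 * B)" by simp
    also have "\<dots> \<le> (\<bar>C\<bar> * (exp (K * S) * (exp (K * S) * (K * h)))) * (2 * B)"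
      by (intro mult_right_mono dn) (simp add: B_def)
    also have "\<dots> = L * h" by (simp add: L_def)
    finally show ?thesis .
  qed
  have "0 \<le> L" using K_nonneg by (simp add: L_def B_def)
  then have "L-lipschitz_on {0..S} (\<lambda>t. ip (u t) (u t))"
  proof (rule lipschitz_onI[rotated])
    fix x y assume xy: "x \<in> {0..S}" "y \<in> {0..S}"
    show "dist (ip (u x) (u x)) (ip (u y) (u y)) \<le> L * dist x y"
      using incr[of x "y - x"] incr[of y "x - y"] xy
      by (cases "x \<le> y") (auto simp: dist_real_def abs_minus_commute)
  qed
  then show ?thesis by (rule lipschitz_on_continuous_on)
qed

theorem energy_growth:
  assumes S: "0 \<le> S"
    and le: "\<And>t. 0 \<le> t \<Longrightarrow> ip (Q t W) (u t) \<le> \<Lambda> * ip (u t) (u t)"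
    and one: "ip (\<lambda>_. 1) (\<lambda>_. 1) = 1"
  shows "L2_norm M (u S) \<le> inverse c * exp (\<Lambda> * S)"
proof -
  have uS: "u S \<in> L2 M" by (rule bounded_L2[OF u_bounded[OF S]])
  have "ip (u S) (u S) \<le> exp ((2 * \<Lambda>) * S) * ip (u 0) (u 0)"
    by (rule Gronwall_right_derivative[OF energy_continuous S energy_right_derivative]) (use le in auto)
  then have "(ip_norm ip (u S))\<^sup>2 \<le> (exp (\<Lambda> * S))\<^sup>2"
    by (simp add: ip_norm_power2[OF uS] u_0 one exp_double[symmetric] mult.assoc)
  then have "ip_norm ip (u S) \<le> exp (\<Lambda> * S)" by (rule power2_le_imp_le) simp
  then have "c * L2_norm M (u S) \<le> exp (\<Lambda> * S)" using norm_lower[OF uS] by linarith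
  then show ?thesis using c_pos by (simp add: field_simps)
qed

end

section \<open>Concentration of time averages\<close>

locale Poincare_process = cadlag_Markov F \<FF> X P + equivalent_L2_form M ip c C
  for F :: "'w measure" and \<FF> :: "real \<Rightarrow> 'w measure"
    and X :: "real \<Rightarrow> 'w \<Rightarrow> 'a::polish_space" and P :: "'a \<Rightarrow> 'w measure"
    and M :: "'a measure"
    and ip :: "('a \<Rightarrow> real) \<Rightarrow> ('a \<Rightarrow> real) \<Rightarrow> real" and c C :: real +
  fixes \<alpha> :: real
  assumes sets_M: "sets M = sets borel"
    and invariant: "invariant_measure X P M"
    and strongly_continuous: "strongly_continuous_L2 M (Markov_semigroup X P)"
    and ip_one: "\<And>g. g \<in> L2 M \<Longrightarrow> ip g (\<lambda>_. 1) = L2_inner M g (\<lambda>_. 1)"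
    and \<alpha>_pos: "0 < \<alpha>"
    and Poincare: "\<And>g. g \<in> generator_domain M (Markov_semigroup X P) \<Longrightarrow> (\<integral>x. g x \<partial>M) = 0 \<Longrightarrow>
      (ip_norm ip g)\<^sup>2 \<le> \<alpha> * ip (\<lambda>x. - generator M (Markov_semigroup X P) g x) g"
begin

text \<open>
  The Poincare inequality is applied to the centred part of \<open>u t\<close>, which is in the domain of the generator
  together with \<open>u t\<close> because the semigroup preserves constants. The chosen value of the generator agrees with the explicit one
  only almost everywhere, which \<open>ip\<close> does not see.
\<close>

lemma exponential_moment_bound:
  assumes V: "bounded_Borel B V" and mean: "(\<integral>x. V x \<partial>M) = 0"
    and \<kappa>: "0 \<le> \<kappa>" "\<kappa> * scale_const M ip \<alpha> V < 1" and S: "0 \<le> S"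
  shows "L2_norm M (\<lambda>x. \<integral>\<omega>. exp (\<kappa> * (LINT t:{0..S}|lborel. V (X t \<omega>))) \<partial>P x)
    \<le> inverse c * exp (\<kappa>\<^sup>2 * variance_const M ip \<alpha> V / (2 * (1 - \<kappa> * scale_const M ip \<alpha> V)) * S)"
proof -
  define W where "W x = \<kappa> * V x" for x
  interpret E: form_stationary_potential F \<FF> X P W "\<bar>\<kappa>\<bar> * B" M ip c C
    by unfold_locales
      (use bounded_Borel_scale[OF V, of \<kappa>] sets_M invariant strongly_continuous in \<open>auto simp: W_def[abs_def]\<close>)
  have VM: "V \<in> borel_measurable M" "\<And>x. \<bar>V x\<bar> \<le> B"
    using V by (auto simp: E.borel_measurable_M dest: bounded_BorelD)
  have "E.Z 0 S \<omega> = \<kappa> * (LINT t:{0..S}|lborel. V (X t \<omega>))" for \<omega>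
  proof -
    have "E.Z 0 S \<omega> = (LINT t:{0..S}|lborel. \<kappa> * V (X t \<omega>))"
      unfolding E.Z_def W_def by (rule set_lebesgue_integral_cong) (auto simp: Y_def)
    then show ?thesis by simp
  qed
  then have u_eq: "E.u S = (\<lambda>x. \<integral>\<omega>. exp (\<kappa> * (LINT t:{0..S}|lborel. V (X t \<omega>))) \<partial>P x)"
    by (simp add: fun_eq_iff E.u_def E.Q_def)
  let ?\<Lambda> = "\<kappa>\<^sup>2 * variance_const M ip \<alpha> V / (2 * (1 - \<kappa> * scale_const M ip \<alpha> V))"
  have "L2_norm M (E.u S) \<le> inverse c * exp (?\<Lambda> * S)"
  proof (rule E.energy_growth[OF S])
    show "ip (\<lambda>_. 1) (\<lambda>_. 1) = 1"
      using ip_one[OF E.bounded_L2[OF E.one_bounded]] by (simp add: L2_inner_def prob_space)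
    fix t :: real assume t: "0 \<le> t"
    define h where "h x = E.Q t W x - W x * E.u t x" for x
    define g where "g x = E.u t x - (\<integral>x. E.u t x \<partial>M)" for x
    note ub = E.u_bounded[OF t]
    have u2: "E.u t \<in> L2 M" by (rule E.bounded_L2[OF ub])
    have gen: "is_generator_value M (Markov_semigroup X P) (E.u t) h"
      unfolding h_def[abs_def] by (rule E.u_in_generator_domain[OF t])
    have h: "h \<in> L2 M" using gen by (simp add: is_generator_value_def)
    have gb: "bounded_Borel (exp (\<bar>\<kappa>\<bar> * B * t) + \<bar>\<integral>x. E.u t x \<partial>M\<bar>) g"
      unfolding g_def[abs_def] by (rule bounded_Borel_diff[OF ub bounded_Borel_const])
    have g2: "g \<in> L2 M" by (rule E.bounded_L2[OF gb])
    have gen_g: "is_generator_value M (Markov_semigroup X P) g h"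
      unfolding g_def[abs_def] by (rule E.generator_value_diff_const[OF ub gen])
    then have dom: "g \<in> generator_domain M (Markov_semigroup X P)"
      using g2 by (auto simp: generator_domain_def)
    have gen_g': "is_generator_value M (Markov_semigroup X P) g (generator M (Markov_semigroup X P) g)"
      unfolding generator_def
      by (rule someI[where P = "is_generator_value M (Markov_semigroup X P) g", OF gen_g])
    then have A2: "generator M (Markov_semigroup X P) g \<in> L2 M" by (simp add: is_generator_value_def)
    have "(\<integral>x. g x \<partial>M) = 0"
      unfolding g_def using E.integrable_M[OF ub] by (simp add: prob_space)
    from Poincare[OF dom this]
    have "(ip_norm ip g)\<^sup>2 \<le> \<alpha> * ip (\<lambda>x. - generator M (Markov_semigroup X P) g x) g" .
    also have "ip (\<lambda>x. - generator M (Markov_semigroup X P) g x) g = ip (\<lambda>x. - h x) g"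
      using E.generator_value_unique[OF gb gen_g' gen_g] by (intro ip_cong_AE L2_uminus A2 h g2) auto
    finally have "ip (\<lambda>x. h x + \<kappa> * (V x * E.u t x)) (E.u t) \<le> ?\<Lambda> * ip (E.u t) (E.u t)"
      unfolding g_def
      by (intro perturbed_form_bound[OF ip_one VM mean \<alpha>_pos \<kappa> u2 h E.generator_value_mean[OF ub gen]])
    moreover have "(\<lambda>x. h x + \<kappa> * (V x * E.u t x)) = E.Q t W" by (simp add: h_def W_def mult.assoc)
    ultimately show "ip (E.Q t W) (E.u t) \<le> ?\<Lambda> * ip (E.u t) (E.u t)" by simp
  qed
  then show ?thesis unfolding u_eq .
qed

lemma scale_const_nonneg: "0 \<le> scale_const M ip \<alpha> V"
  using \<alpha>_pos by (simp add: scale_const_def)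

text \<open>
  Markov's inequality for \<open>exp (\<kappa> \<integral> V (X t) dt)\<close>. Writing \<open>L = ln (2 N / \<delta>) / S\<close>, \<open>v\<close> and \<open>b\<close> for the two constants and
  \<open>s = sqrt (2 L / v)\<close>, the radius is \<open>s v + b L\<close>, and \<open>\<kappa> = s / (1 + b s)\<close> makes \<open>\<kappa> r\<close> exceed the growth rate by
  exactly \<open>L\<close>. That \<open>s\<close> is well defined and positive uses \<open>0 < v\<close>, which holds as \<open>V\<close> is not a null function, and
  \<open>1 \<le> N\<close>, which holds because the norm of \<open>1\<close> is one for both inner
  products, so that \<open>c \<le> 1\<close>, and the density \<open>\<rho>\<close> has integral one, so that its norm is at least one.
\<close>

theorem upper_tail_bound:
  fixes \<mu> :: "'a measure" and \<rho> :: "'a \<Rightarrow> real"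
  defines "\<rho> \<equiv> (\<lambda>x. enn2real (RN_deriv M \<mu> x))" and "N \<equiv> inverse c * L2_norm M \<rho>"
  assumes \<mu>: "prob_space \<mu>" "sets \<mu> = sets borel" "absolutely_continuous M \<mu>" and \<rho>: "\<rho> \<in> L2 M"
    and V: "bounded_Borel B V" and mean: "(\<integral>x. V x \<partial>M) = 0" and nz: "\<not> (AE x in M. V x = 0)"
    and S: "0 < S" and \<delta>: "0 < \<delta>" "\<delta> < 1"
  shows "measure (\<mu> \<bind> P) {\<omega> \<in> space F.
      S * deviation_radius S \<delta> N (variance_const M ip \<alpha> V) (scale_const M ip \<alpha> V)
        \<le> (LINT t:{0..S}|lborel. V (X t \<omega>))} \<le> \<delta> / 2"
proof -
  interpret \<mu>: prob_space \<mu> by (rule \<mu>)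
  define v where "v = variance_const M ip \<alpha> V"
  define b where "b = scale_const M ip \<alpha> V"
  have VM: "V \<in> borel_measurable M" "\<And>x. \<bar>V x\<bar> \<le> B"
    using V measurable_cong_sets[OF sets_M refl] by (auto dest: bounded_BorelD)
  have v: "0 < v" unfolding v_def by (rule variance_const_pos[OF ip_one VM nz \<alpha>_pos])
  have b: "0 \<le> b" unfolding b_def by (rule scale_const_nonneg)
  have one_L2: "(\<lambda>_. 1) \<in> L2 M" by (rule bounded_in_L2[of _ 1]) auto
  have \<rho>_nonneg: "0 \<le> L2_norm M \<rho>" using \<rho> by (rule L2.ip_norm_nonneg)
  have change: "(\<integral>x. g x \<partial>\<mu>) = (\<integral>x. \<rho> x * g x \<partial>M)" if "g \<in> borel_measurable M" for g :: "'a \<Rightarrow> real"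
    unfolding \<rho>_def
    by (rule RN_deriv_integral[OF _ \<mu>(3) _ that]) (use \<mu>.sigma_finite_measure_axioms \<mu>(2) sets_M in auto)
  have N1: "1 \<le> N"
  proof -
    have "1 = (\<integral>x. \<rho> x * 1 \<partial>M)" using change[of "\<lambda>_. 1"] by (simp add: \<mu>.prob_space)
    also have "\<dots> \<le> L2_norm M \<rho>" using abs_integral_le_L2_norm[OF \<rho>] by simp
    finally have \<rho>1: "1 \<le> L2_norm M \<rho>" .
    have "L2_norm M (\<lambda>_. 1) = 1" "ip_norm ip (\<lambda>_. 1) = 1"
      using ip_one[OF one_L2] by (simp_all add: ip_norm_def L2_inner_def prob_space)
    then have "c \<le> 1" using norm_lower[OF one_L2] by simp
    then have "1 * 1 \<le> inverse c * L2_norm M \<rho>"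
      using c_pos \<rho>1 by (intro mult_mono) (auto simp: field_simps)
    then show ?thesis by (simp add: N_def)
  qed
  define L where "L = ln (2 * N / \<delta>) / S"
  have "1 < 2 * N / \<delta>" using N1 \<delta> by (simp add: field_simps)
  then have L: "0 < L" using S by (simp add: L_def)
  define s where "s = sqrt (2 * L / v)"
  have s: "0 < s" "s\<^sup>2 = 2 * L / v" using v L by (simp_all add: s_def)
  define \<kappa> where "\<kappa> = s / (1 + b * s)"
  have bs: "0 < 1 + b * s" using b s by (simp add: add_pos_nonneg)
  have \<kappa>: "0 < \<kappa>" "1 - \<kappa> * b = 1 / (1 + b * s)"
    using s bs by (simp_all add: \<kappa>_def field_simps)
  have \<kappa>b: "\<kappa> * b < 1" using \<kappa>(2) bs by (metis diff_gt_0_iff_gt zero_less_divide_1_iff)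
  define r where "r = deviation_radius S \<delta> N v b"
  have r: "r = s * v + b * L"
  proof -
    have "(s * v)\<^sup>2 = 2 * L * v"
      using v by (simp add: power_mult_distrib s(2)) (simp add: power2_eq_square)
    then have "2 * v * (1 / S) * ln (2 * N / \<delta>) = (s * v)\<^sup>2" by (simp add: L_def)
    then show ?thesis
      using s v by (simp add: r_def deviation_radius_def L_def)
  qed
  define \<Lambda> where "\<Lambda> = \<kappa>\<^sup>2 * v / (2 * (1 - \<kappa> * b))"
  have exponent: "\<kappa> * r - \<Lambda> = L"
  proof -
    have Lv: "L = s * s * v / 2" using s(2) v by (simp add: power2_eq_square)
    have "\<Lambda> = s * s * v / 2 / (1 + b * s)"
      unfolding \<Lambda>_def \<kappa>(2) using bs by (simp add: \<kappa>_def power2_eq_square)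
    moreover have "\<kappa> * r = (s * s * v + s * b * L) / (1 + b * s)"
      by (simp add: \<kappa>_def r algebra_simps)
    ultimately have "\<kappa> * r - \<Lambda> = (s * s * v + s * b * L - s * s * v / 2) / (1 + b * s)"
      by (simp only: diff_divide_distrib)
    also have "s * s * v + s * b * L - s * s * v / 2 = L * (1 + b * s)"
      unfolding Lv by (simp add: algebra_simps)
    finally show ?thesis using bs by simp
  qed
  define I where "I \<omega> = (LINT t:{0..S}|lborel. V (X t \<omega>))" for \<omega>
  have [measurable]: "V \<in> borel_measurable borel" using V by (rule bounded_BorelD)
  have I_eq: "I \<omega> = (LINT t:{0..S}|lborel. V (Y t \<omega>))" for \<omega>
    unfolding I_def by (rule set_lebesgue_integral_cong) (auto simp: Y_def)
  have [measurable]: "I \<in> borel_measurable F"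
    unfolding I_eq by (rule measurable_set_integral_Icc) measurable
  have I_le: "\<bar>I \<omega>\<bar> \<le> B * (S - 0)" if "\<omega> \<in> space F" for \<omega>
    unfolding I_eq
    by (rule abs_set_integral_bounded) (use that S bounded_BorelD(2)[OF V] in auto)
  have "\<mu> \<in> space (prob_algebra borel)" using \<mu> by (simp add: space_prob_algebra)
  then have sets_bind [measurable_cong]: "sets (\<mu> \<bind> P) = sets F" and prob: "prob_space (\<mu> \<bind> P)"
    using P_kernel by (rule sets_bind', rule prob_space_bind')
  interpret \<mu>P: prob_space "\<mu> \<bind> P" by (rule prob)
  have space_bind: "space (\<mu> \<bind> P) = space F" by (rule sets_eq_imp_space_eq[OF sets_bind])
  have eI_le: "\<bar>exp (\<kappa> * I \<omega>)\<bar> \<le> exp (\<kappa> * (B * S))" if "\<omega> \<in> space F" for \<omega>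
    using I_le[OF that] \<kappa>(1) by (auto intro!: mult_left_mono)
  define U where "U x = (\<integral>\<omega>. exp (\<kappa> * I \<omega>) \<partial>P x)" for x
  have U_le: "L2_norm M U \<le> inverse c * exp (\<Lambda> * S)"
    unfolding U_def[abs_def] I_def \<Lambda>_def v_def b_def
    by (rule exponential_moment_bound[OF V mean]) (use \<kappa>(1) \<kappa>b S in \<open>auto simp: b_def\<close>)
  have U_meas: "U \<in> borel_measurable M"
    unfolding measurable_cong_sets[OF sets_M refl] U_def[abs_def]
    by (rule measurable_integral_kernel[where F = F]) measurable
  have U2: "U \<in> L2 M"
    by (rule bounded_in_L2[OF U_meas]) (unfold U_def, rule abs_integral_P_le, use eI_le in auto)
  have "(\<integral>\<omega>. exp (\<kappa> * I \<omega>) \<partial>(\<mu> \<bind> P)) = (\<integral>x. U x \<partial>\<mu>)"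
    unfolding U_def
    by (rule integral_bind_P[OF \<mu>(1,2), where B = "exp (\<kappa> * (B * S))"]) (use eI_le in auto)
  also have "\<dots> = L2_inner M \<rho> U"
    unfolding change[OF U_meas] L2_inner_def ..
  also have "\<dots> \<le> L2_norm M \<rho> * L2_norm M U"
    using L2.Cauchy_Schwarz[OF \<rho> U2] by linarith
  also have "\<dots> \<le> L2_norm M \<rho> * (inverse c * exp (\<Lambda> * S))"
    by (rule mult_left_mono[OF U_le \<rho>_nonneg])
  also have "\<dots> = N * exp (\<Lambda> * S)" by (simp add: N_def)
  finally have moment: "(\<integral>\<omega>. exp (\<kappa> * I \<omega>) \<partial>(\<mu> \<bind> P)) \<le> N * exp (\<Lambda> * S)" .
  have "measure (\<mu> \<bind> P) {\<omega> \<in> space (\<mu> \<bind> P). exp (\<kappa> * (S * r)) \<le> exp (\<kappa> * I \<omega>)}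
      \<le> (\<integral>\<omega>. exp (\<kappa> * I \<omega>) \<partial>(\<mu> \<bind> P)) / exp (\<kappa> * (S * r))"
  proof (rule integral_Markov_inequality_measure[OF _ sets.empty_sets])
    show "integrable (\<mu> \<bind> P) (\<lambda>\<omega>. exp (\<kappa> * I \<omega>))"
      by (rule \<mu>P.integrable_const_bound[of _ "exp (\<kappa> * (B * S))"]) (use eI_le in \<open>auto simp: space_bind\<close>)
  qed auto
  also have "\<dots> \<le> N * exp (\<Lambda> * S) / exp (\<kappa> * (S * r))"
    using moment by (rule divide_right_mono) simp
  also have "\<dots> = N * exp (- (S * (\<kappa> * r - \<Lambda>)))"
    by (simp add: exp_minus exp_diff[symmetric] field_simps flip: exp_add)
  also have "\<dots> = N * exp (- ln (2 * N / \<delta>))"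
    unfolding exponent using S by (simp add: L_def)
  also have "\<dots> = \<delta> / 2"
    using N1 \<delta> by (simp add: exp_minus)
  finally show ?thesis
    unfolding space_bind using \<kappa>(1) by (simp add: I_def r_def v_def b_def)
qed

end

theorem corollary1:
  fixes F :: "'w measure"
    and \<FF> :: "real \<Rightarrow> 'w measure"
    and X :: "real \<Rightarrow> 'w \<Rightarrow> 'a::polish_space"
    and P :: "'a \<Rightarrow> 'w measure"
    and \<mu>s \<mu> :: "'a measure"
    and ip :: "('a \<Rightarrow> real) \<Rightarrow> ('a \<Rightarrow> real) \<Rightarrow> real"
    and f fh \<rho> :: "'a \<Rightarrow> real"
    and c C \<alpha> T \<delta> N vp vm bp bm rp rm :: real
  defines "\<rho> \<equiv> (\<lambda>x. enn2real (RN_deriv \<mu>s \<mu> x))"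
    and "fh \<equiv> (\<lambda>x. f x - (\<integral>y. f y \<partial>\<mu>s))"
    and "N \<equiv> inverse c * L2_norm \<mu>s \<rho>"
    and "vp \<equiv> variance_const \<mu>s ip \<alpha> fh"
    and "vm \<equiv> variance_const \<mu>s ip \<alpha> (\<lambda>x. - fh x)"
    and "bp \<equiv> scale_const \<mu>s ip \<alpha> fh"
    and "bm \<equiv> scale_const \<mu>s ip \<alpha> (\<lambda>x. - fh x)"
    and "rp \<equiv> deviation_radius T \<delta> N vp bp"
    and "rm \<equiv> deviation_radius T \<delta> N vm bm"
  assumes markov: "cadlag_Markov_family F \<FF> X P"
    and mus_prob: "prob_space \<mu>s" "sets \<mu>s = sets borel"
    and invariant: "invariant_measure X P \<mu>s"
    and ergodic: "ergodic_measure X P \<mu>s"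
    and strong_cont: "strongly_continuous_L2 \<mu>s (Markov_semigroup X P)"
    and mu_prob: "prob_space \<mu>" "sets \<mu> = sets borel"
    and mu_density: "absolutely_continuous \<mu>s \<mu>" "\<rho> \<in> L2 \<mu>s"
    and ip: "L2_inner_product \<mu>s ip"
    and c_C: "0 < c" "c \<le> C"
    and norm_equiv: "\<forall>g\<in>L2 \<mu>s. c * L2_norm \<mu>s g \<le> ip_norm ip g \<and> ip_norm ip g \<le> C * L2_norm \<mu>s g"
    and ip_one: "\<forall>g\<in>L2 \<mu>s. ip g (\<lambda>_. 1) = L2_inner \<mu>s g (\<lambda>_. 1)"
    and alpha: "0 < \<alpha>"
    and poincare: "\<forall>g\<in>generator_domain \<mu>s (Markov_semigroup X P).
          (\<integral>x. g x \<partial>\<mu>s) = 0 \<longrightarrow>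
          (ip_norm ip g)\<^sup>2 \<le> \<alpha> * ip (\<lambda>x. - generator \<mu>s (Markov_semigroup X P) g x) g"
    and f_meas: "f \<in> borel_measurable borel"
    and f_bdd: "bounded (range f)"
    and f_nonconst: "\<not> (AE x in \<mu>s. fh x = 0)"
    and T: "0 < T"
    and delta: "0 < 1 - \<delta>" "1 - \<delta> < 1"
  shows "measure (\<mu> \<bind> P)
           {\<omega> \<in> space F.
              1 / T * (LINT t:{0..T}|lborel. f (X t \<omega>)) - (\<integral>x. f x \<partial>\<mu>s) \<in> {- rm<..<rp}}
         \<ge> 1 - \<delta>"
proof -
  interpret M: prob_space \<mu>s by (rule mus_prob)
  interpret Poincare_process F \<FF> X P \<mu>s ip c C \<alpha>
    by (intro Poincare_process.intro cadlag_Markov.intro equivalent_L2_form.intro L2_form.intro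
        Poincare_process_axioms.intro equivalent_L2_form_axioms.intro)
      (use assms in auto)
  obtain G where G: "\<And>x. \<bar>f x\<bar> \<le> G"
    using f_bdd by (auto simp: bounded_iff)
  define m where "m = (\<integral>x. f x \<partial>\<mu>s)"
  have f: "bounded_Borel G f" using f_meas G by (simp add: bounded_Borel_def)
  have int_f: "integrable \<mu>s f"
    by (rule M.integrable_const_bound[of _ G]) (use G f_meas measurable_cong_sets[OF mus_prob(2) refl] in auto)
  have fh: "bounded_Borel (G + \<bar>m\<bar>) fh"
    unfolding fh_def m_def by (rule bounded_Borel_diff[OF f bounded_Borel_const])
  have fh': "bounded_Borel (G + \<bar>m\<bar>) (\<lambda>x. - fh x)" using fh by (simp add: bounded_Borel_def)
  have mean: "(\<integral>x. fh x \<partial>\<mu>s) = 0" unfolding fh_def using int_f by (simp add: M.prob_space)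
  have d: "0 < \<delta>" "\<delta> < 1" using delta by auto
  define I where "I \<omega> = (LINT t:{0..T}|lborel. fh (X t \<omega>))" for \<omega>
  define A where "A = {\<omega> \<in> space F. T * rp \<le> I \<omega>}"
  define A' where "A' = {\<omega> \<in> space F. T * rm \<le> - I \<omega>}"
  have "\<mu> \<in> space (prob_algebra borel)" using mu_prob by (simp add: space_prob_algebra)
  then have sets_bind [measurable_cong]: "sets (\<mu> \<bind> P) = sets F" and prob: "prob_space (\<mu> \<bind> P)"
    using P_kernel by (rule sets_bind', rule prob_space_bind')
  interpret \<mu>P: prob_space "\<mu> \<bind> P" by (rule prob)
  have space_bind: "space (\<mu> \<bind> P) = space F" by (rule sets_eq_imp_space_eq[OF sets_bind])
  have [measurable]: "fh \<in> borel_measurable borel" "f \<in> borel_measurable borel"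
    using fh f by (auto dest: bounded_BorelD)
  have "I \<omega> = (LINT t:{0..T}|lborel. fh (Y t \<omega>))" for \<omega>
    unfolding I_def by (rule set_lebesgue_integral_cong) (auto simp: Y_def)
  then have I_eq: "I = (\<lambda>\<omega>. LINT t:{0..T}|lborel. fh (Y t \<omega>))" by (rule ext)
  have [measurable]: "I \<in> borel_measurable F"
    unfolding I_eq by (rule measurable_set_integral_Icc) measurable
  have AA: "A \<in> sets (\<mu> \<bind> P)" "A' \<in> sets (\<mu> \<bind> P)" unfolding A_def A'_def sets_bind by measurable
  have A_le: "measure (\<mu> \<bind> P) A \<le> \<delta> / 2"
    using upper_tail_bound[OF mu_prob mu_density(1) _ fh mean f_nonconst T d] mu_density(2)
    unfolding A_def I_def rp_def vp_def bp_def N_def \<rho>_def by simp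
  have A'_le: "measure (\<mu> \<bind> P) A' \<le> \<delta> / 2"
  proof -
    have "(LINT t:{0..T}|lborel. - fh (X t \<omega>)) = - I \<omega>" for \<omega>
      unfolding I_def by (simp add: set_lebesgue_integral_def)
    then show ?thesis
      using upper_tail_bound[OF mu_prob mu_density(1) _ fh' _ _ T d] mu_density(2) mean f_nonconst
      unfolding A'_def rm_def vm_def bm_def N_def \<rho>_def by simp
  qed
  have sub: "space (\<mu> \<bind> P) - (A \<union> A') \<subseteq>
      {\<omega> \<in> space F. 1 / T * (LINT t:{0..T}|lborel. f (X t \<omega>)) - m \<in> {- rm<..<rp}}"
  proof
    fix \<omega> assume "\<omega> \<in> space (\<mu> \<bind> P) - (A \<union> A')"
    then have \<omega>: "\<omega> \<in> space F" "I \<omega> < T * rp" "- I \<omega> < T * rm"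
      by (auto simp: space_bind A_def A'_def)
    have "(\<lambda>t. f (Y t \<omega>)) \<in> borel_measurable borel" using \<omega>(1) by measurable
    then have "set_integrable lborel {0..T} (\<lambda>t. f (Y t \<omega>))"
      using G by (rule set_integrable_bounded)
    moreover have "set_integrable lborel {0..T} (\<lambda>t. m)" by (rule set_integrable_bounded[of _ _ _ "\<bar>m\<bar>"]) auto
    ultimately have "(LINT t:{0..T}|lborel. f (Y t \<omega>) - m) = (LINT t:{0..T}|lborel. f (Y t \<omega>)) - m * T"
      using T by (simp add: set_integral_const_Icc)
    moreover have "(LINT t:{0..T}|lborel. f (Y t \<omega>) - m) = I \<omega>" "(LINT t:{0..T}|lborel. f (Y t \<omega>)) = (LINT t:{0..T}|lborel. f (X t \<omega>))"
      unfolding I_def by (auto intro!: set_lebesgue_integral_cong simp: Y_def fh_def m_def)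
    ultimately have "1 / T * (LINT t:{0..T}|lborel. f (X t \<omega>)) - m = I \<omega> / T"
      using T by (simp add: field_simps)
    moreover have "I \<omega> / T < rp" "- rm < I \<omega> / T" using \<omega> T by (simp_all add: field_simps)
    ultimately show "\<omega> \<in> {\<omega> \<in> space F. 1 / T * (LINT t:{0..T}|lborel. f (X t \<omega>)) - m \<in> {- rm<..<rp}}"
      using \<omega>(1) by simp
  qed
  have "1 - \<delta> \<le> 1 - measure (\<mu> \<bind> P) (A \<union> A')"
    using measure_Un_le[OF AA] A_le A'_le by linarith
  also have "\<dots> = measure (\<mu> \<bind> P) (space (\<mu> \<bind> P) - (A \<union> A'))"
    using AA by (intro \<mu>P.prob_compl[symmetric]) auto
  also have "\<dots> \<le> measure (\<mu> \<bind> P) {\<omega> \<in> space F. 1 / T * (LINT t:{0..T}|lborel. f (X t \<omega>)) - m \<in> {- rm<..<rp}}"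
  proof (rule \<mu>P.finite_measure_mono[OF sub])
    have "(LINT t:{0..T}|lborel. f (X t \<omega>)) = (LINT t:{0..T}|lborel. f (Y t \<omega>))" for \<omega>
      by (rule set_lebesgue_integral_cong) (auto simp: Y_def)
    moreover have "(\<lambda>\<omega>. LINT t:{0..T}|lborel. f (Y t \<omega>)) \<in> borel_measurable F"
      by (rule measurable_set_integral_Icc) measurable
    ultimately have [measurable]: "(\<lambda>\<omega>. LINT t:{0..T}|lborel. f (X t \<omega>)) \<in> borel_measurable F" by simp
    show "{\<omega> \<in> space F. 1 / T * (LINT t:{0..T}|lborel. f (X t \<omega>)) - m \<in> {- rm<..<rp}} \<in> sets (\<mu> \<bind> P)"
      unfolding sets_bind by measurable
  qed
  finally show ?thesis unfolding m_def .
qed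

end
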